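(* Let $\Omega\subset\mathbb{R}^N$ be a domain of class $C^2$ with boundary $\Gamma$. Let $x\in\Omega$ and assume that, for $R>0$, there exists a point $y_x\in\Gamma$ such that $\overline{B_R(x)}\cap(\mathbb{R}^N\setminus\Omega)=\{y_x\}$ and $\kappa_j(y_x)<1/R$ for $j=1,\dots,N-1$. Let $1<p\le\infty$, let $u$ be the bounded viscosity solution of $$u_t=\Delta_p^G u \ \text{ in } \Omega\times(0,\infty),\qquad u=0 \ \text{ on } \Omega\times\{0\},\qquad u=1\ \text{ on } \Gamma\times(0,\infty),$$ and, for $1<q\le\infty$, let $\mu_q(x,t)$ be the $q$-mean of $u(\cdot,t)$ on $B_R(x)$. Then, if $1<q<\infty$, $$\lim_{t\to0^+}\left(\frac{R^2}{t}\right)^{\frac{N+1}{4(q-1)}}\mu_q(x,t)=\left\{\frac{N!\int_0^\infty\mathrm{Erfc}(\sigma)^{q-1}\sigma^{\frac{N-1}{2}}\,d\sigma}{\Gamma\left(\frac{N+1}{2}\right)^2}\right\}^{\frac1{q-1}}\left\{(p')^{\frac{N+1}{2}}\,\Pi_\Gamma(y_x)\right\}^{-\frac1{2(q-1)}},$$ and $$\lim_{t\to0^+}\mu_\infty(x,t)=\frac12.$$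
   Context: $N\ge2$; a domain is a connected open set, not necessarily bounded, with nonempty boundary $\Gamma$. $p'=p/(p-1)$ for $1<p<\infty$ and $p'=1$ for $p=\infty$. $\kappa_1(y),\dots,\kappa_{N-1}(y)$ are the principal curvatures of $\Gamma$ at $y$ with respect to the interior normal direction to $\Gamma$ (positive for spheres bounding balls), and $\Pi_\Gamma(y)=\prod_{j=1}^{N-1}[1-R\,\kappa_j(y)]$. $\mathrm{Erfc}(\sigma)=\frac{2}{\sqrt\pi}\int_\sigma^\infty e^{-\tau^2}d\tau$. In the formula, $\Gamma\left(\frac{N+1}{2}\right)$ denotes Euler's gamma function. For $q\in[1,\infty]$, the $q$-mean of a continuous function $v$ on a ball $B$ is the unique $\mu\in\mathbb{R}$ with $\|v-\mu\|_{L^q(B)}\le\|v-\lambda\|_{L^q(B)}$ for all $\lambda\in\mathbb{R}$. Game-theoretic $p$-laplacian: $\Delta_p^Gu=\frac1p\Delta u+\left(1-\frac2p\right)\frac{\langle\nabla^2u\,\nabla u,\nabla u\rangle}{|\nabla u|^2}$ (with $1/p=0$ if $p=\infty$), i.e. $\Delta_p^Gu=-F(\nabla u,\nabla^2u)$ where, for $\xi\in\mathbb{R}^N\setminus\{0\}$ and $X$ a symmetric $N\times N$ matrix, $F(\xi,X)=-\mathrm{tr}[A(\xi)X]$, $A(\xi)=\frac1pI+\left(1-\frac2p\right)\frac{\xi\otimes\xi}{|\xi|^2}$. The semicontinuous envelopes are $F_*(\xi,X)=\lim_{\delta\to0^+}\inf\{F(\eta,Y):\eta\ne0,|\eta-\xi|<\delta,|Y-X|<\delta\}$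 and $F^*=-(-F)_*$. Viscosity solutions of $u_t=\Delta_p^Gu$ in $\Omega\times(0,\infty)$: an upper semicontinuous $u$ is a subsolution if $\phi_t+F_*(\nabla\phi,\nabla^2\phi)\le0$ at $(x,t)$ whenever $\phi\in C^2(\Omega\times(0,\infty))$ and $u-\phi$ attains its maximum at $(x,t)$; a lower semicontinuous $v$ is a supersolution if $\psi_t+F^*(\nabla\psi,\nabla^2\psi)\ge0$ at $(x,t)$ whenever $\psi\in C^2(\Omega\times(0,\infty))$ and $v-\psi$ attains its minimum at $(x,t)$; a solution is both. The initial and boundary values are attained continuously on $\Omega\times\{0\}$ and $\Gamma\times(0,\infty)$; the bounded viscosity solution of the problem is unique by comparison. *)

theory Defs
  imports "HOL-Analysis.Analysis" "HOL-Probability.Essential_Supremum"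
begin

text \<open>Since derivatives are taken in the whole space, this is the class \<open>C\<^sup>2(S)\<close> only for
  open \<open>S\<close>.\<close>

definition C2_on :: "('a::real_normed_vector \<Rightarrow> real) \<Rightarrow> 'a set \<Rightarrow> bool" where
  "C2_on f S \<longleftrightarrow>
     (\<exists>(f' :: 'a \<Rightarrow> 'a \<Rightarrow>\<^sub>L real) (f'' :: 'a \<Rightarrow> 'a \<Rightarrow>\<^sub>L 'a \<Rightarrow>\<^sub>L real).
        (\<forall>x\<in>S. (f has_derivative blinfun_apply (f' x)) (at x)) \<and>
        (\<forall>x\<in>S. (f' has_derivative blinfun_apply (f'' x)) (at x)) \<and>
        continuous_on S f'')"

definition grad :: "(real^'n \<Rightarrow> real) \<Rightarrow> real^'n \<Rightarrow> real^'n" where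
  "grad f x = (\<chi> i. frechet_derivative f (at x) (axis i 1))"

definition hessian :: "(real^'n \<Rightarrow> real) \<Rightarrow> real^'n \<Rightarrow> real^'n^'n" where
  "hessian f x = jacobian (grad f) (at x)"

definition usc_on :: "'a::topological_space set \<Rightarrow> ('a \<Rightarrow> real) \<Rightarrow> bool" where
  "usc_on S f \<longleftrightarrow> (\<forall>x\<in>S. \<forall>c>f x. \<forall>\<^sub>F y in at x within S. f y < c)"

definition lsc_on :: "'a::topological_space set \<Rightarrow> ('a \<Rightarrow> real) \<Rightarrow> bool" where
  "lsc_on S f \<longleftrightarrow> (\<forall>x\<in>S. \<forall>c<f x. \<forall>\<^sub>F y in at x within S. f y > c)"

text \<open>In the neighbourhood \<open>U\<close> of \<open>y\<close> the set \<open>\<Omega>\<close> is the region above the graph, in the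
  direction of the unit vector \<open>e\<close>, of a \<open>C\<^sup>2\<close> function of the hyperplane coordinate
  \<open>z - (z \<bullet> e) e\<close>. The function \<open>g\<close> is defined on the whole space, but only its values on the
  hyperplane orthogonal to \<open>e\<close> matter.\<close>

definition C2_graph_at ::
    "(real^'n) set \<Rightarrow> real^'n \<Rightarrow> real^'n \<Rightarrow> (real^'n \<Rightarrow> real) \<Rightarrow> bool" where
  "C2_graph_at \<Omega> y e g \<longleftrightarrow>
     norm e = 1 \<and> C2_on g UNIV \<and>
     (\<exists>U. open U \<and> y \<in> U \<and> \<Omega> \<inter> U = {z \<in> U. g (z - (z \<bullet> e) *\<^sub>R e) < z \<bullet> e})"

definition C2_domain :: "(real^'n) set \<Rightarrow> bool" where
  "C2_domain \<Omega> \<longleftrightarrow>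
     open \<Omega> \<and> connected \<Omega> \<and> frontier \<Omega> \<noteq> {} \<and>
     (\<forall>y\<in>frontier \<Omega>. \<exists>e g. C2_graph_at \<Omega> y e g)"

text \<open>\<open>\<kappa> 1, \<dots>, \<kappa> (N - 1)\<close> are the principal curvatures at \<open>y\<close>, listed with multiplicity:
  when the boundary is written as a graph over its tangent hyperplane at \<open>y\<close>, with \<open>e\<close> the
  interior unit normal, they are the eigenvalues of the Hessian of the graph function on that
  hyperplane, for an orthonormal basis \<open>v\<close> of principal directions. Since \<open>\<Omega>\<close> lies on the
  side into which \<open>e\<close> points, the curvatures of a sphere bounding a ball are positive.\<close>

definition principal_curvatures ::
    "(real^'n) set \<Rightarrow> real^'n \<Rightarrow> (nat \<Rightarrow> real) \<Rightarrow> bool" where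
  "principal_curvatures \<Omega> y \<kappa> \<longleftrightarrow>
     (\<exists>e g v. C2_graph_at \<Omega> y e g \<and>
        (let y' = y - (y \<bullet> e) *\<^sub>R e; J = {1..CARD('n) - 1} in
          (\<forall>h. h \<bullet> e = 0 \<longrightarrow> grad g y' \<bullet> h = 0) \<and>
          (\<forall>i\<in>J. v i \<bullet> e = 0) \<and>
          (\<forall>i\<in>J. \<forall>j\<in>J. v i \<bullet> v j = (if i = j then 1 else 0)) \<and>
          (\<forall>i\<in>J. \<forall>h. h \<bullet> e = 0 \<longrightarrow> (hessian g y' *v v i) \<bullet> h = \<kappa> i * (v i \<bullet> h))))"

definition game_A :: "ereal \<Rightarrow> real^'n \<Rightarrow> real^'n^'n" where
  "game_A p \<xi> =
     real_of_ereal (1 / p) *\<^sub>R mat 1 +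
     (1 - 2 * real_of_ereal (1 / p)) *\<^sub>R (\<chi> i j. \<xi> $ i * \<xi> $ j / (norm \<xi>)\<^sup>2)"

definition game_F :: "ereal \<Rightarrow> real^'n \<Rightarrow> real^'n^'n \<Rightarrow> real" where
  "game_F p \<xi> X = - trace (game_A p \<xi> ** X)"

text \<open>The matrix argument ranges over symmetric matrices only, whence \<open>transpose Y = Y\<close>.\<close>

definition lower_env ::
    "(real^'n \<Rightarrow> real^'n^'n \<Rightarrow> real) \<Rightarrow> real^'n \<Rightarrow> real^'n^'n \<Rightarrow> real" where
  "lower_env F \<xi> X =
     Lim (at_right 0) (\<lambda>\<delta>. Inf {F \<eta> Y | \<eta> Y.
        \<eta> \<noteq> 0 \<and> transpose Y = Y \<and> norm (\<eta> - \<xi>) < \<delta> \<and> norm (Y - X) < \<delta>})"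

definition upper_env ::
    "(real^'n \<Rightarrow> real^'n^'n \<Rightarrow> real) \<Rightarrow> real^'n \<Rightarrow> real^'n^'n \<Rightarrow> real" where
  "upper_env F \<xi> X = - lower_env (\<lambda>\<eta> Y. - F \<eta> Y) \<xi> X"

definition viscosity_subsolution ::
    "ereal \<Rightarrow> (real^'n) set \<Rightarrow> (real^'n \<Rightarrow> real \<Rightarrow> real) \<Rightarrow> bool" where
  "viscosity_subsolution p \<Omega> u \<longleftrightarrow>
     usc_on (\<Omega> \<times> {0<..}) (\<lambda>(x, t). u x t) \<and>
     (\<forall>\<phi>. C2_on (\<lambda>(x, t). \<phi> x t) (\<Omega> \<times> {0<..}) \<longrightarrow>
       (\<forall>x\<in>\<Omega>. \<forall>t>0.
          (\<forall>z\<in>\<Omega>. \<forall>s>0. u z s - \<phi> z s \<le> u x t - \<phi> x t) \<longrightarrow>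
          deriv (\<phi> x) t
            + lower_env (game_F p) (grad (\<lambda>z. \<phi> z t) x) (hessian (\<lambda>z. \<phi> z t) x) \<le> 0))"

definition viscosity_supersolution ::
    "ereal \<Rightarrow> (real^'n) set \<Rightarrow> (real^'n \<Rightarrow> real \<Rightarrow> real) \<Rightarrow> bool" where
  "viscosity_supersolution p \<Omega> v \<longleftrightarrow>
     lsc_on (\<Omega> \<times> {0<..}) (\<lambda>(x, t). v x t) \<and>
     (\<forall>\<psi>. C2_on (\<lambda>(x, t). \<psi> x t) (\<Omega> \<times> {0<..}) \<longrightarrow>
       (\<forall>x\<in>\<Omega>. \<forall>t>0.
          (\<forall>z\<in>\<Omega>. \<forall>s>0. v z s - \<psi> z s \<ge> v x t - \<psi> x t) \<longrightarrow>
          deriv (\<psi> x) t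
            + upper_env (game_F p) (grad (\<lambda>z. \<psi> z t) x) (hessian (\<lambda>z. \<psi> z t) x) \<ge> 0))"

definition viscosity_solution ::
    "ereal \<Rightarrow> (real^'n) set \<Rightarrow> (real^'n \<Rightarrow> real \<Rightarrow> real) \<Rightarrow> bool" where
  "viscosity_solution p \<Omega> u \<longleftrightarrow>
     viscosity_subsolution p \<Omega> u \<and> viscosity_supersolution p \<Omega> u"

text \<open>Bounded viscosity solution with initial value \<open>0\<close> and boundary value \<open>1\<close>. These values
  are attained continuously, but there is no continuity at the points of
  \<open>frontier \<Omega> \<times> {0}\<close>, where the data are incompatible.\<close>

definition bounded_viscosity_solution_01 ::
    "ereal \<Rightarrow> (real^'n) set \<Rightarrow> (real^'n \<Rightarrow> real \<Rightarrow> real) \<Rightarrow> bool" where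
  "bounded_viscosity_solution_01 p \<Omega> u \<longleftrightarrow>
     viscosity_solution p \<Omega> u \<and>
     bounded ((\<lambda>(x, t). u x t) ` (\<Omega> \<times> {0<..})) \<and>
     (\<forall>x\<in>\<Omega>. u x 0 = 0) \<and>
     (\<forall>y\<in>frontier \<Omega>. \<forall>t>0. u y t = 1) \<and>
     continuous_on (\<Omega> \<times> {0..} \<union> frontier \<Omega> \<times> {0<..}) (\<lambda>(x, t). u x t)"

text \<open>The \<open>L\<^sup>q(B)\<close> norm, \<open>1 \<le> q \<le> \<infinity>\<close>, as a real number; it is meaningful only for functions
  whose norm is finite, such as bounded measurable ones on a ball.\<close>

definition Lq_norm :: "ereal \<Rightarrow> (real^'n) set \<Rightarrow> (real^'n \<Rightarrow> real) \<Rightarrow> real" where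
  "Lq_norm q B f =
     (if q = \<infinity> then real_of_ereal (esssup (lebesgue_on B) (\<lambda>z. ereal \<bar>f z\<bar>))
      else (LINT z|lebesgue_on B. \<bar>f z\<bar> powr real_of_ereal q) powr (1 / real_of_ereal q))"

definition q_mean :: "ereal \<Rightarrow> (real^'n) set \<Rightarrow> (real^'n \<Rightarrow> real) \<Rightarrow> real" where
  "q_mean q B v =
     (THE \<mu>. \<forall>c. Lq_norm q B (\<lambda>z. v z - \<mu>) \<le> Lq_norm q B (\<lambda>z. v z - c))"

definition conj_exponent :: "ereal \<Rightarrow> real" where
  "conj_exponent p = (if p = \<infinity> then 1 else real_of_ereal p / (real_of_ereal p - 1))"

definition Erfc :: "real \<Rightarrow> real" where
  "Erfc \<sigma> = 2 / sqrt pi * (LBINT \<tau>:{\<sigma>..}. exp (- \<tau>\<^sup>2))"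

end

theory Submission
  imports Defs "HOL-Probability.Distributions" "HOL-Real_Asymp.Real_Asymp"
begin

text \<open>Radial functions \<open>\<phi>(|z - c|\<^sup>2, t)\<close> have a gradient of known direction, so on them the
  operator is explicit and linear up to the single point \<open>c\<close>; comparison with them replaces the
  general comparison principle. Barriers built from \<open>Erfc\<close> of \<open>(r\<^sup>2 - |z - c|\<^sup>2) / (2 r \<surd>t)\<close> with a drift,
  for interior and exterior tangent balls, give \<open>u \<approx> Erfc (\<surd>p' d / (2 \<surd>t))\<close> near the touching point,
  where \<open>d\<close> is the distance to the boundary. The initial and boundary data do not match at the
  corners \<open>frontier \<Omega> \<times> {0}\<close>, so \<open>0 \<le> u \<le> 1\<close> needs an iteration there.

  After the parabolic scaling \<open>z = y + t\<^sup>1\<^sup>/\<^sup>4 \<zeta> + t\<^sup>1\<^sup>/\<^sup>2 \<eta> e\<close>, dominated convergence yields the limit of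
  \<open>t\<close> to the power \<open>- (N + 1) / 4\<close> times the integral of \<open>u\<close> to the power \<open>q - 1\<close>; the dominating
  function comes from an interior tangent ball slightly larger than \<open>B\<^sub>R\<close>, which exists because
  \<open>\<kappa>\<^sub>j < 1 / R\<close>. Finally \<open>\<mu>\<close> is the zero of \<open>\<integral>(u - \<mu>)\<^sub>+ - \<integral>(\<mu> - u)\<^sub>+\<close>, both integrands to the power
  \<open>q - 1\<close>, and the second integral behaves like \<open>\<mu>\<close> to the power \<open>q - 1\<close> times the volume of the ball;
  for \<open>q = \<infinity>\<close> the mean is half the sum of the infimum and the supremum.\<close>

section \<open>The complementary error function\<close>

text \<open>The scales explain the exponent. Over a tangential distance \<open>t^(1/4)\<close> the
  sphere leaves its tangent plane by the width \<open>t^(1/2)\<close> of the boundary layer, so the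
  Jacobian of the scaling is \<open>t^((N-1)/4 + 1/2)\<close>; the root of order
  \<open>q - 1\<close> is taken at the end. In the limit the sphere and the boundary differ by the
  quadratic form with eigenvalues \<open>(1/R - kappa_j)/2\<close>; its determinant to the power
  \<open>-1/2\<close> yields the curvature product. In the barriers
  \<open>(r^2 - |z - c|^2)/(2 r)\<close> stands for the distance \<open>r - |z - c|\<close>: it
  agrees to first order at the sphere and is smooth at \<open>c\<close>. Its second-order error and
  the drift are negligible against \<open>t^(1/2)\<close> in the layer, so the inner and outer
  barriers have the same limit. The upper barrier times any bound \<open>M\<close> for
  \<open>u\<close> needs no information at the corners, because it is at least \<open>M\<close>
  outside its ball. The sharp factor 1 and the lower barrier need \<open>0 \<le> u \<le> 1\<close>;
  hence the corner iteration precedes the asymptotics. For \<open>q = \<infinity>\<close> the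
  supremum over the ball is 1 at every positive time while the infimum tends to 0.\<close>

lemma integrable_gauss: "integrable lborel (\<lambda>\<tau>::real. exp (- \<tau>\<^sup>2))"
proof -
  have "integrable lborel (\<lambda>\<tau>. sqrt pi * normal_density 0 (1 / sqrt 2) \<tau>)"
    by (intro integrable_mult_right integrable_normal_density) simp
  then show ?thesis
    by (simp add: normal_density_def power_divide)
qed

lemma set_integrable_gauss: "A \<in> sets borel \<Longrightarrow> set_integrable lborel A (\<lambda>\<tau>::real. exp (- \<tau>\<^sup>2))"
  unfolding set_integrable_def using integrable_mult_indicator[of A lborel, OF _ integrable_gauss] by auto

lemma Erfc_split:
  assumes "a \<le> b"
  shows "Erfc a = 2 / sqrt pi * integral {a..b} (\<lambda>\<tau>. exp (- \<tau>\<^sup>2)) + Erfc b"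
proof -
  have "(LBINT \<tau>:{a..b}\<union>{b<..}. exp (- \<tau>\<^sup>2)) = (LBINT \<tau>:{a..b}. exp (- \<tau>\<^sup>2)) + (LBINT \<tau>:{b<..}. exp (- \<tau>\<^sup>2))"
    by (intro set_integral_Un set_integrable_gauss) auto
  moreover have "{a..b}\<union>{b<..} = {a..}" using assms by auto
  moreover have "(LBINT \<tau>:{b<..}. exp (- \<tau>\<^sup>2)) = (LBINT \<tau>:{b..}. exp (- \<tau>\<^sup>2))"
    unfolding set_lebesgue_integral_def
    by (rule integral_cong_AE) (auto intro!: AE_I[where N="{b}"] simp: indicator_def)
  moreover have "(LBINT \<tau>:{a..b}. exp (- \<tau>\<^sup>2)) = integral {a..b} (\<lambda>\<tau>. exp (- \<tau>\<^sup>2))"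
    by (intro set_borel_integral_eq_integral set_integrable_gauss) auto
  ultimately show ?thesis by (simp add: Erfc_def algebra_simps)
qed

lemma Erfc_has_real_derivative [derivative_intros]:
  "(Erfc has_real_derivative - 2 / sqrt pi * exp (- \<sigma>\<^sup>2)) (at \<sigma>)"
proof -
  have "((\<lambda>u. integral {\<sigma>-1..u} (\<lambda>\<tau>. exp (- \<tau>\<^sup>2))) has_real_derivative exp (- \<sigma>\<^sup>2)) (at \<sigma> within {\<sigma>-1..\<sigma>+1})"
    by (rule integral_has_real_derivative) (auto intro!: continuous_intros)
  then have d: "((\<lambda>u. integral {\<sigma>-1..u} (\<lambda>\<tau>. exp (- \<tau>\<^sup>2))) has_real_derivative exp (- \<sigma>\<^sup>2)) (at \<sigma>)"
    by (simp add: at_within_Icc_at)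
  have "((\<lambda>u. Erfc (\<sigma> - 1) - 2 / sqrt pi * integral {\<sigma>-1..u} (\<lambda>\<tau>. exp (- \<tau>\<^sup>2)))
      has_real_derivative - 2 / sqrt pi * exp (- \<sigma>\<^sup>2)) (at \<sigma>)"
    using DERIV_diff[OF DERIV_const DERIV_cmult[OF d, of "2 / sqrt pi"], of "Erfc (\<sigma> - 1)"] by simp
  moreover have "Erfc (\<sigma> - 1) - 2 / sqrt pi * integral {\<sigma>-1..u} (\<lambda>\<tau>. exp (- \<tau>\<^sup>2)) = Erfc u"
    if "u \<in> {\<sigma>-1<..}" for u
    using Erfc_split[of "\<sigma> - 1" u] that by simp
  ultimately show ?thesis
    using has_field_derivative_transform_within_open[where S="{\<sigma>-1<..}" and g=Erfc] by auto
qed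

lemma continuous_on_Erfc [continuous_intros]:
  "continuous_on S h \<Longrightarrow> continuous_on S (\<lambda>x. Erfc (h x))"
  using continuous_on_compose2[of UNIV Erfc S h]
  by (simp add: DERIV_continuous_on[OF Erfc_has_real_derivative[THEN has_field_derivative_at_within]])

lemma isCont_Erfc: "isCont Erfc x"
  using Erfc_has_real_derivative by (rule DERIV_isCont)

lemma borel_measurable_Erfc [measurable]: "Erfc \<in> borel_measurable borel"
  by (intro borel_measurable_continuous_onI continuous_intros)

lemma Erfc_strict_antimono:
  assumes "a < b"
  shows "Erfc b < Erfc a"
proof (rule DERIV_neg_imp_decreasing[OF assms])
  show "\<exists>y. (Erfc has_real_derivative y) (at x) \<and> y < 0" for x
    using Erfc_has_real_derivative[of x] by (intro exI[of _ "- 2 / sqrt pi * exp (- x\<^sup>2)"]) simp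
qed

lemma Erfc_antimono: "a \<le> b \<Longrightarrow> Erfc b \<le> Erfc a"
  using Erfc_strict_antimono[of a b] by (cases "a = b") auto

lemma Erfc_nonneg: "0 \<le> Erfc x"
  by (auto simp: Erfc_def set_lebesgue_integral_def intro!: mult_nonneg_nonneg integral_nonneg)

lemma Erfc_pos: "0 < Erfc x"
  using Erfc_strict_antimono[of x "x+1"] Erfc_nonneg[of "x+1"] by simp

lemma Erfc_0 [simp]: "Erfc 0 = 1"
  using gaussian_moment_0[THEN has_bochner_integral_integral_eq]
  by (simp add: Erfc_def set_lebesgue_integral_def)

text \<open>By \<open>0 \<le> (\<tau> - 1/2)^2\<close> the Gaussian is at most
  \<open>exp (1/4 - \<tau>)\<close>, whose tail integral is explicit. This rate is weaker than the
  true one but is enough for every domination argument.\<close>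

lemma Erfc_le_exp: "Erfc x \<le> 2 / sqrt pi * exp (1/4 - x)"
proof -
  have *: "(\<integral>\<^sup>+\<tau>. ennreal (exp (1/4 - \<tau>)) * indicator {x..} \<tau> \<partial>lborel) = 0 - (- exp (1/4 - x))"
  proof (rule nn_integral_FTC_atLeast)
    show "((\<lambda>y::real. - exp (1 / 4 - y)) \<longlongrightarrow> 0) at_top"
      by real_asymp
  qed (auto intro!: derivative_eq_intros)
  have "(LBINT \<tau>:{x..}. exp (- \<tau>\<^sup>2)) \<le> exp (1/4 - x)"
  proof (rule ennreal_le_iff[THEN iffD1])
    have "ennreal (LBINT \<tau>:{x..}. exp (- \<tau>\<^sup>2)) = (\<integral>\<^sup>+\<tau>. ennreal (indicator {x..} \<tau> *\<^sub>R exp (- \<tau>\<^sup>2)) \<partial>lborel)"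
      unfolding set_lebesgue_integral_def
      using set_integrable_gauss[of "{x..}"] unfolding set_integrable_def
      by (intro nn_integral_eq_integral[symmetric]) auto
    also have "\<dots> \<le> (\<integral>\<^sup>+\<tau>. ennreal (exp (1/4 - \<tau>)) * indicator {x..} \<tau> \<partial>lborel)"
    proof (rule nn_integral_mono)
      fix \<tau> :: real
      have "0 \<le> (\<tau> - 1/2)\<^sup>2" by simp
      then have "- \<tau>\<^sup>2 \<le> 1/4 - \<tau>" by (simp add: power2_eq_square algebra_simps)
      then show "ennreal (indicator {x..} \<tau> *\<^sub>R exp (- \<tau>\<^sup>2)) \<le> ennreal (exp (1/4 - \<tau>)) * indicator {x..} \<tau>"
        by (auto simp: indicator_def intro!: ennreal_leI)
    qed
    finally show "ennreal (LBINT \<tau>:{x..}. exp (- \<tau>\<^sup>2)) \<le> ennreal (exp (1/4 - x))"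
      using * by simp
  qed simp
  then show ?thesis unfolding Erfc_def by (intro mult_left_mono) auto
qed

lemma Erfc_at_top: "(Erfc \<longlongrightarrow> 0) at_top"
proof (rule tendsto_sandwich[OF _ _ tendsto_const])
  show "((\<lambda>x::real. 2 / sqrt pi * exp (1/4 - x)) \<longlongrightarrow> 0) at_top" by real_asymp
qed (use Erfc_nonneg Erfc_le_exp in \<open>auto intro!: always_eventually\<close>)

section \<open>Twice continuously differentiable functions\<close>

lemma C2_on_const: "C2_on (\<lambda>x. c) S"
  unfolding C2_on_def by (intro exI[of _ "\<lambda>x. 0"]) (auto intro!: derivative_eq_intros continuous_intros)

lemma C2_on_linear:
  assumes "bounded_linear f"
  shows "C2_on f S"
  unfolding C2_on_def using assms
  by (intro exI[of _ "\<lambda>x. Blinfun f"] exI[of _ "\<lambda>x. 0"])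
     (auto simp: bounded_linear_Blinfun_apply bounded_linear_imp_has_derivative zero_blinfun.rep_eq)

lemma C2_on_continuous_on: "C2_on f S \<Longrightarrow> continuous_on S f"
  unfolding C2_on_def
  by (meson continuous_at_imp_continuous_on has_derivative_continuous)

lemma C2_on_cong:
  assumes "C2_on f S" "open S" "\<And>x. x \<in> S \<Longrightarrow> f x = g x"
  shows "C2_on g S"
proof -
  obtain f' f'' where f: "\<forall>x\<in>S. (f has_derivative blinfun_apply (f' x)) (at x)"
    "\<forall>x\<in>S. (f' has_derivative blinfun_apply (f'' x)) (at x)" "continuous_on S f''"
    using assms(1) unfolding C2_on_def by blast
  have "\<forall>x\<in>S. (g has_derivative blinfun_apply (f' x)) (at x)"
  proof
    fix x assume x: "x \<in> S"
    show "(g has_derivative blinfun_apply (f' x)) (at x)"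
      by (rule has_derivative_transform_within_open[OF f(1)[rule_format, OF x] assms(2) x assms(3)])
  qed
  then show ?thesis using f(2,3) unfolding C2_on_def by blast
qed

lemma C2_on_add:
  assumes "C2_on f S" "C2_on g S"
  shows "C2_on (\<lambda>x. f x + g x) S"
proof -
  obtain f' f'' where f: "\<forall>x\<in>S. (f has_derivative blinfun_apply (f' x)) (at x)"
    "\<forall>x\<in>S. (f' has_derivative blinfun_apply (f'' x)) (at x)" "continuous_on S f''"
    using assms(1) unfolding C2_on_def by blast
  obtain g' g'' where g: "\<forall>x\<in>S. (g has_derivative blinfun_apply (g' x)) (at x)"
    "\<forall>x\<in>S. (g' has_derivative blinfun_apply (g'' x)) (at x)" "continuous_on S g''"
    using assms(2) unfolding C2_on_def by blast
  show ?thesis unfolding C2_on_def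
    apply (intro exI[of _ "\<lambda>x. f' x + g' x"] exI[of _ "\<lambda>x. f'' x + g'' x"])
    using f g by (auto simp: blinfun.bilinear_simps plus_blinfun.rep_eq intro!: derivative_eq_intros continuous_intros)
qed

lemma C2_on_compose:
  assumes "C2_on f S"
    and h: "\<And>x. x \<in> S \<Longrightarrow> (h has_real_derivative h1 (f x)) (at (f x))"
    and h1: "\<And>x. x \<in> S \<Longrightarrow> (h1 has_real_derivative h2 (f x)) (at (f x))"
    and h2: "\<And>x. x \<in> S \<Longrightarrow> isCont h2 (f x)"
  shows "C2_on (\<lambda>x. h (f x)) S"
proof -
  obtain f' f'' where f: "\<And>x. x \<in> S \<Longrightarrow> (f has_derivative blinfun_apply (f' x)) (at x)"
    "\<And>x. x \<in> S \<Longrightarrow> (f' has_derivative blinfun_apply (f'' x)) (at x)" "continuous_on S f''"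
    using assms(1) unfolding C2_on_def by blast
  have cf: "continuous_on S f" by (rule C2_on_continuous_on) fact
  have cf': "continuous_on S f'"
    using f(2) by (meson continuous_at_imp_continuous_on has_derivative_continuous)
  have c: "continuous_on S (\<lambda>x. k (f x))" if "\<And>x. x \<in> S \<Longrightarrow> isCont k (f x)" for k :: "real \<Rightarrow> real"
    using that continuous_on_compose2[OF continuous_at_imp_continuous_on[of "f ` S" k] cf] by auto
  let ?F1 = "\<lambda>x. h1 (f x) *\<^sub>R f' x"
  \<comment> \<open>The second summand is \<open>h2 (f x)\<close> times the square of the functional
    \<open>f' x\<close>, written as a map into functionals: \<open>v\<close> goes to
    \<open>f' x v\<close> times \<open>f' x\<close>.\<close>
  let ?F2 = "\<lambda>x. h1 (f x) *\<^sub>R f'' x + h2 (f x) *\<^sub>R (blinfun_scaleR_left (f' x) o\<^sub>L f' x)"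
  have "((\<lambda>x. h (f x)) has_derivative blinfun_apply (?F1 x)) (at x)" if "x \<in> S" for x
    using has_derivative_compose[OF f(1)[OF that] h[OF that, unfolded has_field_derivative_def]]
    by (simp add: scaleR_blinfun.rep_eq)
  moreover have "(?F1 has_derivative blinfun_apply (?F2 x)) (at x)" if "x \<in> S" for x
  proof -
    have "((\<lambda>x. h1 (f x)) has_derivative (\<lambda>v. h2 (f x) * f' x v)) (at x)"
      using has_derivative_compose[OF f(1)[OF that] h1[OF that, unfolded has_field_derivative_def]] .
    from has_derivative_scaleR[OF this f(2)[OF that]]
    show ?thesis
      by (rule has_derivative_eq_rhs)
         (auto simp: blinfun.bilinear_simps intro!: blinfun_eqI)
  qed
  moreover have "continuous_on S ?F2"
    using h1 h2 by (intro continuous_intros c f(3) cf' bounded_linear.continuous_on[OF bounded_linear_blinfun_scaleR_left])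
       (auto intro: DERIV_isCont)
  ultimately show ?thesis unfolding C2_on_def by (intro exI[of _ ?F1] exI[of _ ?F2]) simp
qed

text \<open>Polarization, \<open>f g = ((f + g)^2 - (f - g)^2) / 4\<close>, reduces products to sums
  and composition with the square.\<close>

lemma C2_on_mult:
  assumes "C2_on f S" "C2_on g S"
  shows "C2_on (\<lambda>x. f x * g x) S"
proof -
  have sq: "C2_on (\<lambda>x. (h x)\<^sup>2) S" if "C2_on h S" for h
    by (rule C2_on_compose[OF that, of "\<lambda>x. x\<^sup>2" "\<lambda>x. 2 * x" "\<lambda>x. 2"]) (auto intro!: derivative_eq_intros)
  have cm: "C2_on (\<lambda>x. c * h x) S" if "C2_on h S" for c h
    by (rule C2_on_compose[OF that, of "\<lambda>x. c * x" "\<lambda>x. c" "\<lambda>x. 0"]) (auto intro!: derivative_eq_intros)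
  have "C2_on (\<lambda>x. 1/4 * (f x + g x)\<^sup>2 + (-1/4) * (f x + (-1) * g x)\<^sup>2) S"
    by (intro C2_on_add cm sq assms)
  then show ?thesis by (simp add: power2_eq_square algebra_simps)
qed

lemma C2_on_cmult: "C2_on f S \<Longrightarrow> C2_on (\<lambda>x. c * f x) S"
  by (intro C2_on_mult C2_on_const)

lemma C2_on_minus: "C2_on f S \<Longrightarrow> C2_on (\<lambda>x. - f x) S"
  using C2_on_cmult[of f S "-1"] by simp

lemma C2_on_diff: "C2_on f S \<Longrightarrow> C2_on g S \<Longrightarrow> C2_on (\<lambda>x. f x - g x) S"
  using C2_on_add[OF _ C2_on_minus, of f S g] by simp

lemma C2_on_sum: "(\<And>i. i \<in> I \<Longrightarrow> C2_on (f i) S) \<Longrightarrow> C2_on (\<lambda>x. \<Sum>i\<in>I. f i x) S"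
  by (induction I rule: infinite_finite_induct) (auto intro: C2_on_const C2_on_add)

lemma C2_on_power: "C2_on f S \<Longrightarrow> C2_on (\<lambda>x. (f x) ^ n) S"
  by (induction n) (auto intro: C2_on_const C2_on_mult)

lemma C2_on_exp: "C2_on f S \<Longrightarrow> C2_on (\<lambda>x. exp (f x)) S"
  by (rule C2_on_compose[of f S exp exp exp]) auto

lemma C2_on_Erfc:
  assumes "C2_on f S"
  shows "C2_on (\<lambda>x. Erfc (f x)) S"
proof (rule C2_on_compose[OF assms])
  show "(Erfc has_real_derivative - 2 / sqrt pi * exp (- (f x)\<^sup>2)) (at (f x))" for x
    by (rule Erfc_has_real_derivative)
  have "((\<lambda>x::real. exp (- x\<^sup>2)) has_real_derivative exp (- y\<^sup>2) * - (2 * y)) (at y)" for y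
    by (auto intro!: derivative_eq_intros)
  then show "((\<lambda>x. - 2 / sqrt pi * exp (- x\<^sup>2)) has_real_derivative
      - 2 / sqrt pi * (exp (- (f x)\<^sup>2) * - (2 * f x))) (at (f x))" for x
    by (rule DERIV_cmult)
qed (intro continuous_intros, simp)

lemma C2_on_powr:
  assumes "C2_on f S" and pos: "\<And>x. x \<in> S \<Longrightarrow> 0 < f x"
  shows "C2_on (\<lambda>x. f x powr r) S"
proof (rule C2_on_compose[OF assms(1)])
  fix x assume "x \<in> S"
  then have x: "0 < f x" by (rule pos)
  show "((\<lambda>x. x powr r) has_real_derivative r * f x powr (r - 1)) (at (f x))"
    by (rule has_real_derivative_powr[OF x])
  show "((\<lambda>x. r * x powr (r - 1)) has_real_derivative r * ((r - 1) * f x powr (r - 1 - 1))) (at (f x))"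
    by (rule DERIV_cmult[OF has_real_derivative_powr[OF x]])
  show "isCont (\<lambda>x. r * ((r - 1) * x powr (r - 1 - 1))) (f x)"
    using x by (intro continuous_intros) auto
qed

lemma C2_on_dist_square:
  fixes c :: "real^'n"
  shows "C2_on (\<lambda>(z, t::real). (norm (z - c))\<^sup>2) S"
proof -
  have "C2_on (\<lambda>x::(real^'n) \<times> real. \<Sum>i\<in>UNIV. (fst x $ i - c $ i)\<^sup>2) S"
    by (intro C2_on_sum C2_on_power C2_on_diff C2_on_const C2_on_linear
        bounded_linear_compose[OF bounded_linear_vec_nth bounded_linear_fst])
  also have "(\<lambda>x::(real^'n) \<times> real. \<Sum>i\<in>UNIV. (fst x $ i - c $ i)\<^sup>2) = (\<lambda>(z, t). (norm (z - c))\<^sup>2)"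
    by (simp add: fun_eq_iff power2_norm_eq_inner inner_vec_def) (simp add: power2_eq_square)
  finally show ?thesis .
qed

lemma C2_on_time: "C2_on (\<lambda>(z::real^'n, t::real). t) S"
  using C2_on_linear[OF bounded_linear_snd] by (simp add: case_prod_unfold)

section \<open>Radial test functions\<close>

text \<open>The operator has the eigenvalue \<open>1 - 1/p\<close>, the reciprocal of the conjugate exponent, in the
  gradient direction and \<open>1/p\<close> in the orthogonal ones.\<close>

definition normal_coeff :: "ereal \<Rightarrow> real" where
  "normal_coeff p = 1 - real_of_ereal (1 / p)"

text \<open>The trace of \<open>game_A p \<xi>\<close> for nonzero \<xi> in dimension
  \<open>n\<close>: one eigenvalue \<open>1 - 1/p\<close> and \<open>n - 1\<close> eigenvalues
  \<open>1/p\<close>.\<close>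

definition trace_coeff :: "ereal \<Rightarrow> nat \<Rightarrow> real" where
  "trace_coeff p n = real n * real_of_ereal (1 / p) + 1 - 2 * real_of_ereal (1 / p)"

lemma real_inverse_exponent:
  assumes "1 < p"
  shows "0 \<le> real_of_ereal (1 / p)" "real_of_ereal (1 / p) < 1"
  using assms by (cases p; simp add: one_ereal_def)+

lemma normal_coeff_bounds:
  assumes "1 < p"
  shows "0 < normal_coeff p" "normal_coeff p \<le> 1"
  using real_inverse_exponent[OF assms] by (auto simp: normal_coeff_def)

lemma conj_exponent_eq:
  assumes "1 < p"
  shows "conj_exponent p = 1 / normal_coeff p"
  using assms by (cases p) (auto simp: conj_exponent_def normal_coeff_def one_ereal_def field_simps)

lemma trace_coeff_bounds:
  assumes "1 < p" "2 \<le> n"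
  shows "0 < trace_coeff p n" "trace_coeff p n \<le> real n"
proof -
  define P where "P = real_of_ereal (1 / p)"
  have P: "0 \<le> P" "P < 1" unfolding P_def by (rule real_inverse_exponent[OF assms(1)])+
  have "trace_coeff p n = 1 + (real n - 2) * P" by (simp add: trace_coeff_def P_def algebra_simps)
  moreover have "0 \<le> (real n - 2) * P" "(real n - 2) * P \<le> real n - 2"
    using P assms(2) by (auto intro: mult_left_le)
  ultimately show "0 < trace_coeff p n" "trace_coeff p n \<le> real n" by linarith+
qed

lemma hessian_eq_matrix:
  assumes "open S" "x \<in> S" "\<And>z. z \<in> S \<Longrightarrow> grad f z = G z" "(G has_derivative H) (at x)"
  shows "hessian f x = matrix H"
proof -
  have "(grad f has_derivative H) (at x)"
    using has_derivative_transform_within_open[OF assms(4,1,2)] assms(3) by simp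
  then show ?thesis
    unfolding hessian_def jacobian_def by (simp add: frechet_derivative_at[symmetric])
qed

lemma grad_eqI:
  assumes "(f has_derivative f') (at x)" "\<And>h. f' h = G \<bullet> h"
  shows "grad f x = G"
  by (simp add: grad_def frechet_derivative_at[OF assms(1), symmetric] assms(2) vec_eq_iff inner_axis)

text \<open>The matrix \<open>a d d^T + b I\<close>, the shape of the Hessian of a function of
  \<open>|z - c|^2\<close>, with \<open>d = z - c\<close>.\<close>

definition radial_matrix :: "real \<Rightarrow> real \<Rightarrow> real^'n \<Rightarrow> real^'n^'n" where
  "radial_matrix a b d = (\<chi> i j. a * d $ i * d $ j + (if i = j then b else 0))"

lemma transpose_radial_matrix [simp]: "transpose (radial_matrix a b d) = radial_matrix a b d"
  by (auto simp: radial_matrix_def transpose_def vec_eq_iff)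

lemma has_derivative_radial:
  fixes c :: "real^'n"
  assumes "(\<phi> has_real_derivative \<phi>1) (at ((norm (z - c))\<^sup>2))"
  shows "((\<lambda>z. \<phi> ((norm (z - c))\<^sup>2)) has_derivative (\<lambda>h. ((2 * \<phi>1) *\<^sub>R (z - c)) \<bullet> h)) (at z)"
proof -
  have "((\<lambda>z. (norm (z - c))\<^sup>2) has_derivative (\<lambda>h. 2 * ((z - c) \<bullet> h))) (at z)"
    unfolding power2_norm_eq_inner
    by (rule has_derivative_eq_rhs)
       (auto intro!: derivative_eq_intros simp: inner_commute algebra_simps)
  from has_derivative_compose[OF this assms[unfolded has_field_derivative_def]]
  show ?thesis by (simp add: algebra_simps)
qed

lemma grad_radial:
  fixes c :: "real^'n"
  assumes "(\<phi> has_real_derivative \<phi>1) (at ((norm (z - c))\<^sup>2))"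
  shows "grad (\<lambda>z. \<phi> ((norm (z - c))\<^sup>2)) z = (2 * \<phi>1) *\<^sub>R (z - c)"
  by (rule grad_eqI[OF has_derivative_radial[OF assms]]) simp

lemma hessian_radial:
  fixes c :: "real^'n"
  assumes \<phi>: "\<And>q. (\<phi> has_real_derivative \<phi>1 q) (at q)"
    and \<phi>1: "\<And>q. (\<phi>1 has_real_derivative \<phi>2 q) (at q)"
  shows "hessian (\<lambda>z. \<phi> ((norm (z - c))\<^sup>2)) z =
    radial_matrix (4 * \<phi>2 ((norm (z - c))\<^sup>2)) (2 * \<phi>1 ((norm (z - c))\<^sup>2)) (z - c)"
proof -
  let ?Q = "(norm (z - c))\<^sup>2"
  let ?H = "\<lambda>h. (2 * \<phi>1 ?Q) *\<^sub>R h + (2 * (((2 * \<phi>2 ?Q) *\<^sub>R (z - c)) \<bullet> h)) *\<^sub>R (z - c)"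
  have "((\<lambda>z. (2 * \<phi>1 ((norm (z - c))\<^sup>2)) *\<^sub>R (z - c)) has_derivative ?H) (at z)"
    by (intro has_derivative_scaleR has_derivative_mult_right has_derivative_radial[OF \<phi>1] has_derivative_eq_rhs[OF has_derivative_diff[OF has_derivative_ident has_derivative_const]]) simp
  from hessian_eq_matrix[OF open_UNIV UNIV_I _ this, of "\<lambda>z. \<phi> ((norm (z - c))\<^sup>2)"]
  have "hessian (\<lambda>z. \<phi> ((norm (z - c))\<^sup>2)) z = matrix ?H"
    using grad_radial[OF \<phi>] by blast
  also have "\<dots> = radial_matrix (4 * \<phi>2 ?Q) (2 * \<phi>1 ?Q) (z - c)"
    by (auto simp: matrix_def radial_matrix_def vec_eq_iff inner_axis) (auto simp: axis_def)
  finally show ?thesis .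
qed

lemma game_F_eq:
  "game_F p \<xi> X = - (\<Sum>i\<in>UNIV. \<Sum>j\<in>UNIV. game_A p \<xi> $ i $ j * X $ j $ i)"
  by (simp add: game_F_def trace_def matrix_matrix_mult_def)

lemma game_A_nth:
  "game_A p \<xi> $ i $ j = (if i = j then real_of_ereal (1 / p) else 0) +
     (1 - 2 * real_of_ereal (1 / p)) * (\<xi> $ i * \<xi> $ j / (norm \<xi>)\<^sup>2)"
  by (simp add: game_A_def mat_def)

text \<open>The vector \<xi> is kept independent of \<open>d\<close>, because the envelopes evaluate
  the operator at gradients that need not be radial.\<close>

lemma game_F_radial:
  fixes d \<xi> :: "real^'n"
  assumes "\<xi> \<noteq> 0"
  shows "game_F p \<xi> (radial_matrix a b d) =
    - (real_of_ereal (1 / p) * (a * (norm d)\<^sup>2) + (1 - 2 * real_of_ereal (1 / p)) * (a * (d \<bullet> \<xi>)\<^sup>2 / (norm \<xi>)\<^sup>2)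
       + b * trace_coeff p CARD('n))"
proof -
  define P where "P = real_of_ereal (1 / p)"
  have n: "(norm \<xi>)\<^sup>2 \<noteq> 0" using assms by simp
  have sq: "(norm v)\<^sup>2 = (\<Sum>i\<in>UNIV. v $ i * v $ i)" for v :: "real^'n"
    by (simp add: power2_norm_eq_inner inner_vec_def)
  define e where "e = (1 - 2 * P) / (norm \<xi>)\<^sup>2"
  have "game_A p \<xi> $ i $ j = (if i = j then P else 0) + e * (\<xi> $ i * \<xi> $ j)" for i j
    by (simp add: game_A_nth P_def e_def)
  then have "game_A p \<xi> $ i $ j * radial_matrix a b d $ j $ i =
     (if j = i then P * (a * d $ i * d $ i + b) else 0) +
     e * (a * ((d $ i * \<xi> $ i) * (d $ j * \<xi> $ j)) + (if j = i then b * \<xi> $ i * \<xi> $ i else 0))" for i j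
    by (auto simp: radial_matrix_def algebra_simps)
  then have "(\<Sum>i\<in>UNIV. \<Sum>j\<in>UNIV. game_A p \<xi> $ i $ j * radial_matrix a b d $ j $ i) =
     (\<Sum>i\<in>UNIV. P * (a * d $ i * d $ i + b)) +
     e * ((\<Sum>i\<in>UNIV. \<Sum>j\<in>UNIV. a * ((d $ i * \<xi> $ i) * (d $ j * \<xi> $ j))) + (\<Sum>i\<in>UNIV. b * \<xi> $ i * \<xi> $ i))"
    by (simp add: sum.distrib sum_distrib_left[symmetric])
  also have "(\<Sum>i\<in>UNIV. P * (a * d $ i * d $ i + b)) = P * (a * (norm d)\<^sup>2) + P * b * real CARD('n)"
    by (simp add: sq sum.distrib sum_distrib_left algebra_simps)
  also have "(\<Sum>i\<in>UNIV. \<Sum>j\<in>UNIV. a * ((d $ i * \<xi> $ i) * (d $ j * \<xi> $ j))) = a * (d \<bullet> \<xi>)\<^sup>2"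
    unfolding power2_eq_square inner_vec_def sum_product inner_real_def by (simp only: sum_distrib_left)
  also have "(\<Sum>i\<in>UNIV. b * \<xi> $ i * \<xi> $ i) = b * (norm \<xi>)\<^sup>2"
    by (simp add: sq sum_distrib_left algebra_simps)
  finally show ?thesis
    using n by (simp add: game_F_eq trace_coeff_def P_def[symmetric] e_def) (simp add: field_simps)
qed

section \<open>Semicontinuous envelopes on radial matrices\<close>

lemma game_A_bound:
  assumes "1 < p" "\<xi> \<noteq> 0"
  shows "\<bar>game_A p \<xi> $ i $ j\<bar> \<le> 2"
proof -
  define P where "P = real_of_ereal (1 / p)"
  have P: "0 \<le> P" "P < 1" unfolding P_def by (rule real_inverse_exponent[OF assms(1)])+
  have "\<bar>\<xi> $ i * \<xi> $ j\<bar> \<le> norm \<xi> * norm \<xi>"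
    unfolding abs_mult by (intro mult_mono component_le_norm_cart) auto
  then have 1: "\<bar>\<xi> $ i * \<xi> $ j / (norm \<xi>)\<^sup>2\<bar> \<le> 1"
    using assms(2) by (simp add: power2_eq_square)
  have "\<bar>game_A p \<xi> $ i $ j\<bar> \<le> \<bar>P * (if i = j then 1 else 0)\<bar> + \<bar>1 - 2 * P\<bar> * \<bar>\<xi> $ i * \<xi> $ j / (norm \<xi>)\<^sup>2\<bar>"
    unfolding abs_mult[symmetric] game_A_nth P_def[symmetric]
    using abs_triangle_ineq[of "if i = j then P else 0" "(1 - 2 * P) * (\<xi> $ i * \<xi> $ j / (norm \<xi>)\<^sup>2)"]
    by (cases "i = j") simp_all
  also have "\<dots> \<le> 1 + 1 * 1"
    using P 1 by (intro add_mono mult_mono) auto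
  finally show ?thesis by simp
qed

text \<open>The constant is uniform in \<xi>, also near the singularity at 0, so the perturbations
  of the matrix in the envelopes are absorbed by an arbitrarily small error.\<close>

lemma game_F_lipschitz:
  fixes X Y :: "real^'n^'n"
  assumes "1 < p" "\<xi> \<noteq> 0"
  shows "\<bar>game_F p \<xi> Y - game_F p \<xi> X\<bar> \<le> 2 * (real CARD('n))\<^sup>2 * norm (Y - X)"
proof -
  have "\<bar>game_F p \<xi> Y - game_F p \<xi> X\<bar> =
     \<bar>\<Sum>i\<in>UNIV. \<Sum>j\<in>UNIV. game_A p \<xi> $ i $ j * (Y - X) $ j $ i\<bar>"
    by (simp add: game_F_eq sum_subtractf[symmetric] right_diff_distrib) 
       (simp add: sum_subtractf abs_minus_commute)
  also have "\<dots> \<le> (\<Sum>i\<in>UNIV. \<Sum>j\<in>UNIV. \<bar>game_A p \<xi> $ i $ j * (Y - X) $ j $ i\<bar>)"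
    by (intro order_trans[OF sum_abs] sum_mono order_trans[OF sum_abs]) simp
  also have "\<dots> \<le> (\<Sum>i\<in>(UNIV::'n set). \<Sum>j\<in>(UNIV::'n set). 2 * norm (Y - X))"
  proof (intro sum_mono)
    fix i j
    have "\<bar>(Y - X) $ j $ i\<bar> \<le> norm (Y - X)"
      using component_le_norm_cart[of "(Y - X) $ j" i] Finite_Cartesian_Product.norm_nth_le[of "Y - X" j]
      by linarith
    then show "\<bar>game_A p \<xi> $ i $ j * (Y - X) $ j $ i\<bar> \<le> 2 * norm (Y - X)"
      unfolding abs_mult using game_A_bound[OF assms] by (intro mult_mono) auto
  qed
  finally show ?thesis by (simp add: power2_eq_square)
qed

text \<open>\<open>lower_env\<close> is a \<open>Lim\<close>, which carries information only once
  convergence is established. The infima grow as \<delta> decreases; \<open>up\<close> bounds them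
  from above and \<open>low\<close> from below, so they converge to their supremum, and this is at
  least \<open>m\<close>.\<close>

lemma lower_env_ge:
  fixes X :: "real^'n^'n"
  assumes sym: "transpose X = X"
    and up: "\<And>\<eta>. \<eta> \<noteq> 0 \<Longrightarrow> F \<eta> X \<le> C"
    and low: "\<And>\<epsilon>. 0 < \<epsilon> \<Longrightarrow> \<exists>\<delta>>0. \<forall>\<eta> Y. \<eta> \<noteq> 0 \<longrightarrow> norm (\<eta> - \<xi>) < \<delta> \<longrightarrow> norm (Y - X) < \<delta> \<longrightarrow> m - \<epsilon> \<le> F \<eta> Y"
  shows "m \<le> lower_env F \<xi> X"
proof -
  define S where "S \<delta> = {F \<eta> Y | \<eta> Y. \<eta> \<noteq> 0 \<and> transpose Y = Y \<and> norm (\<eta> - \<xi>) < \<delta> \<and> norm (Y - X) < \<delta>}" for \<delta>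
  \<comment> \<open>Nonzero vectors lie arbitrarily close to \<xi> even if it is 0, so the infima
    are over nonempty sets.\<close>
  have ne: "\<exists>\<eta>. \<eta> \<noteq> 0 \<and> norm (\<eta> - \<xi>) < \<delta>" if \<delta>: "0 < \<delta>" for \<delta>
  proof (cases "\<xi> = 0")
    case True
    obtain v :: "real^'n" where "norm v = \<delta> / 2"
      by (rule vector_choose_size[of "\<delta>/2"]) (use \<delta> in auto)
    then show ?thesis using True \<delta> by (intro exI[of _ v]) auto
  qed (use \<delta> in auto)
  have S_mem: "\<exists>s\<in>S \<delta>. s \<le> C" if "0 < \<delta>" for \<delta>
    using ne[OF that] up that sym unfolding S_def by force
  obtain \<delta>1 where \<delta>1: "0 < \<delta>1"
    and lb1: "\<forall>\<eta> Y. \<eta> \<noteq> 0 \<longrightarrow> norm (\<eta> - \<xi>) < \<delta>1 \<longrightarrow> norm (Y - X) < \<delta>1 \<longrightarrow> m - 1 \<le> F \<eta> Y"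
    using low[of 1] by auto
  have S_sub: "S a \<subseteq> S b" if "a \<le> b" for a b using that unfolding S_def by force
  have bdd1: "\<And>s. s \<in> S \<delta>1 \<Longrightarrow> m - 1 \<le> s" using lb1 unfolding S_def by blast
  have bdd: "bdd_below (S \<delta>)" if "\<delta> \<le> \<delta>1" for \<delta>
    using bdd1 S_sub[OF that] by (intro bdd_belowI[of _ "m - 1"]) blast
  have le_C: "Inf (S \<delta>) \<le> C" if "0 < \<delta>" "\<delta> \<le> \<delta>1" for \<delta>
    using S_mem[OF that(1)] cInf_lower[OF _ bdd[OF that(2)]] by force
  have mono: "Inf (S b) \<le> Inf (S a)" if "0 < a" "a \<le> b" "b \<le> \<delta>1" for a b
    using S_mem[OF that(1)] by (intro cInf_superset_mono S_sub bdd that) auto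
  define L where "L = (SUP \<delta>\<in>{0<..\<delta>1}. Inf (S \<delta>))"
  have bddS: "bdd_above ((\<lambda>\<delta>. Inf (S \<delta>)) ` {0<..\<delta>1})"
    using le_C by (intro bdd_aboveI2[of _ _ C]) auto
  have up_L: "Inf (S \<delta>) \<le> L" if "0 < \<delta>" "\<delta> \<le> \<delta>1" for \<delta>
    unfolding L_def using that by (intro cSUP_upper bddS) auto
  have "((\<lambda>\<delta>. Inf (S \<delta>)) \<longlongrightarrow> L) (at_right 0)"
  proof (rule order_tendstoI)
    fix a assume "a < L"
    then obtain \<delta> where \<delta>: "0 < \<delta>" "\<delta> \<le> \<delta>1" "a < Inf (S \<delta>)"
      unfolding L_def using less_cSUP_iff[OF _ bddS] \<delta>1 by auto
    show "\<forall>\<^sub>F x in at_right 0. a < Inf (S x)"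
      unfolding eventually_at_right_field using \<delta>(1)
      by (intro exI[of _ \<delta>] conjI allI impI less_le_trans[OF \<delta>(3) mono[OF _ _ \<delta>(2)]]) auto
  next
    fix a assume "L < a"
    then show "\<forall>\<^sub>F x in at_right 0. Inf (S x) < a"
      unfolding eventually_at_right_field using \<delta>1
      by (intro exI[of _ \<delta>1] conjI allI impI le_less_trans[OF up_L]) auto
  qed
  then have "lower_env F \<xi> X = L"
    unfolding lower_env_def S_def[symmetric] by (intro tendsto_Lim) auto
  moreover have "m \<le> L"
  proof (rule field_le_epsilon)
    fix e :: real assume "0 < e"
    then obtain \<delta> where \<delta>: "0 < \<delta>"
      "\<forall>\<eta> Y. \<eta> \<noteq> 0 \<longrightarrow> norm (\<eta> - \<xi>) < \<delta> \<longrightarrow> norm (Y - X) < \<delta> \<longrightarrow> m - e \<le> F \<eta> Y"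
      using low[of e] by auto
    define d where "d = min \<delta> \<delta>1"
    have d: "0 < d" "d \<le> \<delta>1" "d \<le> \<delta>" using \<delta> \<delta>1 by (auto simp: d_def)
    have "m - e \<le> Inf (S d)"
      using S_mem[OF d(1)] \<delta>(2) d(3) unfolding S_def by (intro cInf_greatest) force+
    then show "m \<le> L + e" using up_L[OF d(1,2)] by simp
  qed
  ultimately show ?thesis by simp
qed

text \<open>Away from \<open>d = 0\<close> the gradient \<open>b *\<^sub>R d\<close> is nonzero and
  radial, and the operator is continuous there. At \<open>d = 0\<close> the matrix is a multiple of
  the identity, on which the operator has the same value for all directions. So with
  \<open>b \<noteq> 0\<close> the singularity of the operator does no harm.\<close>

lemma lower_env_radial:
  fixes d :: "real^'n"
  assumes p: "1 < p" and b: "b \<noteq> 0"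
  shows "- (a * (norm d)\<^sup>2 * normal_coeff p + b * trace_coeff p CARD('n))
    \<le> lower_env (game_F p) (b *\<^sub>R d) (radial_matrix a b d)"
proof (rule lower_env_ge)
  define C where "C = 2 * (real CARD('n))\<^sup>2"
  have C: "0 < C" by (simp add: C_def)
  let ?X = "radial_matrix a b d" and ?\<xi> = "b *\<^sub>R d"
  let ?m = "- (a * (norm d)\<^sup>2 * normal_coeff p + b * trace_coeff p CARD('n))"
  show "game_F p \<eta> ?X \<le> C * norm ?X" if "\<eta> \<noteq> 0" for \<eta>
    using game_F_lipschitz[OF p that, of "?X" 0] by (auto simp: C_def game_F_eq[of _ _ 0])
  have cont: "\<exists>\<delta>>0. \<forall>\<eta>. \<eta> \<noteq> 0 \<longrightarrow> norm (\<eta> - ?\<xi>) < \<delta> \<longrightarrow> ?m - \<epsilon> \<le> game_F p \<eta> ?X" if "0 < \<epsilon>" for \<epsilon>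
  proof (cases "d = 0")
    case True
    then show ?thesis using that by (intro exI[of _ 1]) (simp add: game_F_radial)
  next
    case False
    define h where "h \<eta> = - (real_of_ereal (1 / p) * (a * (norm d)\<^sup>2) + (1 - 2 * real_of_ereal (1 / p)) * (a * (d \<bullet> \<eta>)\<^sup>2 / (norm \<eta>)\<^sup>2)
       + b * trace_coeff p CARD('n))" for \<eta>
    have "isCont h ?\<xi>"
      unfolding h_def using False b by (intro continuous_intros) auto
    moreover have "h ?\<xi> = ?m"
      using False b unfolding h_def normal_coeff_def
      by (simp add: power_mult_distrib power2_norm_eq_inner[symmetric] power2_eq_square) (simp add: algebra_simps)
    ultimately have "\<exists>\<delta>>0. \<forall>\<eta>. dist \<eta> ?\<xi> < \<delta> \<longrightarrow> dist (h \<eta>) ?m < \<epsilon>"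
      using that unfolding continuous_at_eps_delta by simp
    then obtain \<delta> where "\<delta> > 0" "\<forall>\<eta>. dist \<eta> ?\<xi> < \<delta> \<longrightarrow> dist (h \<eta>) ?m < \<epsilon>"
      by blast
    moreover have "game_F p \<eta> ?X = h \<eta>" if "\<eta> \<noteq> 0" for \<eta>
      using game_F_radial[OF that] by (simp add: h_def)
    moreover have "?m - \<epsilon> \<le> h \<eta>" if "dist (h \<eta>) ?m < \<epsilon>" for \<eta>
      using that unfolding dist_real_def by linarith
    ultimately show ?thesis
      by (intro exI[of _ \<delta>]) (metis dist_norm)
  qed
  show "\<exists>\<delta>>0. \<forall>\<eta> Y. \<eta> \<noteq> 0 \<longrightarrow> norm (\<eta> - ?\<xi>) < \<delta> \<longrightarrow> norm (Y - ?X) < \<delta> \<longrightarrow> ?m - \<epsilon> \<le> game_F p \<eta> Y"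
    if \<epsilon>: "0 < \<epsilon>" for \<epsilon>
  proof -
    obtain \<delta> where \<delta>: "\<delta> > 0" "\<forall>\<eta>. \<eta> \<noteq> 0 \<longrightarrow> norm (\<eta> - ?\<xi>) < \<delta> \<longrightarrow> ?m - \<epsilon>/2 \<le> game_F p \<eta> ?X"
      using cont[of "\<epsilon>/2"] \<epsilon> by auto
    have "?m - \<epsilon> \<le> game_F p \<eta> Y"
      if "\<eta> \<noteq> 0" "norm (\<eta> - ?\<xi>) < min \<delta> (\<epsilon> / (2 * C))" "norm (Y - ?X) < min \<delta> (\<epsilon> / (2 * C))" for \<eta> Y
    proof -
      have "C * norm (Y - ?X) \<le> \<epsilon> / 2"
        using that(3) C by (simp add: field_simps)
      moreover have "\<bar>game_F p \<eta> Y - game_F p \<eta> ?X\<bar> \<le> C * norm (Y - ?X)"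
        unfolding C_def by (rule game_F_lipschitz[OF p that(1)])
      moreover have "?m - \<epsilon>/2 \<le> game_F p \<eta> ?X"
        using \<delta>(2) that by simp
      ultimately show ?thesis by linarith
    qed
    then show ?thesis using \<delta>(1) \<epsilon> C by (intro exI[of _ "min \<delta> (\<epsilon> / (2 * C))"]) auto
  qed
qed simp

lemma C2_on_slice:
  fixes \<phi> :: "real^'n \<Rightarrow> real \<Rightarrow> real"
  assumes "C2_on (\<lambda>(x, t). \<phi> x t) (\<Omega> \<times> {0<..})" "t > 0" "x \<in> \<Omega>"
  obtains G H where "\<And>z. z \<in> \<Omega> \<Longrightarrow> ((\<lambda>z. \<phi> z t) has_derivative (\<lambda>h. G z \<bullet> h)) (at z)"
    "(G has_derivative H) (at x)" "\<phi> x differentiable (at t)"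
proof -
  obtain f' f'' where f: "\<And>x. x \<in> \<Omega> \<times> {0<..} \<Longrightarrow> ((\<lambda>(x, t). \<phi> x t) has_derivative blinfun_apply (f' x)) (at x)"
    "\<And>x. x \<in> \<Omega> \<times> {0<..} \<Longrightarrow> (f' has_derivative blinfun_apply (f'' x)) (at x)"
    using assms(1) unfolding C2_on_def by blast
  have d1: "((\<lambda>z. (z, t)) has_derivative (\<lambda>h. (h, 0))) (at z)" for z :: "real^'n"
    by (auto intro!: derivative_eq_intros)
  define G where "G z = (\<chi> i. f' (z, t) (axis i 1, 0))" for z
  have lin: "f' (z, t) (h, 0) = G z \<bullet> h" for z h
  proof -
    have l: "linear (\<lambda>h::real^'n. f' (z, t) (h, 0))"
      by (rule linearI) (metis blinfun.add_right add_Pair add_0, metis blinfun.scaleR_right scaleR_Pair scaleR_zero_right)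
    have "f' (z, t) (h, 0) = f' (z, t) ((\<Sum>i\<in>UNIV. h $ i *\<^sub>R axis i 1), 0)"
      by (metis (no_types, lifting) basis_expansion scalar_mult_eq_scaleR sum.cong)
    also have "\<dots> = (\<Sum>i\<in>UNIV. h $ i * f' (z, t) (axis i 1, 0))"
      using linear_sum[OF l, of "\<lambda>i. h $ i *\<^sub>R axis i 1" UNIV] linear_scale[OF l] by simp
    finally have "f' (z, t) (h, 0) = (\<Sum>i\<in>UNIV. h $ i * f' (z, t) (axis i 1, 0))" .
    then show ?thesis by (simp add: G_def inner_vec_def mult.commute)
  qed
  show ?thesis
  proof
    show "((\<lambda>z. \<phi> z t) has_derivative (\<lambda>h. G z \<bullet> h)) (at z)" if "z \<in> \<Omega>" for z
      using has_derivative_compose[OF d1 f(1)[of "(z, t)"]] that assms(2) by (simp add: lin)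
    have f2: "((\<lambda>z. f' (z, t)) has_derivative (\<lambda>h. f'' (x, t) (h, 0))) (at x)"
      using has_derivative_compose[OF d1 f(2)[of "(x, t)"]] assms(2,3) by simp
    show "(G has_derivative (\<lambda>h. \<chi> i. f'' (x, t) (h, 0) (axis i 1, 0))) (at x)"
      unfolding has_derivative_componentwise_within[of G] G_def
      by (auto simp: Basis_vec_def inner_axis intro!: bounded_linear.has_derivative[OF blinfun.bounded_linear_left f2])
    have "((\<lambda>t. (x, t)) has_derivative (\<lambda>h. (0, h))) (at t)"
      by (auto intro!: derivative_eq_intros)
    from has_derivative_compose[OF this f(1)[of "(x, t)"]]
    show "\<phi> x differentiable (at t)"
      using assms(2,3) by (auto simp: differentiable_def)
  qed
qed

text \<open>\<open>grad\<close>, \<open>hessian\<close> and \<open>deriv\<close> say nothing where a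
  function is not differentiable, so the sign rules rest on the regularity of the test
  function.\<close>

lemma hessian_minus_C2:
  fixes \<phi> :: "real^'n \<Rightarrow> real \<Rightarrow> real"
  assumes "C2_on (\<lambda>(x, t). \<phi> x t) (\<Omega> \<times> {0<..})" "t > 0" "x \<in> \<Omega>" "open \<Omega>"
  shows "grad (\<lambda>z. - \<phi> z t) x = - grad (\<lambda>z. \<phi> z t) x"
    "hessian (\<lambda>z. - \<phi> z t) x = - hessian (\<lambda>z. \<phi> z t) x"
    "deriv (\<lambda>t. - \<phi> x t) t = - deriv (\<phi> x) t"
proof -
  obtain G H where G: "\<And>z. z \<in> \<Omega> \<Longrightarrow> ((\<lambda>z. \<phi> z t) has_derivative (\<lambda>h. G z \<bullet> h)) (at z)"
    "(G has_derivative H) (at x)" "\<phi> x differentiable (at t)"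
    using C2_on_slice[OF assms(1-3)] by metis
  have 1: "grad (\<lambda>z. \<phi> z t) z = G z" if "z \<in> \<Omega>" for z
    by (rule grad_eqI[OF G(1)[OF that]]) simp
  have 2: "grad (\<lambda>z. - \<phi> z t) z = - G z" if "z \<in> \<Omega>" for z
    by (rule grad_eqI[OF has_derivative_minus[OF G(1)[OF that]]]) simp
  show "grad (\<lambda>z. - \<phi> z t) x = - grad (\<lambda>z. \<phi> z t) x" using 1 2 assms(3) by simp
  have "hessian (\<lambda>z. \<phi> z t) x = matrix H"
    by (rule hessian_eq_matrix[OF assms(4,3) 1 G(2)])
  moreover have "hessian (\<lambda>z. - \<phi> z t) x = matrix (\<lambda>h. - H h)"
    by (rule hessian_eq_matrix[OF assms(4,3) 2 has_derivative_minus[OF G(2)]])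
  ultimately show "hessian (\<lambda>z. - \<phi> z t) x = - hessian (\<lambda>z. \<phi> z t) x"
    by (simp add: matrix_def vec_eq_iff)
  show "deriv (\<lambda>t. - \<phi> x t) t = - deriv (\<phi> x) t"
    by (rule DERIV_imp_deriv, rule DERIV_minus) 
      (metis DERIV_deriv_iff_real_differentiable G(3))
qed

section \<open>Negation exchanges sub- and supersolutions\<close>

lemma game_F_uminus: "game_F p (- \<xi>) (- X) = - game_F p \<xi> X"
  by (simp add: game_F_eq game_A_nth sum_negf)

text \<open>The operator is odd, so changing the signs of both arguments maps one family of
  competitors onto the other.\<close>

lemma upper_env_uminus: "upper_env (game_F p) (- \<xi>) (- X) = - lower_env (game_F p) \<xi> X"
proof -
  have "{- game_F p \<eta> Y | \<eta> Y. \<eta> \<noteq> 0 \<and> transpose Y = Y \<and> norm (\<eta> - - \<xi>) < \<delta> \<and> norm (Y - - X) < \<delta>} =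
    {game_F p \<eta> Y | \<eta> Y. \<eta> \<noteq> 0 \<and> transpose Y = Y \<and> norm (\<eta> - \<xi>) < \<delta> \<and> norm (Y - X) < \<delta>}" (is "?A = ?B") for \<delta>
  proof -
    have tr: "transpose (- Y) = - transpose Y" for Y :: "real^'n^'n" by (simp add: transpose_def vec_eq_iff)
    have n: "norm (- a - b) = norm (a + b)" "norm (- a + b) = norm (a - b)" for a b :: "'k::real_normed_vector"
      by (metis minus_add_distrib norm_minus_cancel uminus_add_conv_diff diff_conv_add_uminus add.commute minus_diff_eq)+
    show ?thesis
    proof (intro equalityI subsetI)
      fix s assume "s \<in> ?A"
      then obtain \<eta> Y where "s = - game_F p \<eta> Y" "\<eta> \<noteq> 0" "transpose Y = Y" "norm (\<eta> - - \<xi>) < \<delta>" "norm (Y - - X) < \<delta>" by auto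
      then have "s = game_F p (- \<eta>) (- Y) \<and> - \<eta> \<noteq> 0 \<and> transpose (- Y) = - Y \<and> norm (- \<eta> - \<xi>) < \<delta> \<and> norm (- Y - X) < \<delta>"
        by (simp add: game_F_uminus tr n)
      then show "s \<in> ?B" by blast
    next
      fix s assume "s \<in> ?B"
      then obtain \<eta> Y where "s = game_F p \<eta> Y" "\<eta> \<noteq> 0" "transpose Y = Y" "norm (\<eta> - \<xi>) < \<delta>" "norm (Y - X) < \<delta>" by auto
      then have "s = - game_F p (- \<eta>) (- Y) \<and> - \<eta> \<noteq> 0 \<and> transpose (- Y) = - Y \<and> norm (- \<eta> - - \<xi>) < \<delta> \<and> norm (- Y - - X) < \<delta>"
        by (simp add: game_F_uminus tr n norm_minus_commute)
      then show "s \<in> ?A" by blast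
    qed
  qed
  then show ?thesis by (simp add: upper_env_def lower_env_def)
qed

text \<open>Lower bounds for \<open>u\<close> become upper bounds for \<open>- u\<close>, and every
  comparison below concerns subsolutions only.\<close>

lemma viscosity_supersolution_uminus:
  fixes \<Omega> :: "(real^'n) set"
  assumes "viscosity_supersolution p \<Omega> u" "open \<Omega>"
  shows "viscosity_subsolution p \<Omega> (\<lambda>z t. - u z t)"
  unfolding viscosity_subsolution_def
proof (intro conjI allI impI ballI)
  have lsc: "lsc_on (\<Omega> \<times> {0<..}) (\<lambda>(x, t). u x t)"
    using assms(1) unfolding viscosity_supersolution_def by blast
  show "usc_on (\<Omega> \<times> {0<..}) (\<lambda>(x, t). - u x t)"
    unfolding usc_on_def
  proof (intro ballI allI impI)
    fix x c assume x: "x \<in> \<Omega> \<times> {0<..}" and c: "(case x of (x, t) \<Rightarrow> - u x t) < c"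
    have "\<forall>\<^sub>F y in at x within \<Omega> \<times> {0<..}. - c < (case y of (x, t) \<Rightarrow> u x t)"
      using lsc x c unfolding lsc_on_def by (auto split: prod.splits)
    then show "\<forall>\<^sub>F y in at x within \<Omega> \<times> {0<..}. (case y of (x, t) \<Rightarrow> - u x t) < c"
      by (rule eventually_mono) (auto split: prod.splits)
  qed
next
  fix \<phi> x and t :: real
  assume \<phi>: "C2_on (\<lambda>(x, t). \<phi> x t) (\<Omega> \<times> {0<..})" and x: "x \<in> \<Omega>" "0 < t"
    and max: "\<forall>z\<in>\<Omega>. \<forall>s>0. - u z s - \<phi> z s \<le> - u x t - \<phi> x t"
  have "C2_on (\<lambda>(x, t). - \<phi> x t) (\<Omega> \<times> {0<..})"
    using C2_on_minus[OF \<phi>] by (simp add: case_prod_unfold)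
  moreover have "\<forall>z\<in>\<Omega>. \<forall>s>0. u z s - - \<phi> z s \<ge> u x t - - \<phi> x t"
    using max by (smt (verit))
  ultimately have "0 \<le> deriv (\<lambda>t. - \<phi> x t) t + upper_env (game_F p) (grad (\<lambda>z. - \<phi> z t) x) (hessian (\<lambda>z. - \<phi> z t) x)"
    using assms(1) x unfolding viscosity_supersolution_def by blast
  then show "deriv (\<phi> x) t + lower_env (game_F p) (grad (\<lambda>z. \<phi> z t) x) (hessian (\<lambda>z. \<phi> z t) x) \<le> 0"
    by (simp add: hessian_minus_C2[OF \<phi> x(2,1) assms(2)] upper_env_uminus)
qed

section \<open>Comparison with radial functions\<close>

text \<open>The parabolic boundary includes the corners \<open>frontier \<Omega> \<times> {0}\<close>. Test functions have
  to touch from above on all of \<open>\<Omega> \<times> {0<..}\<close>; the term \<open>B (t / T\<^sub>1) ^ n\<close> with large \<open>n\<close> makes a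
  barrier that dominates up to time \<open>T\<close> only into a global one.\<close>

lemma radial_comparison:
  fixes \<Omega> :: "(real^'n) set" and v :: "real^'n \<Rightarrow> real \<Rightarrow> real" and c :: "real^'n"
  assumes sub: "viscosity_subsolution p \<Omega> v" and p: "1 < p" and "open \<Omega>"
    and cont: "continuous_on (\<Omega> \<times> {0<..}) (\<lambda>(z, t). v z t)"
    and bound: "\<And>z t. z \<in> \<Omega> \<Longrightarrow> 0 < t \<Longrightarrow> v z t - \<phi> ((norm (z - c))\<^sup>2) t \<le> B"
    and C2: "C2_on (\<lambda>(z, t). \<phi> ((norm (z - c))\<^sup>2) t) (\<Omega> \<times> {0<..})"
    and d1: "\<And>q t. 0 < t \<Longrightarrow> ((\<lambda>q. \<phi> q t) has_real_derivative \<phi>1 q t) (at q)"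
    and d2: "\<And>q t. 0 < t \<Longrightarrow> ((\<lambda>q. \<phi>1 q t) has_real_derivative \<phi>2 q t) (at q)"
    and dt: "\<And>q t. 0 < t \<Longrightarrow> ((\<lambda>t. \<phi> q t) has_real_derivative \<phi>t q t) (at t)"
    and super: "\<And>z t. z \<in> \<Omega> \<Longrightarrow> 0 < t \<Longrightarrow> t < T \<Longrightarrow> \<phi> ((norm (z - c))\<^sup>2) t < v z t \<Longrightarrow>
       \<phi>1 ((norm (z - c))\<^sup>2) t \<noteq> 0 \<and>
       4 * \<phi>2 ((norm (z - c))\<^sup>2) t * (norm (z - c))\<^sup>2 * normal_coeff p
         + 2 * \<phi>1 ((norm (z - c))\<^sup>2) t * trace_coeff p CARD('n) \<le> \<phi>t ((norm (z - c))\<^sup>2) t"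
    and boundary: "\<And>\<zeta> s \<epsilon>. \<zeta> \<in> closure \<Omega> \<Longrightarrow> 0 \<le> s \<Longrightarrow> s < T \<Longrightarrow> \<zeta> \<notin> \<Omega> \<or> s = 0 \<Longrightarrow> 0 < \<epsilon> \<Longrightarrow>
       \<exists>\<delta>>0. \<forall>z\<in>\<Omega>. \<forall>t>0. norm (z - \<zeta>) < \<delta> \<longrightarrow> \<bar>t - s\<bar> < \<delta> \<longrightarrow> v z t - \<phi> ((norm (z - c))\<^sup>2) t < \<epsilon>"
    and infinity: "\<And>\<epsilon>. 0 < \<epsilon> \<Longrightarrow> \<exists>L. \<forall>z\<in>\<Omega>. \<forall>t>0. t < T \<longrightarrow> \<epsilon> \<le> v z t - \<phi> ((norm (z - c))\<^sup>2) t \<longrightarrow> norm z \<le> L"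
    and z0: "z0 \<in> \<Omega>" and t0: "0 < t0" "t0 < T"
  shows "v z0 t0 \<le> \<phi> ((norm (z0 - c))\<^sup>2) t0"
proof (rule ccontr)
  define w where "w z t = \<phi> ((norm (z - c))\<^sup>2) t" for z t
  define D where "D z t = v z t - w z t" for z t
  assume "\<not> v z0 t0 \<le> \<phi> ((norm (z0 - c))\<^sup>2) t0"
  then have "0 < D z0 t0" by (simp add: D_def w_def)
  define \<eta> where "\<eta> = D z0 t0"
  have \<eta>: "0 < \<eta>" using \<open>0 < D z0 t0\<close> by (simp add: \<eta>_def)
  define T1 where "T1 = (t0 + T) / 2"
  have T1: "t0 < T1" "T1 < T" "0 < T1" using t0 by (auto simp: T1_def)
  define B' where "B' = max B \<eta> + 1"
  have B': "0 < B'" "B \<le> B'" using \<eta> by (auto simp: B'_def)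
  define e where "e = \<eta> / (8 * t0)"
  have e: "0 < e" "e * t0 = \<eta> / 8" using \<eta> t0 by (auto simp: e_def)
  have "(\<lambda>n. (t0 / T1) ^ n) \<longlonglongrightarrow> 0" using T1 t0 by (intro LIMSEQ_realpow_zero) auto
  then have "(\<lambda>n. B' * (t0 / T1) ^ n) \<longlonglongrightarrow> 0" by (rule tendsto_mult_right_zero)
  then have "\<forall>\<^sub>F n in sequentially. B' * (t0 / T1) ^ n < \<eta> / 8"
    using \<eta> by (intro order_tendstoD) auto
  then obtain n where n: "B' * (t0 / T1) ^ n < \<eta> / 8" "1 \<le> n"
    by (metis (no_types, lifting) eventually_at_top_linorder eventually_conj eventually_ge_at_top order_refl)
  \<comment> \<open>The linear term makes the inequality at the contact point strict. The power is
    below \<open>\<eta> / 8\<close> once multiplied by \<open>B'\<close> at \<open>t0\<close>, but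
    from \<open>T1\<close> on \<open>k\<close> is at least \<open>B'\<close> and beats
    \<open>v - w\<close>.\<close>
  define k where "k t = e * t + B' * (t / T1) ^ n" for t
  have k0: "k t0 < \<eta> / 4" using n e by (simp add: k_def)
  have k_nonneg: "0 \<le> k t" if "0 < t" for t
    using that e B' T1 by (simp add: k_def)
  have k_large: "B' \<le> k t" if "T1 \<le> t" for t
  proof -
    have "1 \<le> (t / T1) ^ n" using that T1 by (intro one_le_power) auto
    then have "B' \<le> B' * (t / T1) ^ n" using B' by simp
    moreover have "0 \<le> e * t" using e that T1 by simp
    ultimately show ?thesis by (simp add: k_def)
  qed
  \<comment> \<open>Outside this set \<open>D - k\<close> is at most \<open>\<eta> / 2\<close>,
    while at \<open>(z0, t0)\<close> it exceeds \<open>3 \<eta> / 4\<close>; a maximum over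
    \<open>K\<close> is therefore global. The hypothesis \<open>infinity\<close> makes
    \<open>K\<close> bounded, and \<open>boundary\<close> makes it closed although the domain is
    not.\<close>
  define K where "K = {(z, t). z \<in> \<Omega> \<and> 0 < t \<and> t \<le> T1 \<and> \<eta> / 2 \<le> D z t}"
  have contw: "continuous_on (\<Omega> \<times> {0<..}) (\<lambda>(z, t). w z t)"
    using C2_on_continuous_on[OF C2] by (simp add: w_def)
  have contD: "continuous_on (\<Omega> \<times> {0<..}) (\<lambda>(z, t). D z t)"
    using continuous_on_diff[OF cont contw] by (simp add: D_def case_prod_unfold)
  have "compact K"
  proof -
    obtain L where L: "\<forall>z\<in>\<Omega>. \<forall>t>0. t < T \<longrightarrow> \<eta> / 2 \<le> D z t \<longrightarrow> norm z \<le> L"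
      using infinity[of "\<eta> / 2"] \<eta> by (auto simp: D_def w_def)
    have "K \<subseteq> cball 0 L \<times> {0..T1}" using L T1 by (auto simp: K_def)
    then have "bounded K"
      using bounded_subset[OF bounded_Times[OF bounded_cball bounded_closed_interval]] by blast
    moreover have "closed K"
      unfolding closed_sequential_limits
    proof (intro allI impI)
      fix x l assume xl: "(\<forall>n. x n \<in> K) \<and> x \<longlonglongrightarrow> l"
      obtain \<zeta> s where l: "l = (\<zeta>, s)" by (cases l)
      define zn tn where "zn = (\<lambda>n. fst (x n))" and "tn = (\<lambda>n. snd (x n))"
      have K: "zn n \<in> \<Omega>" "0 < tn n" "tn n \<le> T1" "\<eta> / 2 \<le> D (zn n) (tn n)" for n
        using conjunct1[OF xl, rule_format, of n] by (auto simp: K_def zn_def tn_def case_prod_unfold)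
      have lim: "zn \<longlonglongrightarrow> \<zeta>" "tn \<longlonglongrightarrow> s"
        using xl tendsto_fst[of x l] tendsto_snd[of x l] by (auto simp: l zn_def tn_def)
      have \<zeta>: "\<zeta> \<in> closure \<Omega>" using lim K(1) closure_sequential by blast
      have s: "0 \<le> s" "s \<le> T1"
        using lim(2) K(2,3) by (auto intro: LIMSEQ_le_const LIMSEQ_le_const2 less_imp_le)
      have in_dom: "\<zeta> \<in> \<Omega> \<and> s \<noteq> 0"
      proof (rule ccontr)
        assume "\<not> (\<zeta> \<in> \<Omega> \<and> s \<noteq> 0)"
        then obtain \<delta> where \<delta>: "\<delta> > 0" "\<forall>z\<in>\<Omega>. \<forall>t>0. norm (z - \<zeta>) < \<delta> \<longrightarrow> \<bar>t - s\<bar> < \<delta> \<longrightarrow> D z t < \<eta> / 2"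
          using boundary[of \<zeta> s "\<eta> / 2"] \<zeta> s T1 \<eta> by (auto simp: D_def w_def)
        have "\<forall>\<^sub>F n in sequentially. norm (zn n - \<zeta>) < \<delta>" "\<forall>\<^sub>F n in sequentially. \<bar>tn n - s\<bar> < \<delta>"
          using lim \<delta>(1) by (auto simp: tendsto_iff dist_norm)
        then have "\<forall>\<^sub>F n in sequentially. norm (zn n - \<zeta>) < \<delta> \<and> \<bar>tn n - s\<bar> < \<delta>"
          by (rule eventually_conj)
        then obtain n where "norm (zn n - \<zeta>) < \<delta>" "\<bar>tn n - s\<bar> < \<delta>"
          using eventually_happens by fastforce
        then show False using \<delta>(2)[rule_format, OF K(1,2)] K(4)[of n] by fastforce
      qed
      have "(\<lambda>n. (case (zn n, tn n) of (z, t) \<Rightarrow> D z t)) \<longlonglongrightarrow> (case (\<zeta>, s) of (z, t) \<Rightarrow> D z t)"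
        using in_dom s K by (intro continuous_on_tendsto_compose[OF contD] tendsto_Pair lim) auto
      then have "(\<lambda>n. D (zn n) (tn n)) \<longlonglongrightarrow> D \<zeta> s" by simp
      then have "\<eta> / 2 \<le> D \<zeta> s" by (rule LIMSEQ_le_const) (use K(4) in blast)
      then show "l \<in> K" using in_dom s by (auto simp: K_def l)
    qed
    ultimately show ?thesis by (simp add: compact_eq_bounded_closed)
  qed
  moreover have z0K: "(z0, t0) \<in> K" using z0 t0 T1 \<eta> by (auto simp: K_def \<eta>_def)
  moreover have "continuous_on K (\<lambda>(z, t). D z t - k t)"
  proof -
    have "continuous_on K (\<lambda>(z, t). D z t)" by (rule continuous_on_subset[OF contD]) (auto simp: K_def)
    moreover have "continuous_on K (\<lambda>x. k (snd x))"
      unfolding k_def using T1 by (intro continuous_intros) auto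
    ultimately have "continuous_on K (\<lambda>x. (\<lambda>(z, t). D z t) x - k (snd x))" by (rule continuous_on_diff)
    then show ?thesis by (simp add: case_prod_unfold)
  qed
  ultimately obtain x1 where x1: "x1 \<in> K"
      "\<forall>y\<in>K. (\<lambda>(z, t). D z t - k t) y \<le> (\<lambda>(z, t). D z t - k t) x1"
    using continuous_attains_sup[of K "\<lambda>(z, t). D z t - k t"] by blast
  obtain z1 t1 where "x1 = (z1, t1)" by (cases x1)
  with x1 have max1: "(z1, t1) \<in> K" "\<And>z t. (z, t) \<in> K \<Longrightarrow> D z t - k t \<le> D z1 t1 - k t1"
    by auto
  have ge: "3 * \<eta> / 4 \<le> D z1 t1 - k t1"
    using max1(2)[OF z0K] k0 by (simp add: \<eta>_def)
  have z1: "z1 \<in> \<Omega>" "0 < t1" "t1 \<le> T1" using max1(1) by (auto simp: K_def)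
  have "D z t - k t \<le> D z1 t1 - k t1" if "z \<in> \<Omega>" "0 < t" for z t
  proof (cases "t \<le> T1 \<and> \<eta> / 2 \<le> D z t")
    case True
    then show ?thesis using that by (intro max1(2)) (auto simp: K_def)
  next
    case False
    have "D z t - k t \<le> \<eta> / 2"
    proof (cases "t \<le> T1")
      case True
      then show ?thesis using False k_nonneg[OF that(2)] by simp
    next
      case False
      then have "D z t \<le> k t" using bound[OF that] k_large[of t] B' by (simp add: D_def w_def)
      then show ?thesis using \<eta> by simp
    qed
    then show ?thesis using ge \<eta> by simp
  qed
  then have "\<forall>z\<in>\<Omega>. \<forall>s>0. v z s - (w z s + k s) \<le> v z1 t1 - (w z1 t1 + k t1)"
    by (simp add: D_def algebra_simps)
  moreover have "C2_on (\<lambda>(z, t). w z t + k t) (\<Omega> \<times> {0<..})"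
  proof -
    have "C2_on (\<lambda>x. (case x of (z, t) \<Rightarrow> w z t) + (e * (case x of (z, t) \<Rightarrow> t) + B' * ((1 / T1) * (case x of (z, t) \<Rightarrow> t)) ^ n)) (\<Omega> \<times> {0<..})"
      using C2 unfolding w_def[symmetric]
      by (intro C2_on_add C2_on_cmult C2_on_power C2_on_time) auto
    then show ?thesis by (simp add: case_prod_unfold k_def)
  qed
  ultimately have visc: "deriv (\<lambda>t. w z1 t + k t) t1 +
      lower_env (game_F p) (grad (\<lambda>z. w z t1 + k t1) z1) (hessian (\<lambda>z. w z t1 + k t1) z1) \<le> 0"
    using sub z1(1,2) unfolding viscosity_subsolution_def by blast
  define Q where "Q = (norm (z1 - c))\<^sup>2"
  define k' where "k' = e + B' * (real n * (t1 / T1) ^ (n - 1) * (1 / T1))"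
  have k'_pos: "0 < k'"
  proof -
    have "0 \<le> B' * (real n * (t1 / T1) ^ (n - 1) * (1 / T1))" using B' T1 z1 by simp
    then show ?thesis using e by (simp add: k'_def)
  qed
  have "(k has_real_derivative k') (at t1)"
  proof -
    have "((\<lambda>t. t / T1) has_real_derivative 1 / T1) (at t1)"
      using DERIV_cdivide[OF DERIV_ident] .
    from DERIV_power[OF this, of n]
    have "((\<lambda>t. (t / T1) ^ n) has_real_derivative real n * (t1 / T1) ^ (n - 1) * (1 / T1)) (at t1)"
      by (simp add: mult_ac)
    from DERIV_add[OF DERIV_cmult_Id[of e] DERIV_cmult[OF this, of B']]
    show ?thesis unfolding k_def k'_def .
  qed
  then have "((\<lambda>t. w z1 t + k t) has_real_derivative \<phi>t Q t1 + k') (at t1)"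
    unfolding w_def Q_def by (intro DERIV_add dt z1)
  then have 1: "deriv (\<lambda>t. w z1 t + k t) t1 = \<phi>t Q t1 + k'" by (rule DERIV_imp_deriv)
  have d1': "((\<lambda>q. \<phi> q t1 + k t1) has_real_derivative \<phi>1 q t1) (at q)" for q
    using DERIV_add[OF d1[OF z1(2)] DERIV_const] by simp
  have 2: "grad (\<lambda>z. w z t1 + k t1) z1 = (2 * \<phi>1 Q t1) *\<^sub>R (z1 - c)"
    unfolding w_def Q_def by (rule grad_radial[OF d1'])
  have 3: "hessian (\<lambda>z. w z t1 + k t1) z1 = radial_matrix (4 * \<phi>2 Q t1) (2 * \<phi>1 Q t1) (z1 - c)"
    unfolding w_def Q_def by (rule hessian_radial[OF d1' d2[OF z1(2)]])
  \<comment> \<open>\<open>super\<close> is assumed only where the barrier lies below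
    \<open>v\<close>; the contact point is such a point.\<close>
  have "0 < D z1 t1" using ge \<eta> k_nonneg[OF z1(2)] by simp
  then have "\<phi>1 Q t1 \<noteq> 0 \<and> 4 * \<phi>2 Q t1 * Q * normal_coeff p + 2 * \<phi>1 Q t1 * trace_coeff p CARD('n) \<le> \<phi>t Q t1"
    unfolding Q_def using z1 T1 by (intro super) (auto simp: D_def w_def)
  moreover have "- (4 * \<phi>2 Q t1 * Q * normal_coeff p + 2 * \<phi>1 Q t1 * trace_coeff p CARD('n)) \<le>
      lower_env (game_F p) ((2 * \<phi>1 Q t1) *\<^sub>R (z1 - c)) (radial_matrix (4 * \<phi>2 Q t1) (2 * \<phi>1 Q t1) (z1 - c))"
    if "\<phi>1 Q t1 \<noteq> 0"
    using lower_env_radial[OF p, of "2 * \<phi>1 Q t1" "4 * \<phi>2 Q t1" "z1 - c"] that by (simp add: Q_def)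
  ultimately show False
    using visc k'_pos unfolding 1 2 3 by force
qed

section \<open>Tangent balls\<close>

lemma grad_inner:
  fixes f :: "real^'n \<Rightarrow> real"
  assumes "(f has_derivative f') (at x)"
  shows "f' h = grad f x \<bullet> h"
proof -
  have l: "linear f'" using assms has_derivative_linear by blast
  have "f' h = f' (\<Sum>i\<in>UNIV. h $ i *\<^sub>R axis i 1)"
    by (metis (no_types, lifting) basis_expansion scalar_mult_eq_scaleR sum.cong)
  also have "\<dots> = (\<Sum>i\<in>UNIV. h $ i * f' (axis i 1))"
    using linear_sum[OF l, of "\<lambda>i. h $ i *\<^sub>R axis i 1" UNIV] linear_scale[OF l] by simp
  also have "\<dots> = grad f x \<bullet> h"
    by (simp add: grad_def frechet_derivative_at[OF assms, symmetric] inner_vec_def mult.commute)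
  finally show ?thesis .
qed

text \<open>The Lipschitz bound comes from the continuity of the second derivative on a compact
  ball; it is what makes the radii of tangent balls locally uniform.\<close>

lemma C2_on_grad:
  fixes g :: "real^'n \<Rightarrow> real"
  assumes "C2_on g UNIV"
  shows "(g has_derivative (\<lambda>h. grad g a \<bullet> h)) (at a)"
    "(grad g has_derivative (\<lambda>h. hessian g a *v h)) (at a)"
    "continuous_on UNIV (grad g)"
    "\<exists>L>0. \<forall>a\<in>cball a0 r. \<forall>b\<in>cball a0 r. norm (grad g b - grad g a) \<le> L * norm (b - a)"
proof -
  obtain g' g'' where g: "\<And>x. (g has_derivative blinfun_apply (g' x)) (at x)"
    "\<And>x. (g' has_derivative blinfun_apply (g'' x)) (at x)" "continuous_on UNIV g''"
    using assms unfolding C2_on_def by blast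
  show 1: "(g has_derivative (\<lambda>h. grad g a \<bullet> h)) (at a)" for a
    using g(1)[of a] grad_inner[OF g(1)[of a]] by (metis (no_types, lifting) ext)
  have g'_eq: "g' x h = grad g x \<bullet> h" for x h by (rule grad_inner[OF g(1)])
  have D: "(grad g has_derivative (\<lambda>h. \<chi> i. g'' a h (axis i 1))) (at a)" for a
  proof -
    have "grad g = (\<lambda>x. \<chi> i. g' x (axis i 1))"
      by (simp add: fun_eq_iff vec_eq_iff g'_eq inner_axis)
    then show ?thesis
      unfolding has_derivative_componentwise_within[of "grad g"]
      by (auto simp: Basis_vec_def inner_axis intro!: bounded_linear.has_derivative[OF blinfun.bounded_linear_left g(2)])
  qed
  then show 2: "(grad g has_derivative (\<lambda>h. hessian g a *v h)) (at a)" for a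
    using hessian_eq_matrix[OF open_UNIV UNIV_I _ D] matrix_vector_mul(2)[OF has_derivative_linear[OF D]]
    by (metis (no_types, lifting))
  then show "continuous_on UNIV (grad g)"
    by (meson continuous_at_imp_continuous_on has_derivative_continuous)
  have "compact (g'' ` cball a0 r)"
    by (intro compact_continuous_image continuous_on_subset[OF g(3)]) auto
  then obtain L where L: "0 < L" "\<forall>a\<in>cball a0 r. norm (g'' a) \<le> L"
    using compact_imp_bounded[of "g'' ` cball a0 r"] unfolding bounded_pos by blast
  have "norm (grad g b - grad g a) \<le> L * norm (b - a)" if "a \<in> cball a0 r" "b \<in> cball a0 r" for a b
  proof -
    let ?n = "grad g b - grad g a"
    have "norm (g' b - g' a) \<le> L * norm (b - a)"
      by (rule differentiable_bound[of "cball a0 r" g' "\<lambda>x. blinfun_apply (g'' x)"])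
         (use g(2) L that in \<open>auto intro: has_derivative_at_withinI simp: norm_blinfun.rep_eq[symmetric]\<close>)
    \<comment> \<open>Evaluating the functional \<open>g' b - g' a\<close> at the vector
      \<open>?n\<close> that represents it bounds \<open>norm ?n\<close> by the operator
      norm.\<close>
    moreover have "norm ?n * norm ?n \<le> norm (g' b - g' a) * norm ?n"
    proof -
      have "norm ?n * norm ?n = (g' b - g' a) ?n"
        by (simp add: minus_blinfun.rep_eq g'_eq inner_diff_left[symmetric] power2_norm_eq_inner[symmetric] power2_eq_square[symmetric])
      also have "\<dots> \<le> norm (g' b - g' a) * norm ?n"
        using norm_blinfun[of "g' b - g' a" ?n] by simp
      finally show ?thesis .
    qed
    ultimately have "norm ?n * norm ?n \<le> (L * norm (b - a)) * norm ?n"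
      by (meson mult_right_mono norm_ge_zero order_trans)
    then show ?thesis using L(1) by (cases "?n = 0") (auto simp: mult_nonneg_nonneg)
  qed
  then show "\<exists>L>0. \<forall>a\<in>cball a0 r. \<forall>b\<in>cball a0 r. norm (grad g b - grad g a) \<le> L * norm (b - a)"
    using L(1) by blast
qed

text \<open>The mean value inequality is applied to \<open>g\<close> minus its linear part at
  \<open>a\<close>, whose gradient on the segment is at most \<open>L * norm (b - a)\<close>. One
  constant serves all base points of the ball.\<close>

lemma C2_on_Taylor1:
  fixes g :: "real^'n \<Rightarrow> real"
  assumes "C2_on g UNIV"
  obtains L where "L > 0"
    "\<And>a b. a \<in> cball a0 r \<Longrightarrow> b \<in> cball a0 r \<Longrightarrow> \<bar>g b - g a - grad g a \<bullet> (b - a)\<bar> \<le> L * (norm (b - a))\<^sup>2"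
proof -
  obtain L where L: "L > 0"
    "\<forall>a\<in>cball a0 r. \<forall>b\<in>cball a0 r. norm (grad g b - grad g a) \<le> L * norm (b - a)"
    using C2_on_grad(4)[OF assms] by blast
  have "\<bar>g b - g a - grad g a \<bullet> (b - a)\<bar> \<le> L * (norm (b - a))\<^sup>2"
    if ab: "a \<in> cball a0 r" "b \<in> cball a0 r" for a b
  proof -
    let ?h = "\<lambda>x. g x - grad g a \<bullet> x"
    have seg: "closed_segment a b \<subseteq> cball a0 r" using ab by (intro closed_segment_subset) auto
    have "norm (?h b - ?h a) \<le> (L * norm (b - a)) * norm (b - a)"
    proof (rule differentiable_bound[of "closed_segment a b" _ "\<lambda>x h. (grad g x - grad g a) \<bullet> h"])
      fix x assume x: "x \<in> closed_segment a b"
      show "(?h has_derivative (\<lambda>h. (grad g x - grad g a) \<bullet> h)) (at x within closed_segment a b)"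
        by (rule has_derivative_at_withinI, rule has_derivative_eq_rhs, rule has_derivative_diff[OF C2_on_grad(1)[OF assms]])
           (auto intro!: derivative_eq_intros simp: inner_diff_left)
      have "norm (grad g x - grad g a) \<le> L * norm (x - a)" using L(2) seg x ab by blast
      also have "\<dots> \<le> L * norm (b - a)"
        using x L(1) segment_bound1[of x a b] by (simp add: norm_minus_commute)
      finally have "norm (grad g x - grad g a) \<le> L * norm (b - a)" .
      then show "onorm (\<lambda>h. (grad g x - grad g a) \<bullet> h) \<le> L * norm (b - a)"
        unfolding real_norm_def
        by (intro onorm_le, unfold real_norm_def)
          (rule order_trans[OF Cauchy_Schwarz_ineq2 mult_right_mono], auto)
    qed auto
    then show ?thesis by (simp add: power2_eq_square inner_diff_right algebra_simps)
  qed
  with L(1) show ?thesis using that by blast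
qed

definition hyperplane_proj :: "'a::real_inner \<Rightarrow> 'a \<Rightarrow> 'a" where
  "hyperplane_proj e z = z - (z \<bullet> e) *\<^sub>R e"

text \<open>The gradient of \<open>z \<bullet> e - g (hyperplane_proj e z)\<close>, the function
  that is positive exactly on the side of \<Omega>: an interior normal to the graph, not of unit
  length.\<close>

definition graph_normal :: "(real^'n \<Rightarrow> real) \<Rightarrow> real^'n \<Rightarrow> real^'n \<Rightarrow> real^'n" where
  "graph_normal g e z = e - hyperplane_proj e (grad g (hyperplane_proj e z))"

lemma hyperplane_proj_diff: "hyperplane_proj e (a - b) = hyperplane_proj e a - hyperplane_proj e b"
  by (simp add: hyperplane_proj_def algebra_simps inner_diff_left)

lemma hyperplane_proj_inner:
  assumes "norm e = 1"
  shows "hyperplane_proj e z \<bullet> e = 0"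
  using assms by (simp add: hyperplane_proj_def inner_diff_left power2_norm_eq_inner[symmetric])

lemma hyperplane_proj_swap: "hyperplane_proj e a \<bullet> b = a \<bullet> hyperplane_proj e b"
  by (simp add: hyperplane_proj_def inner_diff_left inner_diff_right inner_commute)

lemma norm_hyperplane_proj_le:
  assumes "norm e = 1"
  shows "norm (hyperplane_proj e z) \<le> norm z"
proof -
  have "e \<bullet> e = 1" using assms by (simp add: power2_norm_eq_inner[symmetric])
  then have "(norm (hyperplane_proj e z))\<^sup>2 = (norm z)\<^sup>2 - (z \<bullet> e)\<^sup>2"
    unfolding power2_norm_eq_inner
    by (simp add: hyperplane_proj_def inner_diff_left inner_diff_right inner_commute power2_eq_square)
  then have "(norm (hyperplane_proj e z))\<^sup>2 \<le> (norm z)\<^sup>2" by simp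
  then show ?thesis by (rule power2_le_imp_le) simp
qed

lemma graph_normal_inner: "norm e = 1 \<Longrightarrow> graph_normal g e z \<bullet> e = 1"
  by (simp add: graph_normal_def inner_diff_left hyperplane_proj_inner power2_norm_eq_inner[symmetric])

lemma norm_graph_normal_ge: "norm e = 1 \<Longrightarrow> 1 \<le> norm (graph_normal g e z)"
  using norm_cauchy_schwarz[of "graph_normal g e z" e] by (simp add: graph_normal_inner)

text \<open>In this form membership in a ball tangent at \<open>P\<close> compares a quadratic with
  a linear term, and so can be set against a Taylor bound for the graph.\<close>

lemma ball_translate_iff:
  assumes "norm \<nu> = 1"
  shows "z \<in> ball (P + r *\<^sub>R \<nu>) r \<longleftrightarrow> 0 < r \<and> (norm (z - P))\<^sup>2 < 2 * r * ((z - P) \<bullet> \<nu>)"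
proof -
  have "(norm (z - (P + r *\<^sub>R \<nu>)))\<^sup>2 = (norm (z - P))\<^sup>2 - 2 * r * ((z - P) \<bullet> \<nu>) + r\<^sup>2"
    using assms dot_norm_neg[of "z - P" "r *\<^sub>R \<nu>"] by (simp add: diff_diff_eq)
  moreover have "z \<in> ball (P + r *\<^sub>R \<nu>) r \<longleftrightarrow> 0 < r \<and> (norm (z - (P + r *\<^sub>R \<nu>)))\<^sup>2 < r\<^sup>2"
  proof -
    have "n < r \<longleftrightarrow> 0 < r \<and> n\<^sup>2 < r\<^sup>2" if "0 \<le> n" for n :: real
      using that power_strict_mono[of n r 2] power2_less_imp_less[of n r] by force
    from this[of "norm (z - (P + r *\<^sub>R \<nu>))"] show ?thesis
      unfolding mem_ball dist_norm norm_minus_commute[of _ z] by simp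
  qed
  ultimately show ?thesis by auto
qed

text \<open>Second-order Taylor bounds give tangent balls on both sides with a radius that is uniform near
  a boundary point.\<close>

lemma graph_tangent_balls:
  fixes \<Omega> :: "(real^'n) set"
  assumes gr: "C2_graph_at \<Omega> y0 e g" and "open \<Omega>"
  obtains h r0 where "h > 0" "r0 > 0"
    "\<And>P. norm (P - y0) < h \<Longrightarrow> P \<in> frontier \<Omega> \<Longrightarrow> P \<bullet> e = g (hyperplane_proj e P)"
    "\<And>P r. norm (P - y0) < h \<Longrightarrow> P \<bullet> e = g (hyperplane_proj e P) \<Longrightarrow> 0 < r \<Longrightarrow> r \<le> r0 \<Longrightarrow>
       ball (P + r *\<^sub>R sgn (graph_normal g e P)) r \<subseteq> \<Omega> \<and>
       ball (P - r *\<^sub>R sgn (graph_normal g e P)) r \<inter> \<Omega> = {}"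
proof -
  let ?p = "hyperplane_proj e"
  obtain U where e: "norm e = 1" and g: "C2_on g UNIV" and U: "open U" "y0 \<in> U"
    and \<Omega>: "\<Omega> \<inter> U = {z \<in> U. g (?p z) < z \<bullet> e}"
    using gr unfolding C2_graph_at_def hyperplane_proj_def by blast
  obtain \<delta> where \<delta>: "\<delta> > 0" "ball y0 \<delta> \<subseteq> U" using U openE by blast
  obtain L where L: "L > 0" "\<And>a b. a \<in> cball (?p y0) \<delta> \<Longrightarrow> b \<in> cball (?p y0) \<delta> \<Longrightarrow>
      \<bar>g b - g a - grad g a \<bullet> (b - a)\<bar> \<le> L * (norm (b - a))\<^sup>2"
    using C2_on_Taylor1[OF g] by metis
  \<comment> \<open>\<open>\<delta> / 4\<close> keeps points at distance less than
    \<open>2 r\<close> from \<open>P\<close> inside \<open>U\<close>; \<open>1 / (2 * L)\<close>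
    makes the Taylor error at most \<open>|z - P|^2 / (2 r)\<close>, the quadratic term of the ball
    condition.\<close>
  define r0 where "r0 = min (\<delta> / 4) (1 / (2 * L))"
  have r0: "0 < r0" "r0 \<le> \<delta> / 4" "r0 \<le> 1 / (2 * L)" using \<delta> L by (auto simp: r0_def)
  have pcont: "continuous_on UNIV ?p" unfolding hyperplane_proj_def by (intro continuous_intros)
  have gcont: "continuous_on UNIV g" by (rule C2_on_continuous_on[OF g])
  show thesis
  proof (rule that[of "\<delta> / 2" r0])
    fix P assume P: "norm (P - y0) < \<delta> / 2" "P \<in> frontier \<Omega>"
    have PU: "P \<in> U" using P \<delta> by (auto simp: dist_norm norm_minus_commute)
    have "P \<notin> \<Omega>" using P \<open>open \<Omega>\<close> by (auto simp: frontier_def interior_open)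
    then have "P \<bullet> e \<le> g (?p P)" using \<Omega> PU by force
    moreover have "\<not> P \<bullet> e < g (?p P)"
    proof
      assume lt: "P \<bullet> e < g (?p P)"
      have "open {z. z \<bullet> e < g (?p z)}"
        by (intro open_Collect_less continuous_intros continuous_on_compose2[OF gcont pcont]) auto
      then have "open (U \<inter> {z. z \<bullet> e < g (?p z)})" using U by blast
      moreover have "(U \<inter> {z. z \<bullet> e < g (?p z)}) \<inter> \<Omega> = {}" using \<Omega> by force
      ultimately have "(U \<inter> {z. z \<bullet> e < g (?p z)}) \<inter> closure \<Omega> = {}"
        by (simp add: open_Int_closure_eq_empty)
      then show False using P(2) PU lt by (auto simp: frontier_def)
    qed
    ultimately show "P \<bullet> e = g (?p P)" by simp
  next
    fix P r assume P: "norm (P - y0) < \<delta> / 2" "P \<bullet> e = g (?p P)" and r: "0 < r" "r \<le> r0"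
    define n where "n = graph_normal g e P"
    define \<nu> where "\<nu> = sgn n"
    have n: "1 \<le> norm n" unfolding n_def by (rule norm_graph_normal_ge[OF e])
    have \<nu>: "norm \<nu> = 1" using n by (auto simp: \<nu>_def norm_sgn)
    have \<nu>n: "x \<bullet> \<nu> = (x \<bullet> n) / norm n" for x by (simp add: \<nu>_def sgn_div_norm divide_inverse mult.commute)
    have main: "z \<in> U \<and> g (?p z) - grad g (?p P) \<bullet> (?p z - ?p P) - g (?p P) \<le> (norm (z - P))\<^sup>2 / (2 * r)
        \<and> - (norm (z - P))\<^sup>2 / (2 * r) \<le> g (?p z) - grad g (?p P) \<bullet> (?p z - ?p P) - g (?p P)
        \<and> (z - P) \<bullet> n = (z - P) \<bullet> e - grad g (?p P) \<bullet> (?p z - ?p P)"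
      if "norm (z - P) < 2 * r" for z
    proof -
      have "norm (z - y0) < \<delta>" using norm_triangle_ineq[of "z - P" "P - y0"] that P r r0 by simp
      moreover have "norm (?p z - ?p y0) \<le> norm (z - y0)" "norm (?p P - ?p y0) \<le> norm (P - y0)"
        "norm (?p z - ?p P) \<le> norm (z - P)"
        unfolding hyperplane_proj_diff[symmetric] by (rule norm_hyperplane_proj_le[OF e])+
      ultimately have "z \<in> U" "?p z \<in> cball (?p y0) \<delta>" "?p P \<in> cball (?p y0) \<delta>"
        "(norm (?p z - ?p P))\<^sup>2 \<le> (norm (z - P))\<^sup>2"
        using P \<delta> by (auto simp: dist_norm norm_minus_commute intro: power_mono)
      moreover have "L * (norm (?p z - ?p P))\<^sup>2 \<le> (norm (z - P))\<^sup>2 / (2 * r)"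
      proof -
        have "r \<le> 1 / (2 * L)" using r r0 by linarith
        then have "L \<le> 1 / (2 * r)" using r L by (simp add: field_simps)
        then have "L * (norm (?p z - ?p P))\<^sup>2 \<le> (1 / (2 * r)) * (norm (z - P))\<^sup>2"
          using calculation(4) r by (intro mult_mono) auto
        then show ?thesis by simp
      qed
      ultimately show ?thesis using L(2)[of "?p P" "?p z"]
        by (simp add: n_def graph_normal_def inner_diff_right hyperplane_proj_swap[symmetric] hyperplane_proj_diff abs_le_iff inner_commute)
    qed
    have close: "norm (z - P) < 2 * r" if "norm \<nu>' = 1" "z \<in> ball (P + r *\<^sub>R \<nu>') r" for z \<nu>'
      using that norm_triangle_ineq[of "z - (P + r *\<^sub>R \<nu>')" "r *\<^sub>R \<nu>'"] r
      by (simp add: dist_norm norm_minus_commute)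
    \<comment> \<open>The normal \<open>n\<close> has length at least 1 and the bound is positive,
      so the ball condition for the unit normal implies the one for \<open>n\<close>.\<close>
    have up: "(norm (z - P))\<^sup>2 / (2 * r) < s" if "(norm (z - P))\<^sup>2 < 2 * r * (s / norm n)" for z s
    proof -
      have "0 \<le> (norm (z - P))\<^sup>2" by simp
      then have "0 < s / norm n" using that r by (metis le_less_trans mult_pos_pos zero_less_mult_pos zero_less_numeral)
      then have "s / norm n \<le> s" using n by (simp add: zero_less_divide_iff divide_le_eq mult_le_cancel_left1)
      then have "2 * r * (s / norm n) \<le> 2 * r * s" using r by (intro mult_left_mono) auto
      then have "(norm (z - P))\<^sup>2 < 2 * r * s" using that by linarith
      then show ?thesis using r by (simp add: field_simps)
    qed
    show "ball (P + r *\<^sub>R sgn (graph_normal g e P)) r \<subseteq> \<Omega> \<and> ball (P - r *\<^sub>R sgn (graph_normal g e P)) r \<inter> \<Omega> = {}"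
      unfolding n_def[symmetric] \<nu>_def[symmetric]
    proof (intro conjI subsetI equals0I)
      fix z assume z: "z \<in> ball (P + r *\<^sub>R \<nu>) r"
      then have "(norm (z - P))\<^sup>2 < 2 * r * (((z - P) \<bullet> n) / norm n)"
        unfolding ball_translate_iff[OF \<nu>] by (simp add: \<nu>n)
      from up[OF this] have "g (?p z) < z \<bullet> e" "z \<in> U"
        using main[OF close[OF \<nu> z]] P(2) by (auto simp: inner_diff_left)
      then show "z \<in> \<Omega>" using \<Omega> by blast
    next
      fix z assume z: "z \<in> ball (P - r *\<^sub>R \<nu>) r \<inter> \<Omega>"
      then have z': "z \<in> ball (P + r *\<^sub>R (- \<nu>)) r" by simp
      have \<nu>': "norm (- \<nu>) = 1" using \<nu> by simp
      have "(norm (z - P))\<^sup>2 < 2 * r * (- ((z - P) \<bullet> n) / norm n)"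
        using z' unfolding ball_translate_iff[OF \<nu>'] by (simp add: \<nu>n)
      from up[OF this] have "z \<bullet> e < g (?p z)" "z \<in> U"
        using main[OF close[OF \<nu>' z']] P(2) by (auto simp: inner_diff_left)
      then show False using \<Omega> z by force
    qed
  qed (use \<delta> r0 in auto)
qed

lemma exterior_balls:
  fixes \<Omega> :: "(real^'n) set"
  assumes "C2_domain \<Omega>" "y0 \<in> frontier \<Omega>"
  obtains h r0 where "h > 0" "r0 > 0"
    "\<And>P r. P \<in> frontier \<Omega> \<Longrightarrow> norm (P - y0) < h \<Longrightarrow> 0 < r \<Longrightarrow> r \<le> r0 \<Longrightarrow> \<exists>c. norm (c - P) = r \<and> ball c r \<inter> \<Omega> = {}"
proof -
  obtain e g where gr: "C2_graph_at \<Omega> y0 e g" and o: "open \<Omega>"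
    using assms unfolding C2_domain_def by blast
  have e: "norm e = 1" using gr by (simp add: C2_graph_at_def)
  obtain h r0 where h: "h > 0" "r0 > 0"
    "\<And>P. norm (P - y0) < h \<Longrightarrow> P \<in> frontier \<Omega> \<Longrightarrow> P \<bullet> e = g (hyperplane_proj e P)"
    "\<And>P r. norm (P - y0) < h \<Longrightarrow> P \<bullet> e = g (hyperplane_proj e P) \<Longrightarrow> 0 < r \<Longrightarrow> r \<le> r0 \<Longrightarrow>
       ball (P + r *\<^sub>R sgn (graph_normal g e P)) r \<subseteq> \<Omega> \<and>
       ball (P - r *\<^sub>R sgn (graph_normal g e P)) r \<inter> \<Omega> = {}"
    using graph_tangent_balls[OF gr o] by metis
  show thesis
  proof (rule that[OF h(1,2)])
    fix P r assume P: "P \<in> frontier \<Omega>" "norm (P - y0) < h" "0 < r" "r \<le> r0"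
    have "graph_normal g e P \<noteq> 0" using norm_graph_normal_ge[OF e, of g P] by auto
    then have "norm (P - r *\<^sub>R sgn (graph_normal g e P) - P) = r"
      using P by (simp add: norm_sgn)
    then show "\<exists>c. norm (c - P) = r \<and> ball c r \<inter> \<Omega> = {}"
      using h(3,4) P by blast
  qed
qed

section \<open>Barriers\<close>

text \<open>The variable \<open>q\<close> stands for \<open>|z - c|^2\<close>. With \<alpha> for
  \<open>normal_coeff p\<close>, \<open>b = 1 / (4 r sqrt \<alpha>)\<close> and
  \<open>A = b r^2\<close>, the argument is \<open>(r^2 - q) / (2 r)\<close> divided by
  \<open>2 sqrt (\<alpha> t)\<close>, minus the drift \<open>k sqrt t\<close>. Exterior balls use
  the opposite signs of \<open>M\<close>, \<open>A\<close>, \<open>b\<close> and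
  \<open>k\<close>.\<close>

definition erfc_barrier :: "real \<Rightarrow> real \<Rightarrow> real \<Rightarrow> real \<Rightarrow> real \<Rightarrow> real \<Rightarrow> real" where
  "erfc_barrier M A b k q t = M * Erfc ((A - b * q) * t powr (- (1/2)) - k * t powr (1/2))"

definition erfc_arg :: "real \<Rightarrow> real \<Rightarrow> real \<Rightarrow> real \<Rightarrow> real \<Rightarrow> real" where
  "erfc_arg A b k q t = (A - b * q) * t powr (- (1/2)) - k * t powr (1/2)"

lemma erfc_barrier_eq: "erfc_barrier M A b k q t = M * Erfc (erfc_arg A b k q t)"
  by (simp add: erfc_barrier_def erfc_arg_def)

lemma powr_half_mult:
  assumes "0 < (t::real)"
  shows "t powr (- (1/2)) * t powr (- (1/2)) = 1 / t" "t powr (1/2) * t powr (- (1/2)) = 1"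
    "t powr (- (1/2)) = 1 / sqrt t" "t powr (1/2) = sqrt t"
proof -
  show 1: "t powr (1/2) = sqrt t" using assms by (simp add: powr_half_sqrt)
  show 2: "t powr (- (1/2)) = 1 / sqrt t" using assms by (simp add: powr_minus powr_half_sqrt inverse_eq_divide)
  show "t powr (- (1/2)) * t powr (- (1/2)) = 1 / t" "t powr (1/2) * t powr (- (1/2)) = 1"
    unfolding 1 2 using assms by simp_all
qed

lemma C2_on_erfc_barrier:
  fixes c :: "real^'n"
  shows "C2_on (\<lambda>(z, t). erfc_barrier M A b k ((norm (z - c))\<^sup>2) t) (\<Omega> \<times> {0<..})"
proof -
  have "C2_on (\<lambda>x::(real^'n) \<times> real. M * Erfc ((A - b * (\<lambda>(z, t). (norm (z - c))\<^sup>2) x) * ((\<lambda>(z, t). t) x) powr (- (1/2))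
      - k * ((\<lambda>(z, t). t) x) powr (1/2))) (\<Omega> \<times> {0<..})"
    by (intro C2_on_cmult C2_on_Erfc C2_on_diff C2_on_mult C2_on_const C2_on_dist_square C2_on_powr C2_on_time) auto
  then show ?thesis by (simp add: erfc_barrier_def case_prod_unfold)
qed

lemma erfc_barrier_derivs:
  fixes M A b k q t :: real
  assumes t: "0 < t"
  defines "g \<equiv> \<lambda>q t. exp (- (erfc_arg A b k q t)\<^sup>2)"
  shows "((\<lambda>q. erfc_barrier M A b k q t) has_real_derivative
      2 * M * b / sqrt pi * t powr (- (1/2)) * g q t) (at q)"
    "((\<lambda>q. 2 * M * b / sqrt pi * t powr (- (1/2)) * g q t) has_real_derivative
      4 * M * b\<^sup>2 / sqrt pi / t * erfc_arg A b k q t * g q t) (at q)"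
    "((\<lambda>t. erfc_barrier M A b k q t) has_real_derivative
      M / sqrt pi / t * (erfc_arg A b k q t + 2 * k * sqrt t) * g q t) (at t)"
proof -
  have dq: "((\<lambda>q. erfc_arg A b k q t) has_real_derivative - b * t powr (- (1/2))) (at q)" for q
    unfolding erfc_arg_def by (auto intro!: derivative_eq_intros)
  have "((\<lambda>q. M * Erfc (erfc_arg A b k q t)) has_real_derivative
     M * ((- 2 / sqrt pi * exp (- (erfc_arg A b k q t)\<^sup>2)) * (- b * t powr (- (1/2))))) (at q)"
    by (intro DERIV_cmult DERIV_chain2[OF Erfc_has_real_derivative] dq)
  then show "((\<lambda>q. erfc_barrier M A b k q t) has_real_derivative
      2 * M * b / sqrt pi * t powr (- (1/2)) * g q t) (at q)"
    by (simp add: erfc_barrier_eq g_def mult_ac)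
  have "((\<lambda>q. g q t) has_real_derivative
      exp (- (erfc_arg A b k q t)\<^sup>2) * (- (2 * erfc_arg A b k q t * (- b * t powr (- (1/2)))))) (at q)"
    unfolding g_def using dq[of q] by (auto intro!: derivative_eq_intros)
  then have "((\<lambda>q. 2 * M * b / sqrt pi * t powr (- (1/2)) * g q t) has_real_derivative
      2 * M * b / sqrt pi * t powr (- (1/2)) *
      (exp (- (erfc_arg A b k q t)\<^sup>2) * (- (2 * erfc_arg A b k q t * (- b * t powr (- (1/2))))))) (at q)"
    by (rule DERIV_cmult)
  moreover have "2 * M * b / sqrt pi * t powr (- (1/2)) *
      (exp (- (erfc_arg A b k q t)\<^sup>2) * (- (2 * erfc_arg A b k q t * (- b * t powr (- (1/2)))))) =
      4 * M * b\<^sup>2 / sqrt pi * (t powr (- (1/2)) * t powr (- (1/2))) * erfc_arg A b k q t * g q t"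
    by (simp add: g_def power2_eq_square)
  ultimately show "((\<lambda>q. 2 * M * b / sqrt pi * t powr (- (1/2)) * g q t) has_real_derivative
      4 * M * b\<^sup>2 / sqrt pi / t * erfc_arg A b k q t * g q t) (at q)"
    unfolding powr_half_mult(1)[OF t] by simp
  have "((\<lambda>t. erfc_arg A b k q t) has_real_derivative
      (A - b * q) * (- (1/2) * t powr (- (1/2) - 1)) - k * (1/2 * t powr (1/2 - 1))) (at t)"
    unfolding erfc_arg_def
    by (intro DERIV_diff DERIV_cmult has_real_derivative_powr[OF t])
  moreover have "(A - b * q) * (- (1/2) * t powr (- (1/2) - 1)) - k * (1/2 * t powr (1/2 - 1)) =
     - (erfc_arg A b k q t + 2 * k * sqrt t) / (2 * t)"
  proof -
    have "t powr (- (1/2) - 1) = t powr (- (1/2)) / t powr 1" "t powr (1/2 - 1) = t powr (1/2) / t powr 1"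
      by (rule powr_diff)+
    then have e: "t powr (- (1/2) - 1) = t powr (- (1/2)) / t" "t powr (1/2 - 1) = t powr (1/2) / t"
      using t by simp_all
    show ?thesis
      unfolding e erfc_arg_def powr_half_mult(4)[OF t, symmetric] using t by (simp add: field_simps)
  qed
  ultimately have dt: "((\<lambda>t. erfc_arg A b k q t) has_real_derivative - (erfc_arg A b k q t + 2 * k * sqrt t) / (2 * t)) (at t)"
    by simp
  have "((\<lambda>t. M * Erfc (erfc_arg A b k q t)) has_real_derivative
     M * ((- 2 / sqrt pi * exp (- (erfc_arg A b k q t)\<^sup>2)) * (- (erfc_arg A b k q t + 2 * k * sqrt t) / (2 * t)))) (at t)"
    by (intro DERIV_cmult DERIV_chain2[OF Erfc_has_real_derivative] dt)
  moreover have "M * ((- 2 / sqrt pi * exp (- (erfc_arg A b k q t)\<^sup>2)) * (- (erfc_arg A b k q t + 2 * k * sqrt t) / (2 * t))) =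
     M / sqrt pi / t * (erfc_arg A b k q t + 2 * k * sqrt t) * g q t"
    using t by (simp add: g_def field_simps)
  ultimately show "((\<lambda>t. erfc_barrier M A b k q t) has_real_derivative
      M / sqrt pi / t * (erfc_arg A b k q t + 2 * k * sqrt t) * g q t) (at t)"
    unfolding erfc_barrier_eq by simp
qed

text \<open>The sign of \<open>M\<close> decides whether the barrier is a supersolution inside or outside the ball
  \<open>q < r\<^sup>2\<close>; the drift \<open>k\<close> absorbs the lower order term in both cases.\<close>

lemma erfc_barrier_super:
  fixes M A b k q t :: real
  assumes p: "1 < p" and N: "2 \<le> n" and t: "0 < t" and r: "0 < r"
    and \<beta>: "\<beta> = 1 / (4 * r * sqrt (normal_coeff p))"
    and cases: "(0 < M \<and> b = \<beta> \<and> k = 2 * \<beta> * real n \<and> 0 \<le> q \<and> q \<le> r\<^sup>2) \<or>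
      (M < 0 \<and> b = - \<beta> \<and> k = - 2 * \<beta> * real n \<and> r\<^sup>2 \<le> q)"
    and x: "0 \<le> erfc_arg A b k q t"
  defines "g \<equiv> exp (- (erfc_arg A b k q t)\<^sup>2)"
  shows "2 * M * b / sqrt pi * t powr (- (1/2)) * g \<noteq> 0"
    "4 * (4 * M * b\<^sup>2 / sqrt pi / t * erfc_arg A b k q t * g) * q * normal_coeff p
      + 2 * (2 * M * b / sqrt pi * t powr (- (1/2)) * g) * trace_coeff p n
      \<le> M / sqrt pi / t * (erfc_arg A b k q t + 2 * k * sqrt t) * g"
proof -
  define \<alpha> where "\<alpha> = normal_coeff p"
  define x where "x = erfc_arg A b k q t"
  have \<alpha>: "0 < \<alpha>" unfolding \<alpha>_def by (rule normal_coeff_bounds[OF p])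
  have \<beta>pos: "0 < \<beta>" using \<alpha> r by (simp add: \<beta> \<alpha>_def)
  have "\<beta>\<^sup>2 * \<alpha> = 1 / (16 * r\<^sup>2)"
    using \<alpha> r by (simp add: \<beta> \<alpha>_def[symmetric] power_divide power_mult_distrib)
  then have b2: "b\<^sup>2 * \<alpha> = 1 / (16 * r\<^sup>2)" using cases by auto
  have g: "0 < g" by (simp add: g_def)
  have M: "M \<noteq> 0" "b \<noteq> 0" using cases \<beta>pos by auto
  show "2 * M * b / sqrt pi * t powr (- (1/2)) * g \<noteq> 0" using M g t by simp
  have s: "t powr (- (1/2)) = sqrt t / t"
    unfolding powr_half_mult(3)[OF t] using t by (simp add: field_simps)
  \<comment> \<open>This is the claimed inequality up to the positive factor
    \<open>g / (sqrt pi * t)\<close>. The value of \<beta> is the one with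
    \<open>16 b^2 \<alpha> = 1 / r^2\<close>, which turns the second-derivative term into
    \<open>x q / r^2\<close>. The drift pays for the trace term because
    \<open>trace_coeff p n \<le> n\<close>.\<close>
  have "M * (x * (1 - q / r\<^sup>2) + 2 * sqrt t * (k - 2 * b * trace_coeff p n)) \<ge> 0"
  proof -
    have tr: "2 * b * trace_coeff p n \<le> k \<and> 0 < M \<or> k \<le> 2 * b * trace_coeff p n \<and> M < 0"
      using cases trace_coeff_bounds[OF p N] \<beta>pos by (auto simp: mult_left_mono)
    have "0 \<le> x * (1 - q / r\<^sup>2) \<and> 0 < M \<or> x * (1 - q / r\<^sup>2) \<le> 0 \<and> M < 0"
      using cases x r by (auto simp: x_def[symmetric] divide_le_eq le_divide_eq intro!: mult_nonneg_nonneg mult_nonneg_nonpos)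
    moreover have "0 \<le> 2 * sqrt t * (k - 2 * b * trace_coeff p n) \<and> 0 < M \<or> 2 * sqrt t * (k - 2 * b * trace_coeff p n) \<le> 0 \<and> M < 0"
      using tr t by (auto simp: mult_nonneg_nonneg mult_nonneg_nonpos)
    ultimately show ?thesis
      using mult_nonneg_nonneg[of M "x * (1 - q / r\<^sup>2) + 2 * sqrt t * (k - 2 * b * trace_coeff p n)"]
        mult_nonpos_nonpos[of M "x * (1 - q / r\<^sup>2) + 2 * sqrt t * (k - 2 * b * trace_coeff p n)"]
      by linarith
  qed
  then have "0 \<le> g / (sqrt pi * t) * (M * (x * (1 - q / r\<^sup>2) + 2 * sqrt t * (k - 2 * b * trace_coeff p n)))"
    using g t by simp
  also have "1 - q / r\<^sup>2 = 1 - 16 * (b\<^sup>2 * \<alpha>) * q"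
    unfolding b2 using r by (simp add: field_simps)
  also have "g / (sqrt pi * t) * (M * (x * (1 - 16 * (b\<^sup>2 * \<alpha>) * q) + 2 * sqrt t * (k - 2 * b * trace_coeff p n))) =
     M / sqrt pi / t * (x + 2 * k * sqrt t) * g - (4 * (4 * M * b\<^sup>2 / sqrt pi / t * x * g) * q * \<alpha>
      + 2 * (2 * M * b / sqrt pi * (sqrt t / t) * g) * trace_coeff p n)"
  proof -
    define y where "y = sqrt pi"
    have "y \<noteq> 0" by (simp add: y_def)
    then show ?thesis unfolding y_def[symmetric] using t by (simp add: field_simps)
  qed
  finally show "4 * (4 * M * b\<^sup>2 / sqrt pi / t * erfc_arg A b k q t * g) * q * normal_coeff p
      + 2 * (2 * M * b / sqrt pi * t powr (- (1/2)) * g) * trace_coeff p n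
      \<le> M / sqrt pi / t * (erfc_arg A b k q t + 2 * k * sqrt t) * g"
    unfolding s x_def \<alpha>_def by simp
qed

text \<open>Used for \<open>u\<close> with boundary bound 1 and for \<open>- u\<close> with any
  boundary bound from -1 on. At the corners nothing beyond boundedness is assumed.\<close>

locale dirichlet_subsolution =
  fixes p :: ereal and \<Omega> :: "(real^'n) set" and v :: "real^'n \<Rightarrow> real \<Rightarrow> real" and b M :: real
  assumes p: "1 < p" and dim: "2 \<le> CARD('n)" and dom: "C2_domain \<Omega>"
    and sub: "viscosity_subsolution p \<Omega> v"
    and cont: "continuous_on (\<Omega> \<times> {0..} \<union> frontier \<Omega> \<times> {0<..}) (\<lambda>(z, t). v z t)"
    and initial: "\<And>z. z \<in> \<Omega> \<Longrightarrow> v z 0 \<le> 0"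
    and boundary: "\<And>z t. z \<in> frontier \<Omega> \<Longrightarrow> 0 < t \<Longrightarrow> v z t \<le> b"
    and bound: "\<And>z t. z \<in> \<Omega> \<Longrightarrow> 0 < t \<Longrightarrow> v z t \<le> M"
begin

lemma open_domain: "open \<Omega>"
  using dom by (simp add: C2_domain_def)

lemma cont_interior: "continuous_on (\<Omega> \<times> {0<..}) (\<lambda>(z, t). v z t)"
  by (rule continuous_on_subset[OF cont]) auto

lemma near_value:
  assumes "(\<zeta>, s) \<in> \<Omega> \<times> {0..} \<union> frontier \<Omega> \<times> {0<..}" "v \<zeta> s < m"
  shows "\<exists>\<delta>>0. \<forall>z\<in>\<Omega>. \<forall>t>0. norm (z - \<zeta>) < \<delta> \<longrightarrow> \<bar>t - s\<bar> < \<delta> \<longrightarrow> v z t < m"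
proof -
  have "\<forall>\<^sub>F x in at (\<zeta>, s) within \<Omega> \<times> {0..} \<union> frontier \<Omega> \<times> {0<..}. (\<lambda>(z, t). v z t) x < m"
    using cont assms unfolding continuous_on_def by (force intro!: order_tendstoD(2))
  then obtain d where d: "d > 0" "\<forall>x\<in>\<Omega> \<times> {0..} \<union> frontier \<Omega> \<times> {0<..}. 0 < dist x (\<zeta>, s) \<and> dist x (\<zeta>, s) < d \<longrightarrow> (\<lambda>(z, t). v z t) x < m"
    unfolding eventually_at by auto
  have "v z t < m" if zt: "z \<in> \<Omega>" "0 < t" "norm (z - \<zeta>) < d / 2" "\<bar>t - s\<bar> < d / 2" for z t
  proof (cases "(z, t) = (\<zeta>, s)")
    case False
    have "dist (z, t) (\<zeta>, s) \<le> norm (z - \<zeta>) + \<bar>t - s\<bar>"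
      using sqrt_sum_squares_le_sum_abs[of "norm (z - \<zeta>)" "t - s"] by (simp add: dist_Pair_Pair dist_real_def dist_norm[where 'a="real^'n"])
    then have "dist (z, t) (\<zeta>, s) < d" using zt by simp
    then show ?thesis using d(2)[rule_format, of "(z, t)"] zt False by simp
  qed (use assms in auto)
  then show ?thesis using d(1) by (intro exI[of _ "d / 2"]) auto
qed

text \<open>Outside the ball the barrier is at least \<open>M\<close>, the global bound for
  \<open>v\<close>. Hence the frontier, the corners and infinity are harmless, and the supersolution
  property matters only inside. Since the closed ball lies in \<Omega>, each frontier point has a
  neighbourhood outside it.\<close>

lemma ball_upper_bound:
  assumes M: "0 < M" and ball: "cball c r \<subseteq> \<Omega>" and r: "0 < r" and z0: "z0 \<in> \<Omega>" and t0: "0 < t0"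
  shows "v z0 t0 \<le> M * Erfc (((r\<^sup>2 - (norm (z0 - c))\<^sup>2) / (2 * r) - real CARD('n) * t0 / r) / (2 * sqrt (normal_coeff p * t0)))"
proof -
  define \<beta> where "\<beta> = 1 / (4 * r * sqrt (normal_coeff p))"
  have \<alpha>: "0 < normal_coeff p" by (rule normal_coeff_bounds[OF p])
  have \<beta>: "0 < \<beta>" using r \<alpha> by (simp add: \<beta>_def)
  define k where "k = 2 * \<beta> * real CARD('n)"
  define x where "x = erfc_arg (\<beta> * r\<^sup>2) \<beta> k"
  define \<phi> where "\<phi> = erfc_barrier M (\<beta> * r\<^sup>2) \<beta> k"
  have \<phi>: "\<phi> q t = M * Erfc (x q t)" for q t by (simp add: \<phi>_def x_def erfc_barrier_eq)
  have x: "x q t = (\<beta> * (r\<^sup>2 - q) - k * t) / sqrt t" if "0 < t" for q t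
  proof -
    have "k * t / sqrt t = k * sqrt t" using that by (simp add: real_div_sqrt flip: times_divide_eq_right)
    then show ?thesis
      using that unfolding x_def erfc_arg_def powr_half_mult(3,4)[OF that]
      by (simp add: diff_divide_distrib right_diff_distrib)
  qed
  have k: "0 < k" using \<beta> by (simp add: k_def)
  have outside: "M \<le> \<phi> q t" if "0 < t" "r\<^sup>2 \<le> q" for q t
  proof -
    have "\<beta> * (r\<^sup>2 - q) \<le> 0" using that \<beta> by (intro mult_nonneg_nonpos) auto
    moreover have "0 < k * t" using that k by simp
    ultimately have "x q t \<le> 0" unfolding x[OF that(1)] using that by (intro divide_nonpos_pos) auto
    then show ?thesis using Erfc_antimono[of "x q t" 0] M by (simp add: \<phi>)
  qed
  have pos: "0 \<le> \<phi> q t" for q t using M by (simp add: \<phi> Erfc_nonneg)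
  have "v z0 t0 \<le> \<phi> ((norm (z0 - c))\<^sup>2) t0"
  proof (rule radial_comparison[OF sub p open_domain cont_interior, where B=M and T="t0 + 1"])
    show "v z t - \<phi> ((norm (z - c))\<^sup>2) t \<le> M" if "z \<in> \<Omega>" "0 < t" for z t
      using bound[OF that] pos[of "(norm (z - c))\<^sup>2" t] by simp
    show "C2_on (\<lambda>(z, t). \<phi> ((norm (z - c))\<^sup>2) t) (\<Omega> \<times> {0<..})"
      unfolding \<phi>_def by (rule C2_on_erfc_barrier)
  next
    fix z t assume z: "z \<in> \<Omega>" "0 < t" "t < t0 + 1" "\<phi> ((norm (z - c))\<^sup>2) t < v z t"
    have lt: "\<phi> ((norm (z - c))\<^sup>2) t < M" using bound z by fastforce
    then have q: "(norm (z - c))\<^sup>2 \<le> r\<^sup>2" using outside[of t "(norm (z - c))\<^sup>2"] z by force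
    have "0 \<le> x ((norm (z - c))\<^sup>2) t"
    proof (rule ccontr)
      assume "\<not> 0 \<le> x ((norm (z - c))\<^sup>2) t"
      then have "1 \<le> Erfc (x ((norm (z - c))\<^sup>2) t)" using Erfc_antimono[of _ 0] by simp
      then show False using lt M by (simp add: \<phi>)
    qed
    then show "2 * M * \<beta> / sqrt pi * t powr (- (1/2)) * exp (- (erfc_arg (\<beta> * r\<^sup>2) \<beta> k ((norm (z - c))\<^sup>2) t)\<^sup>2) \<noteq> 0 \<and>
        4 * (4 * M * \<beta>\<^sup>2 / sqrt pi / t * erfc_arg (\<beta> * r\<^sup>2) \<beta> k ((norm (z - c))\<^sup>2) t * exp (- (erfc_arg (\<beta> * r\<^sup>2) \<beta> k ((norm (z - c))\<^sup>2) t)\<^sup>2)) * (norm (z - c))\<^sup>2 * normal_coeff p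
         + 2 * (2 * M * \<beta> / sqrt pi * t powr (- (1/2)) * exp (- (erfc_arg (\<beta> * r\<^sup>2) \<beta> k ((norm (z - c))\<^sup>2) t)\<^sup>2)) * trace_coeff p CARD('n)
       \<le> M / sqrt pi / t * (erfc_arg (\<beta> * r\<^sup>2) \<beta> k ((norm (z - c))\<^sup>2) t + 2 * k * sqrt t) * exp (- (erfc_arg (\<beta> * r\<^sup>2) \<beta> k ((norm (z - c))\<^sup>2) t)\<^sup>2)"
      using erfc_barrier_super[OF p dim z(2) r \<beta>_def, of M \<beta> k "(norm (z - c))\<^sup>2" "\<beta> * r\<^sup>2"] q M
      by (simp add: k_def x_def)
  next
    fix \<zeta> and s \<epsilon> :: real assume \<zeta>: "\<zeta> \<in> closure \<Omega>" "0 \<le> s" "\<zeta> \<notin> \<Omega> \<or> s = 0" "0 < \<epsilon>"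
    show "\<exists>\<delta>>0. \<forall>z\<in>\<Omega>. \<forall>t>0. norm (z - \<zeta>) < \<delta> \<longrightarrow> \<bar>t - s\<bar> < \<delta> \<longrightarrow> v z t - \<phi> ((norm (z - c))\<^sup>2) t < \<epsilon>"
    proof (cases "\<zeta> \<in> \<Omega>")
      case True
      then have "v \<zeta> s < \<epsilon>" using \<zeta> initial[OF True] by auto
      then obtain \<delta> where "\<delta> > 0" "\<forall>z\<in>\<Omega>. \<forall>t>0. norm (z - \<zeta>) < \<delta> \<longrightarrow> \<bar>t - s\<bar> < \<delta> \<longrightarrow> v z t < \<epsilon>"
        using near_value[of \<zeta> s \<epsilon>] True \<zeta> by auto
      moreover have "v z t - \<phi> ((norm (z - c))\<^sup>2) t < \<epsilon>" if "v z t < \<epsilon>" for z t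
        using that pos[of "(norm (z - c))\<^sup>2" t] by simp
      ultimately show ?thesis by blast
    next
      case False
      then have "\<zeta> \<notin> cball c r" using ball by blast
      then have d: "0 < norm (\<zeta> - c) - r" by (simp add: dist_norm norm_minus_commute)
      have "v z t - \<phi> ((norm (z - c))\<^sup>2) t < \<epsilon>" if "z \<in> \<Omega>" "0 < t" "norm (z - \<zeta>) < norm (\<zeta> - c) - r" for z t
      proof -
        have "r \<le> norm (z - c)"
          using norm_triangle_ineq[of "\<zeta> - z" "z - c"] that(3) by (simp add: norm_minus_commute)
        then have "r\<^sup>2 \<le> (norm (z - c))\<^sup>2" using r by (intro power_mono) auto
        then show ?thesis using outside[OF that(2)] bound[OF that(1,2)] \<zeta>(4) by fastforce
      qed
      then show ?thesis using d by blast
    qed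
  next
    fix \<epsilon> :: real assume \<epsilon>: "0 < \<epsilon>"
    have "norm z \<le> norm c + r" if "z \<in> \<Omega>" "0 < t" "\<epsilon> \<le> v z t - \<phi> ((norm (z - c))\<^sup>2) t" for z t
    proof -
      have "\<not> r\<^sup>2 \<le> (norm (z - c))\<^sup>2" using that bound[of z t] outside[of t "(norm (z - c))\<^sup>2"] \<epsilon> by fastforce
      then have "(norm (z - c))\<^sup>2 < r\<^sup>2" by simp
      then have "norm (z - c) < r" using r by (simp add: power2_less_imp_less)
      then show ?thesis using norm_triangle_ineq[of "z - c" c] by simp
    qed
    then show "\<exists>L. \<forall>z\<in>\<Omega>. \<forall>t>0. t < t0 + 1 \<longrightarrow> \<epsilon> \<le> v z t - \<phi> ((norm (z - c))\<^sup>2) t \<longrightarrow> norm z \<le> L" by blast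
  qed (use erfc_barrier_derivs[where M=M and b=\<beta> and k=k and A="\<beta> * r\<^sup>2"] z0 t0 in \<open>auto simp: \<phi>_def\<close>)
  also have "x ((norm (z0 - c))\<^sup>2) t0 = ((r\<^sup>2 - (norm (z0 - c))\<^sup>2) / (2 * r) - real CARD('n) * t0 / r) / (2 * sqrt (normal_coeff p * t0))"
    using t0 r \<alpha> by (simp add: x k_def \<beta>_def real_sqrt_mult field_simps)
  then have "\<phi> ((norm (z0 - c))\<^sup>2) t0 = M * Erfc (((r\<^sup>2 - (norm (z0 - c))\<^sup>2) / (2 * r) - real CARD('n) * t0 / r) / (2 * sqrt (normal_coeff p * t0)))"
    by (simp add: \<phi>)
  finally show ?thesis .
qed


text \<open>With a constant \<open>r\<^sup>2 < (norm (z - c))\<^sup>2\<close> on \<open>\<Omega>\<close> the barrier vanishes uniformly as \<open>t \<rightarrow> 0\<close>, so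
  no condition at the corners is needed.\<close>

lemma ball_lower_bound:
  assumes nonpos: "\<And>z t. z \<in> \<Omega> \<Longrightarrow> 0 < t \<Longrightarrow> v z t \<le> 0" and b: "b = - 1"
    and ball: "ball c r' \<inter> \<Omega> = {}" and r: "0 < r" "r < r'" and z0: "z0 \<in> \<Omega>" and t0: "0 < t0"
  shows "v z0 t0 \<le> - Erfc ((((norm (z0 - c))\<^sup>2 - r\<^sup>2) / (2 * r) + real CARD('n) * t0 / r) / (2 * sqrt (normal_coeff p * t0)))"
proof -
  define \<beta> where "\<beta> = 1 / (4 * r * sqrt (normal_coeff p))"
  have \<alpha>: "0 < normal_coeff p" by (rule normal_coeff_bounds[OF p])
  have \<beta>: "0 < \<beta>" using r \<alpha> by (simp add: \<beta>_def)
  define k where "k = 2 * \<beta> * real CARD('n)"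
  have k: "0 < k" using \<beta> by (simp add: k_def)
  define x where "x = erfc_arg (- \<beta> * r\<^sup>2) (- \<beta>) (- k)"
  define \<phi> where "\<phi> = erfc_barrier (- 1) (- \<beta> * r\<^sup>2) (- \<beta>) (- k)"
  have \<phi>: "\<phi> q t = - Erfc (x q t)" for q t by (simp add: \<phi>_def x_def erfc_barrier_eq)
  have x: "x q t = (\<beta> * (q - r\<^sup>2) + k * t) / sqrt t" if "0 < t" for q t
  proof -
    have "k * t / sqrt t = k * sqrt t" using that by (simp add: real_div_sqrt flip: times_divide_eq_right)
    then show ?thesis
      using that unfolding x_def erfc_arg_def powr_half_mult(3,4)[OF that]
      by (simp add: diff_divide_distrib add_divide_distrib right_diff_distrib)
  qed
  have x_ge: "\<beta> * (q - r\<^sup>2) / sqrt t \<le> x q t" if "0 < t" for q t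
    unfolding x[OF that] using that k by (intro divide_right_mono) auto
  have far: "r' \<le> norm (z - c)" if "z \<in> closure \<Omega>" for z
  proof -
    have "ball c r' \<inter> closure \<Omega> = {}" using ball by (simp add: open_Int_closure_eq_empty)
    then show ?thesis using that by (force simp: dist_norm norm_minus_commute)
  qed
  have far2: "r'\<^sup>2 \<le> (norm (z - c))\<^sup>2" if "z \<in> \<Omega>" for z
    using far[of z] that closure_subset[of \<Omega>] r by (intro power_mono) auto
  have rr: "r\<^sup>2 < r'\<^sup>2" using r by (intro power_strict_mono) auto
  have x_ge2: "\<beta> * (r'\<^sup>2 - r\<^sup>2) / sqrt t \<le> x ((norm (z - c))\<^sup>2) t" if "z \<in> \<Omega>" "0 < t" for z t
    using far2[OF that(1)] \<beta> that(2)
    by (intro order_trans[OF _ x_ge[OF that(2)]] divide_right_mono mult_left_mono) auto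
  have x_pos: "0 \<le> x ((norm (z - c))\<^sup>2) t" if "z \<in> \<Omega>" "0 < t" for z t
    using x_ge2[OF that] \<beta> rr that(2) by (intro order_trans[OF _ x_ge2[OF that]]) simp
  have \<phi>_ge: "- 1 \<le> \<phi> ((norm (z - c))\<^sup>2) t" if "z \<in> \<Omega>" "0 < t" for z t
    using Erfc_antimono[OF x_pos[OF that]] by (simp add: \<phi>)
  have small: "\<exists>X>0. \<forall>y\<ge>X. Erfc y < \<epsilon>" if "0 < \<epsilon>" for \<epsilon>
  proof -
    have "\<forall>\<^sub>F y in at_top. Erfc y < \<epsilon>" by (rule order_tendstoD(2)[OF Erfc_at_top that])
    then obtain X where "\<forall>y\<ge>X. Erfc y < \<epsilon>" by (auto simp: eventually_at_top_linorder)
    then show ?thesis by (intro exI[of _ "max X 1"]) auto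
  qed
  have "v z0 t0 \<le> \<phi> ((norm (z0 - c))\<^sup>2) t0"
  proof (rule radial_comparison[OF sub p open_domain cont_interior, where B=1 and T="t0 + 1"])
    show "v z t - \<phi> ((norm (z - c))\<^sup>2) t \<le> 1" if "z \<in> \<Omega>" "0 < t" for z t
      using nonpos[OF that] \<phi>_ge[OF that] by simp
    show "C2_on (\<lambda>(z, t). \<phi> ((norm (z - c))\<^sup>2) t) (\<Omega> \<times> {0<..})"
      unfolding \<phi>_def by (rule C2_on_erfc_barrier)
  next
    fix z t assume z: "z \<in> \<Omega>" "0 < t" "t < t0 + 1" "\<phi> ((norm (z - c))\<^sup>2) t < v z t"
    show "2 * (- 1) * (- \<beta>) / sqrt pi * t powr (- (1/2)) * exp (- (erfc_arg (- \<beta> * r\<^sup>2) (- \<beta>) (- k) ((norm (z - c))\<^sup>2) t)\<^sup>2) \<noteq> 0 \<and>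
        4 * (4 * (- 1) * (- \<beta>)\<^sup>2 / sqrt pi / t * erfc_arg (- \<beta> * r\<^sup>2) (- \<beta>) (- k) ((norm (z - c))\<^sup>2) t * exp (- (erfc_arg (- \<beta> * r\<^sup>2) (- \<beta>) (- k) ((norm (z - c))\<^sup>2) t)\<^sup>2)) * (norm (z - c))\<^sup>2 * normal_coeff p
         + 2 * (2 * (- 1) * (- \<beta>) / sqrt pi * t powr (- (1/2)) * exp (- (erfc_arg (- \<beta> * r\<^sup>2) (- \<beta>) (- k) ((norm (z - c))\<^sup>2) t)\<^sup>2)) * trace_coeff p CARD('n)
       \<le> (- 1) / sqrt pi / t * (erfc_arg (- \<beta> * r\<^sup>2) (- \<beta>) (- k) ((norm (z - c))\<^sup>2) t + 2 * (- k) * sqrt t) * exp (- (erfc_arg (- \<beta> * r\<^sup>2) (- \<beta>) (- k) ((norm (z - c))\<^sup>2) t)\<^sup>2)"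
      using far2[OF z(1)] rr x_pos[OF z(1,2)]
      by (intro conjI erfc_barrier_super[OF p dim z(2) r(1) \<beta>_def]) (auto simp: k_def x_def)
  next
    fix \<zeta> and s \<epsilon> :: real assume \<zeta>: "\<zeta> \<in> closure \<Omega>" "0 \<le> s" "\<zeta> \<notin> \<Omega> \<or> s = 0" "0 < \<epsilon>"
    show "\<exists>\<delta>>0. \<forall>z\<in>\<Omega>. \<forall>t>0. norm (z - \<zeta>) < \<delta> \<longrightarrow> \<bar>t - s\<bar> < \<delta> \<longrightarrow> v z t - \<phi> ((norm (z - c))\<^sup>2) t < \<epsilon>"
    proof (cases "s = 0")
      case False
      then have f: "\<zeta> \<in> frontier \<Omega>" "0 < s" using \<zeta> open_domain by (auto simp: frontier_def interior_open)
      have "v \<zeta> s < - 1 + \<epsilon>" using boundary[OF f] b \<zeta> by simp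
      then obtain \<delta> where "\<delta> > 0" "\<forall>z\<in>\<Omega>. \<forall>t>0. norm (z - \<zeta>) < \<delta> \<longrightarrow> \<bar>t - s\<bar> < \<delta> \<longrightarrow> v z t < - 1 + \<epsilon>"
        using near_value[of \<zeta> s "- 1 + \<epsilon>"] f by auto
      moreover have "v z t - \<phi> ((norm (z - c))\<^sup>2) t < \<epsilon>" if "v z t < - 1 + \<epsilon>" "z \<in> \<Omega>" "0 < t" for z t
        using that \<phi>_ge[of z t] by simp
      ultimately show ?thesis by blast
    next
      case True
      obtain X where X: "X > 0" "\<forall>y\<ge>X. Erfc y < \<epsilon>" using small[OF \<zeta>(4)] by blast
      define A where "A = \<beta> * (r'\<^sup>2 - r\<^sup>2)"
      have A: "0 < A" using \<beta> rr by (simp add: A_def)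
      have "v z t - \<phi> ((norm (z - c))\<^sup>2) t < \<epsilon>" if "z \<in> \<Omega>" "0 < t" "\<bar>t - s\<bar> < (A / X)\<^sup>2" for z t
      proof -
        have "sqrt t < A / X" using that True A X by (intro real_less_lsqrt) auto
        then have "X \<le> A / sqrt t" using X that by (simp add: field_simps)
        then have "X \<le> x ((norm (z - c))\<^sup>2) t" using x_ge2[OF that(1,2)] by (simp add: A_def)
        then show ?thesis using X(2) nonpos[OF that(1,2)] by (fastforce simp: \<phi>)
      qed
      then show ?thesis using A X by (intro exI[of _ "(A / X)\<^sup>2"]) auto
    qed
  next
    fix \<epsilon> :: real assume \<epsilon>: "0 < \<epsilon>"
    obtain X where X: "X > 0" "\<forall>y\<ge>X. Erfc y < \<epsilon>" using small[OF \<epsilon>] by blast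
    have "norm z \<le> norm c + sqrt (r\<^sup>2 + X * sqrt (t0 + 1) / \<beta>)"
      if "z \<in> \<Omega>" "0 < t" "t < t0 + 1" "\<epsilon> \<le> v z t - \<phi> ((norm (z - c))\<^sup>2) t" for z t
    proof -
      have "\<epsilon> \<le> Erfc (x ((norm (z - c))\<^sup>2) t)" using that nonpos[OF that(1,2)] by (simp add: \<phi>)
      then have "x ((norm (z - c))\<^sup>2) t < X" using X(2) by (meson not_le)
      then have "\<beta> * ((norm (z - c))\<^sup>2 - r\<^sup>2) / sqrt t < X" using x_ge[OF that(2), of "(norm (z - c))\<^sup>2"] by linarith
      then have "\<beta> * ((norm (z - c))\<^sup>2 - r\<^sup>2) < X * sqrt t" using that by (simp add: field_simps)
      also have "\<dots> \<le> X * sqrt (t0 + 1)" using X that by simp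
      finally have "(norm (z - c))\<^sup>2 \<le> r\<^sup>2 + X * sqrt (t0 + 1) / \<beta>" using \<beta> by (simp add: field_simps)
      then have "norm (z - c) \<le> sqrt (r\<^sup>2 + X * sqrt (t0 + 1) / \<beta>)" by (rule real_le_rsqrt)
      then show ?thesis using norm_triangle_ineq[of "z - c" c] by simp
    qed
    then show "\<exists>L. \<forall>z\<in>\<Omega>. \<forall>t>0. t < t0 + 1 \<longrightarrow> \<epsilon> \<le> v z t - \<phi> ((norm (z - c))\<^sup>2) t \<longrightarrow> norm z \<le> L" by blast
  qed (use z0 t0 in \<open>auto simp only: \<phi>_def intro!: erfc_barrier_derivs\<close>)
  also have "x ((norm (z0 - c))\<^sup>2) t0 = (((norm (z0 - c))\<^sup>2 - r\<^sup>2) / (2 * r) + real CARD('n) * t0 / r) / (2 * sqrt (normal_coeff p * t0))"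
    using t0 r \<alpha> by (simp add: x k_def \<beta>_def real_sqrt_mult field_simps)
  then have "\<phi> ((norm (z0 - c))\<^sup>2) t0 = - Erfc ((((norm (z0 - c))\<^sup>2 - r\<^sup>2) / (2 * r) + real CARD('n) * t0 / r) / (2 * sqrt (normal_coeff p * t0)))"
    by (simp add: \<phi>)
  finally show ?thesis .
qed

end

section \<open>Bounds near the corners and the maximum principle\<close>

context dirichlet_subsolution
begin

text \<open>An upper bound at positive times in a neighbourhood of the corner
  \<open>(y, 0)\<close>.\<close>

definition locally_below :: "real^'n \<Rightarrow> real \<Rightarrow> bool" where
  "locally_below y m \<longleftrightarrow> (\<exists>h>0. \<forall>z\<in>\<Omega>. \<forall>t>0. norm (z - y) < h \<longrightarrow> t < h \<longrightarrow> v z t \<le> m)"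

text \<open>At the centre of a ball of radius \<open>K * sqrt t\<close> the Erfc argument in
  \<open>ball_upper_bound\<close> does not depend on \<open>t\<close> and is large with
  \<open>K\<close>. So values above \<open>b\<close> can occur only within distance
  \<open>K * sqrt t\<close> of the complement of \<Omega>.\<close>

lemma below_boundary_value_far_from_boundary:
  assumes b: "0 < b" and bM: "b < M"
  obtains K where "1 \<le> K" "\<And>z t. z \<in> \<Omega> \<Longrightarrow> 0 < t \<Longrightarrow> cball z (K * sqrt t) \<subseteq> \<Omega> \<Longrightarrow> v z t \<le> b"
proof -
  define \<alpha> where "\<alpha> = normal_coeff p"
  have \<alpha>: "0 < \<alpha>" unfolding \<alpha>_def by (rule normal_coeff_bounds[OF p])
  have "\<forall>\<^sub>F x in at_top. Erfc x < b / M"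
    using b bM by (intro order_tendstoD(2)[OF Erfc_at_top]) auto
  then obtain X0 where "\<forall>x\<ge>X0. Erfc x < b / M" by (auto simp: eventually_at_top_linorder)
  then obtain X where X: "0 < X" "\<And>x. X \<le> x \<Longrightarrow> Erfc x < b / M" by (metis max.bounded_iff max.strict_coboundedI2 zero_less_one)
  \<comment> \<open>With \<open>n\<close> for the dimension, this value gives
    \<open>K / 2 - n / K \<ge> 2 sqrt \<alpha> X\<close>, because
    \<open>n / K \<le> n\<close>.\<close>
  define K where "K = 4 * sqrt \<alpha> * X + 2 * real CARD('n)"
  have K: "1 \<le> K" 
  proof -
    have "0 < 4 * sqrt \<alpha> * X" using X(1) \<alpha> by simp
    moreover have "2 \<le> real CARD('n)" using dim by simp
    ultimately show ?thesis unfolding K_def by linarith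
  qed
  have "v z t \<le> b" if z: "z \<in> \<Omega>" and t: "0 < t" and ball: "cball z (K * sqrt t) \<subseteq> \<Omega>" for z t
  proof -
    let ?r = "K * sqrt t"
    have r: "0 < ?r" using K t by simp
    have "v z t \<le> M * Erfc (((?r\<^sup>2 - (norm (z - z))\<^sup>2) / (2 * ?r) - real CARD('n) * t / ?r) / (2 * sqrt (\<alpha> * t)))"
      unfolding \<alpha>_def using b bM by (intro ball_upper_bound[OF _ ball r z t]) simp
    also have "((?r\<^sup>2 - (norm (z - z))\<^sup>2) / (2 * ?r) - real CARD('n) * t / ?r) / (2 * sqrt (\<alpha> * t)) = (K / 2 - real CARD('n) / K) / (2 * sqrt \<alpha>)"
    proof -
      have "?r\<^sup>2 / (2 * ?r) = K / 2 * sqrt t" "real CARD('n) * t / ?r = real CARD('n) / K * sqrt t"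
        using K t by (auto simp: power2_eq_square field_simps)
      then have "(?r\<^sup>2 - (norm (z - z))\<^sup>2) / (2 * ?r) - real CARD('n) * t / ?r = (K / 2 - real CARD('n) / K) * sqrt t"
        by (simp only: left_diff_distrib) simp
      then show ?thesis using t \<alpha> by (simp only: real_sqrt_mult) simp
    qed
    also have "M * Erfc \<dots> \<le> M * (b / M)"
    proof (intro mult_left_mono less_imp_le[OF X(2)])
      have "real CARD('n) / K \<le> real CARD('n)" using K by (simp add: divide_le_eq mult_le_cancel_left1)
      moreover have "K / 2 = 2 * sqrt \<alpha> * X + real CARD('n)" by (simp add: K_def)
      ultimately have "2 * sqrt \<alpha> * X \<le> K / 2 - real CARD('n) / K" by linarith
      then show "X \<le> (K / 2 - real CARD('n) / K) / (2 * sqrt \<alpha>)" using \<alpha> by (simp add: field_simps)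
    qed (use b bM in auto)
    finally show ?thesis using b bM by simp
  qed
  then show thesis using that K by blast
qed

text \<open>On the scale \<open>\<tau>\<close> the barrier subtracts from a local upper bound \<open>m\<close> a Gaussian-type bump around
  the centre of an exterior ball of radius \<open>\<surd>\<tau>\<close>. The bump is a subsolution where it exceeds \<open>S0\<close>, and
  it is below \<open>S0\<close> for very small times, so that the unknown behaviour at the corners is
  irrelevant. All terms are radial, so that the gradient has the radial direction.\<close>

lemma corner_bump_bound:
  fixes c :: "real^'n"
  assumes b: "0 < b" and m: "b < m" "m \<le> M"
    and h: "0 < h" "\<And>z t. z \<in> \<Omega> \<Longrightarrow> 0 < t \<Longrightarrow> norm (z - y) < h \<Longrightarrow> t < h \<Longrightarrow> v z t \<le> m"
    and ball: "ball c (sqrt \<tau>) \<inter> \<Omega> = {}" and c: "norm (c - y) \<le> h / 2"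
    and \<tau>: "0 < \<tau>" "2 * \<tau> \<le> h"
    and L: "1 \<le> L" and \<beta>: "1 \<le> \<beta>" "2 * real CARD('n) + (L\<^sup>2 + 2)\<^sup>2 + 1 \<le> 4 * \<beta> * normal_coeff p"
    and S0: "S0 = exp (- \<beta> * (L\<^sup>2 + 1)) / 2"
    and \<tau>1: "2 * (4 * M / h\<^sup>2) * real CARD('n) * \<tau> \<le> (m - b) * S0"
    and z0: "z0 \<in> \<Omega>"
  shows "v z0 \<tau> \<le> b + (m - b) * (1 - (exp (- \<beta> * ((norm (z0 - c))\<^sup>2 / \<tau> + 1)) - S0)) + 4 * M / h\<^sup>2 * (norm (z0 - c))\<^sup>2"
proof -
  \<comment> \<open>Chosen with \<open>P (h / 2)^2 = M\<close>: at distance \<open>h / 2\<close>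
    from \<open>c\<close> the quadratic term alone dominates \<open>v\<close>, so the local bound
    \<open>m\<close> is used only near \<open>y\<close>.\<close>
  define P where "P = 4 * M / h\<^sup>2"
  have P: "0 < P" using b m h(1) by (simp add: P_def)
  define E where "E q t = exp (- \<beta> * (q / \<tau> + \<tau> / t))" for q t
  define \<phi> where "\<phi> q t = b + (m - b) * (1 - (E q t - S0)) + P * q" for q t
  have S0pos: "0 < S0" by (simp add: S0)
  have E_le: "E q t \<le> 1" if "0 \<le> q" "0 < t" for q t
    using that \<tau> \<beta> by (simp add: E_def)
  have \<phi>_ge: "b \<le> \<phi> q t" if "0 \<le> q" "0 < t" for q t
  proof -
    have "0 \<le> (m - b) * (1 - (E q t - S0))" using E_le[OF that] S0pos m by simp
    moreover have "0 \<le> P * q" using P that by simp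
    ultimately show ?thesis unfolding \<phi>_def by linarith
  qed
  \<comment> \<open>Where the bump is at most \<open>S0\<close> the barrier is above
    \<open>v\<close> without any differential inequality; this disposes of very small times and of
    points far from \<open>c\<close>.\<close>
  have key: "v z t \<le> \<phi> ((norm (z - c))\<^sup>2) t"
    if z: "z \<in> \<Omega>" "0 < t" "t < h" "E ((norm (z - c))\<^sup>2) t \<le> S0" for z t
  proof -
    have "0 \<le> (m - b) * (S0 - E ((norm (z - c))\<^sup>2) t)" using z m by simp
    then have ge: "m + P * (norm (z - c))\<^sup>2 \<le> \<phi> ((norm (z - c))\<^sup>2) t"
      by (simp add: \<phi>_def algebra_simps)
    show ?thesis
    proof (cases "norm (z - y) < h")
      case True
      have "0 \<le> P * (norm (z - c))\<^sup>2" using P by simp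
      then show ?thesis using h(2)[OF z(1,2) True z(3)] ge by linarith
    next
      case False
      have "norm (z - y) \<le> norm (z - c) + norm (c - y)" using norm_triangle_ineq[of "z - c" "c - y"] by simp
      then have "h / 2 \<le> norm (z - c)" using False c by linarith
      then have "(h / 2)\<^sup>2 \<le> (norm (z - c))\<^sup>2" using h by (intro power_mono) auto
      then have "P * (h / 2)\<^sup>2 \<le> P * (norm (z - c))\<^sup>2" using P by simp
      moreover have "P * (h / 2)\<^sup>2 = M" using h by (simp add: P_def power_divide)
      ultimately show ?thesis using bound[OF z(1,2)] ge b m by linarith
    qed
  qed
  have far: "\<tau> \<le> (norm (z - c))\<^sup>2" if "z \<in> \<Omega>" for z
  proof -
    have "z \<notin> ball c (sqrt \<tau>)" using ball that by blast
    then have "sqrt \<tau> \<le> norm (z - c)" by (simp add: dist_norm norm_minus_commute)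
    then show ?thesis using \<tau> by (simp add: real_sqrt_le_iff sqrt_le_D)
  qed
  \<comment> \<open>One more unit in the exponent than in the definition of \<open>S0\<close> gains
    the factor \<open>exp (- \<beta>) \<le> 1 / 2\<close>.\<close>
  have small_E: "E q t \<le> S0" if "L\<^sup>2 + 2 \<le> q / \<tau> + \<tau> / t" for q t
  proof -
    have "E q t \<le> exp (- \<beta> * (L\<^sup>2 + 2))" using that \<beta> by (simp add: E_def)
    also have "\<dots> = exp (- \<beta> * (L\<^sup>2 + 1)) * exp (- \<beta>)" by (simp add: exp_add[symmetric] algebra_simps)
    also have "exp (- \<beta>) \<le> 1 / 2"
    proof -
      have "2 \<le> exp \<beta>" using exp_ge_add_one_self[of \<beta>] \<beta> by linarith
      then show ?thesis by (simp add: exp_minus field_simps)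
    qed
    finally show ?thesis by (simp add: S0)
  qed
  have E_q: "((\<lambda>q. E q t) has_real_derivative - (\<beta> / \<tau>) * E q t) (at q)" for q t
    unfolding E_def using \<tau> by (auto intro!: derivative_eq_intros)
  have E_t: "((\<lambda>t. E q t) has_real_derivative \<beta> * \<tau> / t\<^sup>2 * E q t) (at t)" if "0 < t" for q t
    unfolding E_def using that \<tau> by (auto intro!: derivative_eq_intros simp: power2_eq_square)
  have "v z0 \<tau> \<le> \<phi> ((norm (z0 - c))\<^sup>2) \<tau>"
  proof (rule radial_comparison[OF sub p open_domain cont_interior, where B=M and T="2 * \<tau>"
        and ?\<phi>1.0="\<lambda>q t. (m - b) * (\<beta> / \<tau>) * E q t + P" and ?\<phi>2.0="\<lambda>q t. - (m - b) * (\<beta> / \<tau>)\<^sup>2 * E q t"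
        and \<phi>t="\<lambda>q t. - (m - b) * (\<beta> * \<tau> / t\<^sup>2) * E q t"])
    show "v z t - \<phi> ((norm (z - c))\<^sup>2) t \<le> M" if "z \<in> \<Omega>" "0 < t" for z t
      using bound[OF that] \<phi>_ge[of "(norm (z - c))\<^sup>2" t] b that by simp
    have "C2_on (\<lambda>x::(real^'n) \<times> real. b + (m - b) * (1 - (exp ((- \<beta>) * ((1 / \<tau>) * (\<lambda>(z, t). (norm (z - c))\<^sup>2) x
        + \<tau> * ((\<lambda>(z, t). t) x) powr (- 1))) - S0)) + P * (\<lambda>(z, t). (norm (z - c))\<^sup>2) x) (\<Omega> \<times> {0<..})"
      by (intro C2_on_add C2_on_cmult C2_on_exp C2_on_diff C2_on_const C2_on_dist_square C2_on_powr C2_on_time) auto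
    then have C: "C2_on (\<lambda>x::(real^'n) \<times> real. b + (m - b) * (1 - (exp ((- \<beta>) * ((1 / \<tau>) * (norm (fst x - c))\<^sup>2
        + \<tau> * snd x powr (- 1))) - S0)) + P * (norm (fst x - c))\<^sup>2) (\<Omega> \<times> {0<..})"
      by (simp add: case_prod_unfold)
    have tp: "t powr (- 1) = 1 / t" if "0 < t" for t :: real using that by (simp add: powr_minus_divide)
    show "C2_on (\<lambda>(z, t). \<phi> ((norm (z - c))\<^sup>2) t) (\<Omega> \<times> {0<..})"
      by (rule C2_on_cong[OF C]) (use open_domain tp in \<open>auto simp: \<phi>_def E_def open_Times\<close>)
  next
    fix q t :: real
    assume t: "0 < t"
    have "((\<lambda>q. b + (m - b) * (1 - (E q t - S0)) + P * q) has_real_derivative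
        0 + (m - b) * (0 - ((- (\<beta> / \<tau>) * E q t) - 0)) + P) (at q)"
      by (intro DERIV_add DERIV_cmult DERIV_diff DERIV_const E_q DERIV_cmult_Id)
    then show "((\<lambda>q. \<phi> q t) has_real_derivative (m - b) * (\<beta> / \<tau>) * E q t + P) (at q)"
      unfolding \<phi>_def by (rule DERIV_cong) simp
    have alg: "a * k * (- k * e) + 0 = - a * k\<^sup>2 * e" for a k e :: real
      by (simp add: power2_eq_square)
    have "((\<lambda>q. (m - b) * (\<beta> / \<tau>) * E q t + P) has_real_derivative (m - b) * (\<beta> / \<tau>) * (- (\<beta> / \<tau>) * E q t) + 0) (at q)"
      by (intro DERIV_add DERIV_cmult DERIV_const E_q)
    then show "((\<lambda>q. (m - b) * (\<beta> / \<tau>) * E q t + P) has_real_derivative - (m - b) * (\<beta> / \<tau>)\<^sup>2 * E q t) (at q)"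
      unfolding alg .
    have alg2: "0 + a * (0 - (k * e - 0)) + 0 = - a * k * e" for a k e :: real
      by simp
    have "((\<lambda>t. b + (m - b) * (1 - (E q t - S0)) + P * q) has_real_derivative
        0 + (m - b) * (0 - (\<beta> * \<tau> / t\<^sup>2 * E q t - 0)) + 0) (at t)"
      by (intro DERIV_add DERIV_cmult DERIV_diff DERIV_const E_t t)
    then show "((\<lambda>t. \<phi> q t) has_real_derivative - (m - b) * (\<beta> * \<tau> / t\<^sup>2) * E q t) (at t)"
      unfolding \<phi>_def alg2 .
  next
    fix z t assume z: "z \<in> \<Omega>" "0 < t" "t < 2 * \<tau>" "\<phi> ((norm (z - c))\<^sup>2) t < v z t"
    define q where "q = (norm (z - c))\<^sup>2"
    \<comment> \<open>Where the bump exceeds \<open>S0\<close> the ratio \<open>\<tau> / t\<close>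
      is at most \<open>L^2 + 2\<close>, while \<open>q \<ge> \<tau>\<close> by the exterior ball.
      With \<beta> large the normal second derivative therefore dominates the time derivative and
      the trace.\<close>
    have E: "S0 < E q t" using key[OF z(1,2)] z \<tau> by (force simp: q_def)
    then have "q / \<tau> + \<tau> / t < L\<^sup>2 + 2" using small_E[of q t] by force
    moreover have "0 \<le> q / \<tau>" using \<tau> by (simp add: q_def)
    ultimately have st: "\<tau> / t \<le> L\<^sup>2 + 2" by linarith
    have q: "1 \<le> q / \<tau>" using far[OF z(1)] \<tau> by (simp add: q_def)
    have tr: "0 < trace_coeff p CARD('n)" "trace_coeff p CARD('n) \<le> real CARD('n)" using trace_coeff_bounds[OF p dim] by auto
    have \<alpha>: "0 < normal_coeff p" by (rule normal_coeff_bounds[OF p])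
    have "(\<tau> / t)\<^sup>2 \<le> (L\<^sup>2 + 2)\<^sup>2" using st \<tau> z by (intro power_mono) auto
    moreover have "4 * \<beta> * normal_coeff p * 1 \<le> 4 * \<beta> * normal_coeff p * (q / \<tau>)"
      using q \<beta> \<alpha> by (intro mult_left_mono) auto
    ultimately have "2 * trace_coeff p CARD('n) + (\<tau> / t)\<^sup>2 - 4 * \<beta> * normal_coeff p * (q / \<tau>) \<le> - 1"
      using \<beta>(2) tr by linarith
    then have "(\<beta> / \<tau> * ((m - b) * E q t)) * (2 * trace_coeff p CARD('n) + (\<tau> / t)\<^sup>2 - 4 * \<beta> * normal_coeff p * (q / \<tau>))
       \<le> (\<beta> / \<tau> * ((m - b) * E q t)) * (- 1)"
      using \<beta> \<tau> m E S0pos by (intro mult_left_mono) auto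
    also have "\<dots> \<le> - ((m - b) * S0 / \<tau>)"
    proof -
      have "(1 / \<tau>) * ((m - b) * S0) \<le> \<beta> / \<tau> * ((m - b) * E q t)"
        using \<beta> \<tau> m E S0pos by (intro mult_mono divide_right_mono) auto
      then show ?thesis by simp
    qed
    \<comment> \<open>The smallness hypothesis on \<tau> lets the gain absorb the contribution of
      the quadratic term \<open>P q\<close>.\<close>
    also have "\<dots> \<le> - (2 * P * trace_coeff p CARD('n))"
    proof -
      have "2 * P * trace_coeff p CARD('n) * \<tau> \<le> 2 * P * real CARD('n) * \<tau>" using tr P \<tau> by simp
      also have "\<dots> \<le> (m - b) * S0" using \<tau>1 by (simp add: P_def)
      finally show ?thesis using \<tau> by (simp add: field_simps)
    qed
    finally have main: "(\<beta> / \<tau> * ((m - b) * E q t)) * (2 * trace_coeff p CARD('n) + (\<tau> / t)\<^sup>2 - 4 * \<beta> * normal_coeff p * (q / \<tau>))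
       + 2 * P * trace_coeff p CARD('n) \<le> 0" by simp
    have "4 * (- (m - b) * (\<beta> / \<tau>)\<^sup>2 * E q t) * q * normal_coeff p + 2 * ((m - b) * (\<beta> / \<tau>) * E q t + P) * trace_coeff p CARD('n)
        - (- (m - b) * (\<beta> * \<tau> / t\<^sup>2) * E q t) =
       (\<beta> / \<tau> * ((m - b) * E q t)) * (2 * trace_coeff p CARD('n) + (\<tau> / t)\<^sup>2 - 4 * \<beta> * normal_coeff p * (q / \<tau>))
       + 2 * P * trace_coeff p CARD('n)"
      using \<tau> z by (simp add: power2_eq_square field_simps)
    moreover have "0 < (m - b) * (\<beta> / \<tau>) * E q t + P"
      using \<beta> \<tau> m E S0pos P by (intro add_pos_pos mult_pos_pos) auto
    ultimately show "(m - b) * (\<beta> / \<tau>) * E ((norm (z - c))\<^sup>2) t + P \<noteq> 0 \<and>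
      4 * (- (m - b) * (\<beta> / \<tau>)\<^sup>2 * E ((norm (z - c))\<^sup>2) t) * (norm (z - c))\<^sup>2 * normal_coeff p
        + 2 * ((m - b) * (\<beta> / \<tau>) * E ((norm (z - c))\<^sup>2) t + P) * trace_coeff p CARD('n)
        \<le> - (m - b) * (\<beta> * \<tau> / t\<^sup>2) * E ((norm (z - c))\<^sup>2) t"
      using main unfolding q_def by linarith
  next
    fix \<zeta> and s \<epsilon> :: real assume \<zeta>: "\<zeta> \<in> closure \<Omega>" "0 \<le> s" "\<zeta> \<notin> \<Omega> \<or> s = 0" "0 < \<epsilon>"
    show "\<exists>\<delta>>0. \<forall>z\<in>\<Omega>. \<forall>t>0. norm (z - \<zeta>) < \<delta> \<longrightarrow> \<bar>t - s\<bar> < \<delta> \<longrightarrow> v z t - \<phi> ((norm (z - c))\<^sup>2) t < \<epsilon>"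
    proof (cases "s = 0")
      case False
      then have f: "\<zeta> \<in> frontier \<Omega>" "0 < s" using \<zeta> open_domain by (auto simp: frontier_def interior_open)
      have "v \<zeta> s < b + \<epsilon>" using boundary[OF f] \<zeta> by simp
      then obtain \<delta> where "\<delta> > 0" "\<forall>z\<in>\<Omega>. \<forall>t>0. norm (z - \<zeta>) < \<delta> \<longrightarrow> \<bar>t - s\<bar> < \<delta> \<longrightarrow> v z t < b + \<epsilon>"
        using near_value[of \<zeta> s "b + \<epsilon>"] f by auto
      moreover have "v z t - \<phi> ((norm (z - c))\<^sup>2) t < \<epsilon>" if "v z t < b + \<epsilon>" "0 < t" for z t
        using that \<phi>_ge[of "(norm (z - c))\<^sup>2" t] by simp
      ultimately show ?thesis by blast
    next
      case True
      define \<delta> where "\<delta> = min h (\<tau> / (L\<^sup>2 + 2))"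
      have L2: "0 < L\<^sup>2 + 2" by (simp add: add_nonneg_pos)
      have "\<delta> > 0" using h \<tau> L2 by (simp add: \<delta>_def)
      moreover have "v z t - \<phi> ((norm (z - c))\<^sup>2) t < \<epsilon>" if "z \<in> \<Omega>" "0 < t" "\<bar>t - s\<bar> < \<delta>" for z t
      proof -
        have t: "t < h" "t < \<tau> / (L\<^sup>2 + 2)" using that True by (auto simp: \<delta>_def)
        then have "L\<^sup>2 + 2 \<le> \<tau> / t" using that L2 by (simp add: field_simps)
        moreover have "0 \<le> (norm (z - c))\<^sup>2 / \<tau>" using \<tau> by simp
        ultimately have "E ((norm (z - c))\<^sup>2) t \<le> S0" by (intro small_E) linarith
        then show ?thesis using key[OF that(1,2) t(1)] \<zeta> by simp
      qed
      ultimately show ?thesis by blast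
    qed
  next
    fix \<epsilon> :: real assume \<epsilon>: "0 < \<epsilon>"
    have "norm z \<le> norm c + sqrt (M / P)" if "z \<in> \<Omega>" "0 < t" "\<epsilon> \<le> v z t - \<phi> ((norm (z - c))\<^sup>2) t" for z t
    proof -
      have "0 \<le> (m - b) * (1 - (E ((norm (z - c))\<^sup>2) t - S0))" using E_le[of "(norm (z - c))\<^sup>2" t] S0pos m that by simp
      then have "P * (norm (z - c))\<^sup>2 \<le> M" using that bound[OF that(1,2)] \<epsilon> b unfolding \<phi>_def by linarith
      then have "(norm (z - c))\<^sup>2 \<le> M / P" using P by (simp add: field_simps)
      then have "norm (z - c) \<le> sqrt (M / P)" by (rule real_le_rsqrt)
      then show ?thesis using norm_triangle_ineq[of "z - c" c] by simp
    qed
    then show "\<exists>L. \<forall>z\<in>\<Omega>. \<forall>t>0. t < 2 * \<tau> \<longrightarrow> \<epsilon> \<le> v z t - \<phi> ((norm (z - c))\<^sup>2) t \<longrightarrow> norm z \<le> L" by blast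
  qed (use z0 \<tau> in auto)
  then show ?thesis using \<tau> by (simp add: \<phi>_def E_def P_def)
qed

text \<open>Points whose ball of radius \<open>K sqrt \<tau>\<close> lies in \<Omega> already
  satisfy the bound \<open>b\<close>. Every other point close to the corner has an exterior ball of
  radius \<open>sqrt \<tau>\<close> with centre within \<open>L sqrt \<tau>\<close>, and there the
  bump takes off the fraction \<open>S0\<close> of \<open>m - b\<close>. The bump involves scaled
  quantities only, so \<theta> depends neither on \<open>m\<close> nor on the neighbourhood; this
  uniformity permits iteration.\<close>

lemma corner_improvement:
  assumes b: "0 < b" and bM: "b < M" and y: "y \<in> frontier \<Omega>"
  obtains \<theta> where "0 \<le> \<theta>" "\<theta> < 1"
    "\<And>m. b < m \<Longrightarrow> m \<le> M \<Longrightarrow> locally_below y m \<Longrightarrow> locally_below y (b + \<theta> * (m - b))"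
proof -
  define \<alpha> where "\<alpha> = normal_coeff p"
  have \<alpha>: "0 < \<alpha>" unfolding \<alpha>_def by (rule normal_coeff_bounds[OF p])
  obtain K where K: "1 \<le> K" "\<And>z t. z \<in> \<Omega> \<Longrightarrow> 0 < t \<Longrightarrow> cball z (K * sqrt t) \<subseteq> \<Omega> \<Longrightarrow> v z t \<le> b"
    using below_boundary_value_far_from_boundary[OF b bM] by metis
  \<comment> \<open>In units of \<open>sqrt \<tau>\<close>: \<open>K\<close> for the distance to a
    frontier point and 1 for the radius of the exterior ball there.\<close>
  define L where "L = K + 1"
  have L: "1 \<le> L" using K by (simp add: L_def)
  define \<beta> where "\<beta> = max 1 ((2 * real CARD('n) + (L\<^sup>2 + 2)\<^sup>2 + 1) / (4 * \<alpha>))"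
  have \<beta>: "1 \<le> \<beta>" "2 * real CARD('n) + (L\<^sup>2 + 2)\<^sup>2 + 1 \<le> 4 * \<beta> * normal_coeff p"
  proof -
    have "(2 * real CARD('n) + (L\<^sup>2 + 2)\<^sup>2 + 1) / (4 * \<alpha>) \<le> \<beta>" by (simp add: \<beta>_def)
    then show "2 * real CARD('n) + (L\<^sup>2 + 2)\<^sup>2 + 1 \<le> 4 * \<beta> * normal_coeff p"
      using \<alpha> by (simp add: \<alpha>_def[symmetric] field_simps)
  qed (simp add: \<beta>_def)
  define S0 where "S0 = exp (- \<beta> * (L\<^sup>2 + 1)) / 2"
  have S0: "0 < S0" "S0 \<le> 1"
  proof -
    have "exp (- \<beta> * (L\<^sup>2 + 1)) \<le> 1" using \<beta>(1) by (simp add: mult_nonneg_nonneg)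
    then show "S0 \<le> 1" unfolding S0_def by linarith
  qed (simp add: S0_def)
  obtain hx r0 where hx: "hx > 0" "r0 > 0"
    "\<And>P r. P \<in> frontier \<Omega> \<Longrightarrow> norm (P - y) < hx \<Longrightarrow> 0 < r \<Longrightarrow> r \<le> r0 \<Longrightarrow> \<exists>c. norm (c - P) = r \<and> ball c r \<inter> \<Omega> = {}"
    using exterior_balls[OF dom y] by metis
  have step: "locally_below y (b + (1 - S0 / 2) * (m - b))" if m: "b < m" "m \<le> M" and lb: "locally_below y m" for m
  proof -
    obtain h where h: "h > 0" "\<And>z t. z \<in> \<Omega> \<Longrightarrow> 0 < t \<Longrightarrow> norm (z - y) < h \<Longrightarrow> t < h \<Longrightarrow> v z t \<le> m"
      using lb unfolding locally_below_def by blast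
    define P where "P = 4 * M / h\<^sup>2"
    have P: "0 < P" using b bM h by (simp add: P_def)
    define \<sigma> where "\<sigma> = Min {h / (4 * L), hx / (2 * L), r0}"
    have \<sigma>: "0 < \<sigma>" "\<sigma> \<le> h / (4 * L)" "\<sigma> \<le> hx / (2 * L)" "\<sigma> \<le> r0"
      using h hx L by (auto simp: \<sigma>_def)
    \<comment> \<open>The entries give in turn: \<open>sqrt \<tau> < \<sigma>\<close>; a centre
      \<open>c\<close> within \<open>h / 2\<close> of \<open>y\<close> and
      \<open>2 * \<tau> \<le> h\<close>; a frontier point within \<open>hx\<close> of
      \<open>y\<close>; the smallness of \<tau> in \<open>corner_bump_bound\<close>; a quadratic
      term of at most half the gain, whence \<open>S0 / 2\<close> in the factor.\<close>
    define h' where "h' = Min {\<sigma>\<^sup>2, h / 4, hx / 2, (m - b) * S0 / (2 * P * real CARD('n)), (m - b) * S0 / (2 * P * L\<^sup>2)}"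
    have h': "0 < h'" "h' \<le> \<sigma>\<^sup>2" "h' \<le> h / 4" "h' \<le> hx / 2" "h' \<le> (m - b) * S0 / (2 * P * real CARD('n))"
      "h' \<le> (m - b) * S0 / (2 * P * L\<^sup>2)"
      using h hx L \<sigma> m P S0 by (auto simp: h'_def)
    have "v z \<tau> \<le> b + (1 - S0 / 2) * (m - b)" if z: "z \<in> \<Omega>" "0 < \<tau>" "norm (z - y) < h'" "\<tau> < h'" for z \<tau>
    proof (cases "cball z (K * sqrt \<tau>) \<subseteq> \<Omega>")
      case True
      have "0 \<le> (1 - S0 / 2) * (m - b)" using S0 m by simp
      then show ?thesis using K(2)[OF z(1,2) True] by simp
    next
      case False
      have s\<tau>: "sqrt \<tau> < \<sigma>" using z h' \<sigma> by (intro real_less_lsqrt) auto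
      have Ls: "L * sqrt \<tau> \<le> h / 4" "L * sqrt \<tau> \<le> hx / 2"
      proof -
        have "L * sqrt \<tau> \<le> L * (h / (4 * L))" using s\<tau> \<sigma> L by (intro mult_left_mono) auto
        then show "L * sqrt \<tau> \<le> h / 4" using L by simp
        have "L * sqrt \<tau> \<le> L * (hx / (2 * L))" using s\<tau> \<sigma> L by (intro mult_left_mono) auto
        then show "L * sqrt \<tau> \<le> hx / 2" using L by simp
      qed
      have "cball z (K * sqrt \<tau>) \<inter> frontier \<Omega> \<noteq> {}"
      proof (rule connected_Int_frontier)
        have "z \<in> cball z (K * sqrt \<tau>)" using K z by simp
        then show "cball z (K * sqrt \<tau>) \<inter> \<Omega> \<noteq> {}" using z by blast
      qed (use False in auto)
      then obtain y1 where y1: "y1 \<in> frontier \<Omega>" "norm (y1 - z) \<le> K * sqrt \<tau>"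
        by (auto simp: dist_norm norm_minus_commute)
      have sp: "0 < sqrt \<tau>" using z by simp
      have "K * sqrt \<tau> < L * sqrt \<tau>" using sp by (simp add: L_def)
      moreover have "norm (y1 - y) \<le> norm (y1 - z) + norm (z - y)"
        using norm_triangle_ineq[of "y1 - z" "z - y"] by simp
      ultimately have "norm (y1 - y) < hx"
        using y1(2) z(3) h'(4) Ls(2) by linarith
      then obtain c where c: "norm (c - y1) = sqrt \<tau>" "ball c (sqrt \<tau>) \<inter> \<Omega> = {}"
        using hx(3)[OF y1(1) _ sp] s\<tau> \<sigma> by auto
      have zc: "norm (z - c) \<le> L * sqrt \<tau>"
        using norm_triangle_ineq[of "z - y1" "y1 - c"] y1 c by (simp add: L_def norm_minus_commute algebra_simps)
      have cy: "norm (c - y) \<le> h / 2"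
        using norm_triangle_ineq[of "c - z" "z - y"] zc Ls z h' by (simp add: norm_minus_commute)
      have q: "(norm (z - c))\<^sup>2 \<le> L\<^sup>2 * \<tau>"
        using power_mono[OF zc, of 2] z by (simp add: power_mult_distrib)
      have "v z \<tau> \<le> b + (m - b) * (1 - (exp (- \<beta> * ((norm (z - c))\<^sup>2 / \<tau> + 1)) - S0)) + 4 * M / h\<^sup>2 * (norm (z - c))\<^sup>2"
      proof (rule corner_bump_bound[OF b m h c(2) cy z(2) _ L \<beta> S0_def _ z(1)])
        show "2 * \<tau> \<le> h" using z h' by simp
        have "\<tau> \<le> (m - b) * S0 / (2 * P * real CARD('n))" using z h' by simp
        then show "2 * (4 * M / h\<^sup>2) * real CARD('n) * \<tau> \<le> (m - b) * S0"
          unfolding P_def[symmetric] using P by (simp add: field_simps)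
      qed
      also have "\<dots> \<le> b + (m - b) * (1 - S0) + (m - b) * (S0 / 2)"
      proof -
        have "(norm (z - c))\<^sup>2 / \<tau> \<le> L\<^sup>2" using q z by (simp add: field_simps)
        then have "exp (- \<beta> * (L\<^sup>2 + 1)) \<le> exp (- \<beta> * ((norm (z - c))\<^sup>2 / \<tau> + 1))" using \<beta> by simp
        then have "1 - (exp (- \<beta> * ((norm (z - c))\<^sup>2 / \<tau> + 1)) - S0) \<le> 1 - S0" by (simp add: S0_def)
        then have "(m - b) * (1 - (exp (- \<beta> * ((norm (z - c))\<^sup>2 / \<tau> + 1)) - S0)) \<le> (m - b) * (1 - S0)" using m by (intro mult_left_mono) auto
        moreover have "P * (norm (z - c))\<^sup>2 \<le> (m - b) * (S0 / 2)"
        proof -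
          have "P * (norm (z - c))\<^sup>2 \<le> P * (L\<^sup>2 * \<tau>)" using q P by simp
          also have "\<dots> \<le> P * (L\<^sup>2 * ((m - b) * S0 / (2 * P * L\<^sup>2)))" using z h' P by (intro mult_left_mono) auto
          also have "\<dots> = (m - b) * (S0 / 2)" using P L by simp
          finally show ?thesis .
        qed
        ultimately show ?thesis by (simp add: P_def)
      qed
      also have "\<dots> = b + (1 - S0 / 2) * (m - b)" by (simp add: algebra_simps)
      finally show ?thesis .
    qed
    then show ?thesis using h'(1) unfolding locally_below_def by blast
  qed
  show thesis by (rule that[of "1 - S0 / 2"]) (use S0 step in auto)
qed

text \<open>Iteration of \<open>corner_improvement\<close> gives the bounds
  \<open>b + \<theta>' ^ n * (M - b)\<close>, on neighbourhoods that may shrink with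
  \<open>n\<close>; only some neighbourhood is claimed.\<close>

lemma corner_bound:
  assumes b: "0 < b" and y: "y \<in> frontier \<Omega>" and \<epsilon>: "0 < \<epsilon>"
  shows "\<exists>h>0. \<forall>z\<in>\<Omega>. \<forall>t>0. norm (z - y) < h \<longrightarrow> t < h \<longrightarrow> v z t < b + \<epsilon>"
proof (cases "b < M")
  case False
  then show ?thesis using bound \<epsilon> by (intro exI[of _ 1]) (force intro: le_less_trans)
next
  case True
  obtain \<theta> where \<theta>: "0 \<le> \<theta>" "\<theta> < 1"
    "\<And>m. b < m \<Longrightarrow> m \<le> M \<Longrightarrow> locally_below y m \<Longrightarrow> locally_below y (b + \<theta> * (m - b))"
    using corner_improvement[OF b True y] by metis
  \<comment> \<open>A positive factor keeps every bound strictly above \<open>b\<close>, as the next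
    application of the improvement requires.\<close>
  define \<theta>' where "\<theta>' = max \<theta> (1/2)"
  have \<theta>': "0 < \<theta>'" "\<theta>' < 1" "\<theta> \<le> \<theta>'" using \<theta> by (auto simp: \<theta>'_def)
  have mono: "locally_below y m'" if "locally_below y m" "m \<le> m'" for m m'
    using that unfolding locally_below_def by (meson order_trans)
  have "locally_below y (b + \<theta>' ^ n * (M - b))" for n
  proof (induction n)
    case 0
    then show ?case using bound unfolding locally_below_def by (intro exI[of _ 1]) simp
  next
    case (Suc n)
    have pos: "0 < \<theta>' ^ n * (M - b)" using \<theta>' True by simp
    moreover have "\<theta>' ^ n * (M - b) \<le> M - b" using \<theta>' True power_le_one[of \<theta>' n] by (simp add: mult_left_le_one_le)
    ultimately have "locally_below y (b + \<theta> * (\<theta>' ^ n * (M - b)))"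
      using \<theta>(3)[of "b + \<theta>' ^ n * (M - b)"] Suc by simp
    then show ?case
      by (rule mono) (use \<theta>' pos mult_right_mono[of \<theta> \<theta>' "\<theta>' ^ n * (M - b)"] in \<open>simp add: mult.assoc\<close>)
  qed
  note lb = this
  have "\<exists>n. \<theta>' ^ n * (M - b) < \<epsilon>"
  proof -
    have "(\<lambda>n. \<theta>' ^ n) \<longlonglongrightarrow> 0" using \<theta>' by (intro LIMSEQ_realpow_zero) auto
    then have "(\<lambda>n. \<theta>' ^ n * (M - b)) \<longlonglongrightarrow> 0" by (rule tendsto_mult_left_zero)
    then have "\<forall>\<^sub>F n in sequentially. \<theta>' ^ n * (M - b) < \<epsilon>" using \<epsilon> by (intro order_tendstoD) auto
    then show ?thesis by (auto simp: eventually_sequentially)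
  qed
  then obtain n where n: "\<theta>' ^ n * (M - b) < \<epsilon>" by blast
  obtain h where h: "h > 0" "\<And>z t. z \<in> \<Omega> \<Longrightarrow> 0 < t \<Longrightarrow> norm (z - y) < h \<Longrightarrow> t < h \<Longrightarrow> v z t \<le> b + \<theta>' ^ n * (M - b)"
    using lb[of n] unfolding locally_below_def by blast
  have "v z t < b + \<epsilon>" if "z \<in> \<Omega>" "0 < t" "norm (z - y) < h" "t < h" for z t
    using h(2)[OF that] n by linarith
  then show ?thesis using h(1) by blast
qed

text \<open>With the corners under control, comparison with
  \<open>b + \<gamma> (|z|^2 + 2 N t)\<close> works on unbounded domains as well, since this
  function grows at infinity; \<gamma> tends to 0 with the error \<open>e\<close>. Positivity of
  \<open>b\<close> comes from the corner estimate.\<close>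

lemma maximum_principle:
  assumes b: "0 < b" and z0: "z0 \<in> \<Omega>" and t0: "0 < t0"
  shows "v z0 t0 \<le> b"
proof (rule field_le_epsilon)
  fix e :: real assume e: "0 < e"
  define C where "C = (norm (z0 - 0))\<^sup>2 + 2 * real CARD('n) * t0 + 1"
  have C: "0 < C" using t0 by (simp add: C_def add_nonneg_pos)
  define \<gamma> where "\<gamma> = e / C"
  have \<gamma>: "0 < \<gamma>" using e C by (simp add: \<gamma>_def)
  define \<phi> where "\<phi> q t = b + \<gamma> * (q + 2 * real CARD('n) * t)" for q t
  have \<phi>_ge: "b \<le> \<phi> ((norm (z - 0))\<^sup>2) t" if "0 < t" for z :: "real^'n" and t
    using \<gamma> that by (simp add: \<phi>_def)
  have "v z0 t0 \<le> \<phi> ((norm (z0 - 0))\<^sup>2) t0"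
  proof (rule radial_comparison[OF sub p open_domain cont_interior, where B=M and T="t0 + 1"
        and ?\<phi>1.0="\<lambda>q t. \<gamma>" and ?\<phi>2.0="\<lambda>q t. 0" and \<phi>t="\<lambda>q t. \<gamma> * (2 * real CARD('n))"])
    show "v z t - \<phi> ((norm (z - 0))\<^sup>2) t \<le> M" if "z \<in> \<Omega>" "0 < t" for z t
      using bound[OF that] \<phi>_ge[OF that(2), of z] b by simp
    have "C2_on (\<lambda>x::(real^'n) \<times> real. b + \<gamma> * ((\<lambda>(z, t). (norm (z - 0))\<^sup>2) x + 2 * real CARD('n) * (\<lambda>(z, t). t) x)) (\<Omega> \<times> {0<..})"
      by (intro C2_on_add C2_on_cmult C2_on_const C2_on_dist_square C2_on_time)
    then show "C2_on (\<lambda>(z, t). \<phi> ((norm (z - 0))\<^sup>2) t) (\<Omega> \<times> {0<..})"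
      by (simp add: case_prod_unfold \<phi>_def)
  next
    show "\<gamma> \<noteq> 0 \<and> 4 * 0 * (norm (z - 0))\<^sup>2 * normal_coeff p + 2 * \<gamma> * trace_coeff p CARD('n) \<le> \<gamma> * (2 * real CARD('n))" for z :: "real^'n"
      using \<gamma> trace_coeff_bounds[OF p dim] by simp
  next
    fix \<zeta> and s \<epsilon> :: real assume \<zeta>: "\<zeta> \<in> closure \<Omega>" "0 \<le> s" "\<zeta> \<notin> \<Omega> \<or> s = 0" "0 < \<epsilon>"
    have "\<exists>\<delta>>0. \<forall>z\<in>\<Omega>. \<forall>t>0. norm (z - \<zeta>) < \<delta> \<longrightarrow> \<bar>t - s\<bar> < \<delta> \<longrightarrow> v z t < b + \<epsilon>"
    proof (cases "\<zeta> \<in> \<Omega>")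
      case True
      then have "v \<zeta> s < b + \<epsilon>" using initial[OF True] b \<zeta> by auto
      then show ?thesis using near_value[of \<zeta> s] True \<zeta> by auto
    next
      case False
      then have f: "\<zeta> \<in> frontier \<Omega>" using \<zeta> open_domain by (auto simp: frontier_def interior_open)
      show ?thesis
      proof (cases "s = 0")
        case True
        then show ?thesis using corner_bound[OF b f \<zeta>(4)] by force
      next
        case False
        then have "v \<zeta> s < b + \<epsilon>" using boundary[OF f, of s] \<zeta> by simp
        then show ?thesis using near_value[of \<zeta> s] f \<zeta> False by auto
      qed
    qed
    then show "\<exists>\<delta>>0. \<forall>z\<in>\<Omega>. \<forall>t>0. norm (z - \<zeta>) < \<delta> \<longrightarrow> \<bar>t - s\<bar> < \<delta> \<longrightarrow> v z t - \<phi> ((norm (z - 0))\<^sup>2) t < \<epsilon>"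
      using \<phi>_ge by (smt (verit, best))
  next
    fix \<epsilon> :: real assume \<epsilon>: "0 < \<epsilon>"
    have "norm z \<le> sqrt (M / \<gamma>)" if "z \<in> \<Omega>" "0 < t" "\<epsilon> \<le> v z t - \<phi> ((norm (z - 0))\<^sup>2) t" for z t
    proof -
      have "0 \<le> \<gamma> * (2 * real CARD('n) * t)" using \<gamma> that by simp
      then have "\<gamma> * (norm z)\<^sup>2 \<le> M" using that bound[OF that(1,2)] \<epsilon> b by (simp add: \<phi>_def algebra_simps)
      then have "(norm z)\<^sup>2 \<le> M / \<gamma>" using \<gamma> by (simp add: field_simps)
      then show ?thesis by (rule real_le_rsqrt)
    qed
    then show "\<exists>L. \<forall>z\<in>\<Omega>. \<forall>t>0. t < t0 + 1 \<longrightarrow> \<epsilon> \<le> v z t - \<phi> ((norm (z - 0))\<^sup>2) t \<longrightarrow> norm z \<le> L" by blast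
  qed (use z0 t0 in \<open>auto simp: \<phi>_def intro!: derivative_eq_intros\<close>)
  also have "\<dots> \<le> b + \<gamma> * C" using \<gamma> by (simp add: \<phi>_def C_def)
  also have "\<gamma> * C = e" using C by (simp add: \<gamma>_def)
  finally show "v z0 t0 \<le> b + e" .
qed

end

section \<open>Range of the solution, tangent ball bounds and the boundary layer\<close>

lemma bounded_solution_sub:
  fixes \<Omega> :: "(real^'n) set"
  assumes "1 < p" "2 \<le> CARD('n)" "C2_domain \<Omega>" "bounded_viscosity_solution_01 p \<Omega> u"
  obtains M where "dirichlet_subsolution p \<Omega> u 1 M"
    "\<And>b. - 1 \<le> b \<Longrightarrow> dirichlet_subsolution p \<Omega> (\<lambda>z t. - u z t) b M"
proof -
  have u: "viscosity_subsolution p \<Omega> u" "viscosity_supersolution p \<Omega> u"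
    "bounded ((\<lambda>(x, t). u x t) ` (\<Omega> \<times> {0<..}))" "\<And>x. x \<in> \<Omega> \<Longrightarrow> u x 0 = 0"
    "\<And>y t. y \<in> frontier \<Omega> \<Longrightarrow> 0 < t \<Longrightarrow> u y t = 1"
    "continuous_on (\<Omega> \<times> {0..} \<union> frontier \<Omega> \<times> {0<..}) (\<lambda>(x, t). u x t)"
    using assms(4) unfolding bounded_viscosity_solution_01_def viscosity_solution_def by auto
  obtain M where "\<forall>w\<in>(\<lambda>(x, t). u x t) ` (\<Omega> \<times> {0<..}). norm w \<le> M"
    using u(3) unfolding bounded_iff by blast
  then have M: "\<bar>u z t\<bar> \<le> M" if "z \<in> \<Omega>" "0 < t" for z t using that by force
  have op: "open \<Omega>" using assms(3) by (simp add: C2_domain_def)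
  have cm: "continuous_on (\<Omega> \<times> {0..} \<union> frontier \<Omega> \<times> {0<..}) (\<lambda>(x, t). - u x t)"
    using continuous_on_minus[OF u(6)] by (simp add: case_prod_unfold)
  show thesis
  proof (rule that[of M])
    show "dirichlet_subsolution p \<Omega> u 1 M"
      by unfold_locales (use assms u M in \<open>auto simp: abs_le_iff\<close>)
    show "dirichlet_subsolution p \<Omega> (\<lambda>z t. - u z t) b M" if "- 1 \<le> b" for b
      by unfold_locales (use assms u(4,5) M that cm viscosity_supersolution_uminus[OF u(2) op] in \<open>auto simp: abs_le_iff\<close>)
  qed
qed

text \<open>The barrier arguments at height \<open>l\<close> along \<open>e\<close> over a foot
  point, with \<open>k\<close> the cosine between \<open>e\<close> and the normal there. The centre
  of the exterior ball lies at \<open>- r\<close> along the normal, which accounts for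
  \<open>- r\<close> in the second identity. As \<open>l\<close> and \<open>t\<close> tend to 0,
  only the term with \<open>l / sqrt t * k\<close> survives.\<close>

lemma layer_arg_eq:
  fixes r l k \<alpha> t N :: real
  assumes "0 < r" "0 < t" "0 < \<alpha>"
  shows "((r\<^sup>2 - (l\<^sup>2 - 2 * r * (l * k) + r\<^sup>2)) / (2 * r) - N * t / r) / (2 * sqrt (\<alpha> * t)) =
    (l / sqrt t * k - l / sqrt t * l / (2 * r) - N * sqrt t / r) / (2 * sqrt \<alpha>)"
    "((l\<^sup>2 - 2 * (- r) * (l * k) + (- r)\<^sup>2 - r\<^sup>2) / (2 * r) + N * t / r) / (2 * sqrt (\<alpha> * t)) =
    (l / sqrt t * k + l / sqrt t * l / (2 * r) + N * sqrt t / r) / (2 * sqrt \<alpha>)"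
proof -
  obtain s where s: "s > 0" "t = s * s" using assms(2) by (metis real_sqrt_gt_zero real_sqrt_mult_self abs_of_pos)
  obtain a where a: "a > 0" "\<alpha> = a * a" using assms(3) by (metis real_sqrt_gt_zero real_sqrt_mult_self abs_of_pos)
  have "sqrt t = s" "sqrt \<alpha> = a" "sqrt (\<alpha> * t) = a * s" using s a by (auto simp: real_sqrt_mult)
  then show "((r\<^sup>2 - (l\<^sup>2 - 2 * r * (l * k) + r\<^sup>2)) / (2 * r) - N * t / r) / (2 * sqrt (\<alpha> * t)) =
    (l / sqrt t * k - l / sqrt t * l / (2 * r) - N * sqrt t / r) / (2 * sqrt \<alpha>)"
    "((l\<^sup>2 - 2 * (- r) * (l * k) + (- r)\<^sup>2 - r\<^sup>2) / (2 * r) + N * t / r) / (2 * sqrt (\<alpha> * t)) =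
    (l / sqrt t * k + l / sqrt t * l / (2 * r) + N * sqrt t / r) / (2 * sqrt \<alpha>)"
    using assms(1) s a by (simp_all add: field_simps power2_eq_square)
qed

context
  fixes p :: ereal and \<Omega> :: "(real^'n) set" and u :: "real^'n \<Rightarrow> real \<Rightarrow> real"
  assumes p: "1 < p" and dim: "2 \<le> CARD('n)" and dom: "C2_domain \<Omega>"
    and sol: "bounded_viscosity_solution_01 p \<Omega> u"
begin

lemma solution_range:
  assumes "z \<in> \<Omega>" "0 < t"
  shows "0 \<le> u z t" "u z t \<le> 1"
proof -
  obtain M where M: "dirichlet_subsolution p \<Omega> u 1 M"
    "\<And>b. - 1 \<le> b \<Longrightarrow> dirichlet_subsolution p \<Omega> (\<lambda>z t. - u z t) b M"
    using bounded_solution_sub[OF p dim dom sol] by metis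
  show "u z t \<le> 1" using dirichlet_subsolution.maximum_principle[OF M(1) _ assms] by simp
  \<comment> \<open>The maximum principle needs a positive boundary bound, so 0 is reached as a
    limit.\<close>
  have "- u z t \<le> 0 + b" if "0 < b" for b
    using dirichlet_subsolution.maximum_principle[OF M(2)[of b] that assms] that by simp
  then have "- u z t \<le> 0" by (rule field_le_epsilon)
  then show "0 \<le> u z t" by simp
qed

text \<open>The barrier requires a closed ball in \<Omega>. Smaller concentric balls and continuity
  in the radius extend the bound to open balls touching the frontier, the case of interest.\<close>

lemma solution_upper_bound:
  assumes ball: "ball c r \<subseteq> \<Omega>" and r: "0 < r" and z: "z \<in> \<Omega>" and t: "0 < t"
  shows "u z t \<le> Erfc (((r\<^sup>2 - (norm (z - c))\<^sup>2) / (2 * r) - real CARD('n) * t / r) / (2 * sqrt (normal_coeff p * t)))"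
proof -
  obtain M where "dirichlet_subsolution p \<Omega> u 1 M" using bounded_solution_sub[OF p dim dom sol] by metis
  then have sub: "dirichlet_subsolution p \<Omega> u 1 1"
    using solution_range(2) unfolding dirichlet_subsolution_def by auto
  let ?f = "\<lambda>r. Erfc (((r\<^sup>2 - (norm (z - c))\<^sup>2) / (2 * r) - real CARD('n) * t / r) / (2 * sqrt (normal_coeff p * t)))"
  have \<alpha>: "0 < normal_coeff p" by (rule normal_coeff_bounds[OF p])
  have "isCont ?f r" using r t \<alpha> by (intro continuous_intros isCont_o2[OF _ isCont_Erfc]) auto
  then have "(?f \<longlongrightarrow> ?f r) (at_left r)" by (simp add: continuous_within filterlim_at_split)
  moreover have "\<forall>\<^sub>F s in at_left r. u z t \<le> ?f s"
    unfolding eventually_at_left_field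
  proof (intro exI[of _ 0] conjI allI impI r)
    fix s assume s: "0 < s" "s < r"
    have "cball c s \<subseteq> \<Omega>" using s ball by force
    from dirichlet_subsolution.ball_upper_bound[OF sub _ this s(1) z t] show "u z t \<le> ?f s" by simp
  qed
  ultimately show ?thesis by (rule tendsto_lowerbound) simp
qed

text \<open>The same passage to the limit: the barrier sphere has to lie strictly inside the
  exterior ball.\<close>

lemma solution_lower_bound:
  assumes ball: "ball c r \<inter> \<Omega> = {}" and r: "0 < r" and z: "z \<in> \<Omega>" and t: "0 < t"
  shows "Erfc ((((norm (z - c))\<^sup>2 - r\<^sup>2) / (2 * r) + real CARD('n) * t / r) / (2 * sqrt (normal_coeff p * t))) \<le> u z t"
proof -
  obtain M where "\<And>b. - 1 \<le> b \<Longrightarrow> dirichlet_subsolution p \<Omega> (\<lambda>z t. - u z t) b M"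
    using bounded_solution_sub[OF p dim dom sol] by metis
  then have sub: "dirichlet_subsolution p \<Omega> (\<lambda>z t. - u z t) (- 1) M" by simp
  let ?f = "\<lambda>r. Erfc ((((norm (z - c))\<^sup>2 - r\<^sup>2) / (2 * r) + real CARD('n) * t / r) / (2 * sqrt (normal_coeff p * t)))"
  have \<alpha>: "0 < normal_coeff p" by (rule normal_coeff_bounds[OF p])
  have "isCont ?f r" using r t \<alpha> by (intro continuous_intros isCont_o2[OF _ isCont_Erfc]) auto
  then have "(?f \<longlongrightarrow> ?f r) (at_left r)" by (simp add: continuous_within filterlim_at_split)
  moreover have "\<forall>\<^sub>F s in at_left r. ?f s \<le> u z t"
    unfolding eventually_at_left_field
  proof (intro exI[of _ 0] conjI allI impI r)
    fix s assume s: "0 < s" "s < r"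
    have "- u z t \<le> - ?f s"
      by (rule dirichlet_subsolution.ball_lower_bound[OF sub _ _ ball s z t]) (auto simp: solution_range)
    then show "?f s \<le> u z t" by simp
  qed
  ultimately show ?thesis by (rule tendsto_upperbound) simp
qed

text \<open>Each \<open>Z i\<close> has a foot point \<open>P i\<close> on the graph, reached along
  \<open>e\<close>, with interior and exterior tangent balls of one fixed radius. The normals at
  \<open>P i\<close> tend to \<open>e\<close>, so both ball bounds have the same limit. The filter
  is there because in the scaling argument the point moves with time.\<close>

lemma solution_boundary_layer:
  fixes F :: "'i filter" and Z :: "'i \<Rightarrow> real^'n" and \<tau> :: "'i \<Rightarrow> real"
  assumes gr: "C2_graph_at \<Omega> y e g" and y: "y \<in> frontier \<Omega>"
    and normal: "graph_normal g e y = e"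
    and \<tau>: "(\<tau> \<longlongrightarrow> 0) F" "\<forall>\<^sub>F i in F. 0 < \<tau> i"
    and Z: "(Z \<longlongrightarrow> y) F" "\<forall>\<^sub>F i in F. Z i \<in> \<Omega>"
    and \<sigma>: "((\<lambda>i. (Z i \<bullet> e - g (hyperplane_proj e (Z i))) / sqrt (\<tau> i)) \<longlongrightarrow> \<sigma>) F"
  shows "((\<lambda>i. u (Z i) (\<tau> i)) \<longlongrightarrow> Erfc (\<sigma> / (2 * sqrt (normal_coeff p)))) F"
proof -
  let ?p = "hyperplane_proj e"
  define \<alpha> where "\<alpha> = normal_coeff p"
  have \<alpha>: "0 < \<alpha>" unfolding \<alpha>_def by (rule normal_coeff_bounds[OF p])
  have op: "open \<Omega>" using dom by (simp add: C2_domain_def)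
  have e: "norm e = 1" and g: "C2_on g UNIV" using gr by (auto simp: C2_graph_at_def)
  have ee: "e \<bullet> e = 1" using e by (simp add: power2_norm_eq_inner[symmetric])
  obtain h r where h: "h > 0" "r > 0"
    "\<And>P. norm (P - y) < h \<Longrightarrow> P \<in> frontier \<Omega> \<Longrightarrow> P \<bullet> e = g (?p P)"
    "\<And>P s. norm (P - y) < h \<Longrightarrow> P \<bullet> e = g (?p P) \<Longrightarrow> 0 < s \<Longrightarrow> s \<le> r \<Longrightarrow>
       ball (P + s *\<^sub>R sgn (graph_normal g e P)) s \<subseteq> \<Omega> \<and>
       ball (P - s *\<^sub>R sgn (graph_normal g e P)) s \<inter> \<Omega> = {}"
    using graph_tangent_balls[OF gr op] by metis
  have pcont: "continuous_on UNIV ?p" unfolding hyperplane_proj_def by (intro continuous_intros)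
  have gcont: "continuous_on UNIV g" by (rule C2_on_continuous_on[OF g])
  have ncont: "continuous_on UNIV (graph_normal g e)"
    unfolding graph_normal_def
    by (intro continuous_intros continuous_on_compose2[OF pcont] continuous_on_compose2[OF C2_on_grad(3)[OF g]] pcont) auto
  define lam where "lam i = Z i \<bullet> e - g (?p (Z i))" for i
  define P where "P i = Z i - lam i *\<^sub>R e" for i
  have pP: "?p (P i) = ?p (Z i)" for i
    using ee by (simp add: P_def hyperplane_proj_def inner_diff_left algebra_simps)
  have gP: "P i \<bullet> e = g (?p (P i))" for i
    unfolding pP using ee by (simp add: P_def lam_def inner_diff_left)
  have "isCont (\<lambda>z. z \<bullet> e - g (?p z)) y"
    using continuous_on_compose2[OF gcont pcont] by (intro continuous_intros) (auto simp: continuous_on_eq_continuous_at)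
  then have "(lam \<longlongrightarrow> y \<bullet> e - g (?p y)) F"
    unfolding lam_def using isCont_tendsto_compose Z(1) by fast
  moreover have "y \<bullet> e = g (?p y)" using h(1,3) y by simp
  ultimately have lam0: "(lam \<longlongrightarrow> 0) F" by simp
  have "(P \<longlongrightarrow> y - 0 *\<^sub>R e) F"
    unfolding P_def by (intro tendsto_intros Z lam0)
  then have P: "(P \<longlongrightarrow> y) F" by simp
  define n where "n i = graph_normal g e (P i)" for i
  have "isCont (graph_normal g e) y" using ncont by (simp add: continuous_on_eq_continuous_at)
  then have "(n \<longlongrightarrow> e) F" unfolding n_def using isCont_tendsto_compose[OF _ P] normal by metis
  then have "((\<lambda>i. norm (n i)) \<longlongrightarrow> 1) F" using tendsto_norm[of n e F] e by simp
  then have k: "((\<lambda>i. 1 / norm (n i)) \<longlongrightarrow> 1) F" using tendsto_divide[OF tendsto_const, of "\<lambda>i. norm (n i)" 1 F 1] by simp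
  define \<nu> where "\<nu> i = sgn (n i)" for i
  have n1: "1 \<le> norm (n i)" for i unfolding n_def by (rule norm_graph_normal_ge[OF e])
  have n0: "n i \<noteq> 0" for i using n1[of i] by auto
  have \<nu>: "norm (\<nu> i) = 1" "\<nu> i \<bullet> e = 1 / norm (n i)" for i
    using n0[of i] graph_normal_inner[OF e, of g "P i"]
    by (auto simp: \<nu>_def norm_sgn sgn_div_norm n_def[symmetric] divide_inverse)
  have ZP: "Z i = P i + lam i *\<^sub>R e" for i by (simp add: P_def)
  have d: "(norm (Z i - (P i + s *\<^sub>R \<nu> i)))\<^sup>2 = (lam i)\<^sup>2 - 2 * s * (lam i * (1 / norm (n i))) + s\<^sup>2" for i s
  proof -
    have "\<nu> i \<bullet> \<nu> i = 1" using \<nu>(1)[of i] by (simp add: power2_norm_eq_inner[symmetric])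
    then show ?thesis unfolding ZP power2_norm_eq_inner
      using \<nu>(2)[of i] ee by (simp add: inner_diff_left inner_diff_right inner_commute power2_eq_square algebra_simps)
  qed
  have near: "\<forall>\<^sub>F i in F. norm (P i - y) < h" using P h(1) by (simp add: tendsto_iff dist_norm)
  let ?q = "\<lambda>i. lam i / sqrt (\<tau> i)"
  let ?N = "real CARD('n)"
  have rho: "(?q \<longlongrightarrow> \<sigma>) F" using \<sigma> by (simp add: lam_def)
  have s\<tau>: "((\<lambda>i. sqrt (\<tau> i)) \<longlongrightarrow> 0) F" using tendsto_real_sqrt[OF \<tau>(1)] by simp
  let ?up = "\<lambda>i. (?q i * (1 / norm (n i)) - ?q i * lam i / (2 * r) - ?N * sqrt (\<tau> i) / r) / (2 * sqrt \<alpha>)"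
  let ?lo = "\<lambda>i. (?q i * (1 / norm (n i)) + ?q i * lam i / (2 * r) + ?N * sqrt (\<tau> i) / r) / (2 * sqrt \<alpha>)"
  have "(?up \<longlongrightarrow> (\<sigma> * 1 - \<sigma> * 0 / (2 * r) - ?N * 0 / r) / (2 * sqrt \<alpha>)) F"
    using h(2) \<alpha> by (intro tendsto_intros rho k lam0 s\<tau>) auto
  then have lim_up: "((\<lambda>i. Erfc (?up i)) \<longlongrightarrow> Erfc (\<sigma> / (2 * sqrt \<alpha>))) F"
    using isCont_tendsto_compose[OF isCont_Erfc] by fastforce
  have "(?lo \<longlongrightarrow> (\<sigma> * 1 + \<sigma> * 0 / (2 * r) + ?N * 0 / r) / (2 * sqrt \<alpha>)) F"
    using h(2) \<alpha> by (intro tendsto_intros rho k lam0 s\<tau>) auto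
  then have lim_lo: "((\<lambda>i. Erfc (?lo i)) \<longlongrightarrow> Erfc (\<sigma> / (2 * sqrt \<alpha>))) F"
    using isCont_tendsto_compose[OF isCont_Erfc] by fastforce
  have upper: "\<forall>\<^sub>F i in F. u (Z i) (\<tau> i) \<le> Erfc (?up i)"
    using near Z(2) \<tau>(2)
  proof eventually_elim
    case (elim i)
    have b: "ball (P i + r *\<^sub>R \<nu> i) r \<subseteq> \<Omega>"
      using h(4)[OF elim(1) gP h(2)] by (simp add: \<nu>_def n_def)
    have "u (Z i) (\<tau> i) \<le> Erfc (((r\<^sup>2 - (norm (Z i - (P i + r *\<^sub>R \<nu> i)))\<^sup>2) / (2 * r) - ?N * \<tau> i / r) / (2 * sqrt (\<alpha> * \<tau> i)))"
      unfolding \<alpha>_def by (rule solution_upper_bound[OF b h(2) elim(2,3)])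
    also have "((r\<^sup>2 - (norm (Z i - (P i + r *\<^sub>R \<nu> i)))\<^sup>2) / (2 * r) - ?N * \<tau> i / r) / (2 * sqrt (\<alpha> * \<tau> i)) = ?up i"
      unfolding d by (rule layer_arg_eq(1)) (use elim h(2) \<alpha> in auto)
    finally show ?case .
  qed
  have lower: "\<forall>\<^sub>F i in F. Erfc (?lo i) \<le> u (Z i) (\<tau> i)"
    using near Z(2) \<tau>(2)
  proof eventually_elim
    case (elim i)
    have b: "ball (P i + (- r) *\<^sub>R \<nu> i) r \<inter> \<Omega> = {}"
      using h(4)[OF elim(1) gP h(2)] by (simp add: \<nu>_def n_def)
    have "Erfc ((((norm (Z i - (P i + (- r) *\<^sub>R \<nu> i)))\<^sup>2 - r\<^sup>2) / (2 * r) + ?N * \<tau> i / r) / (2 * sqrt (\<alpha> * \<tau> i))) \<le> u (Z i) (\<tau> i)"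
      unfolding \<alpha>_def by (rule solution_lower_bound[OF b h(2) elim(2,3)])
    also have "(((norm (Z i - (P i + (- r) *\<^sub>R \<nu> i)))\<^sup>2 - r\<^sup>2) / (2 * r) + ?N * \<tau> i / r) / (2 * sqrt (\<alpha> * \<tau> i)) = ?lo i"
      unfolding d by (rule layer_arg_eq(2)) (use elim h(2) \<alpha> in auto)
    finally show ?case .
  qed
  show ?thesis
    unfolding \<alpha>_def[symmetric] by (rule tendsto_sandwich[OF lower upper lim_lo lim_up])
qed

end

section \<open>Principal curvatures\<close>

text \<open>Differentiability of the gradient at \<open>a\<close> bounds the derivative of the
  Taylor remainder along the segment, and the mean value theorem turns this into a bound for the
  remainder.\<close>

lemma C2_on_Taylor2:
  fixes g :: "real^'n \<Rightarrow> real"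
  assumes g: "C2_on g UNIV" and \<epsilon>: "0 < \<epsilon>"
  obtains \<delta> where "\<delta> > 0"
    "\<And>h. norm h < \<delta> \<Longrightarrow> \<bar>g (a + h) - g a - grad g a \<bullet> h - (hessian g a *v h) \<bullet> h / 2\<bar> \<le> \<epsilon> * (norm h)\<^sup>2"
proof -
  have "(grad g has_derivative (\<lambda>h. hessian g a *v h)) (at a)" by (rule C2_on_grad(2)[OF g])
  then obtain \<delta> where \<delta>: "\<delta> > 0"
    "\<And>b. norm (b - a) < \<delta> \<Longrightarrow> norm (grad g b - grad g a - hessian g a *v (b - a)) \<le> \<epsilon> * norm (b - a)"
    using \<epsilon> unfolding has_derivative_at_alt by blast
  have "\<bar>g (a + h) - g a - grad g a \<bullet> h - (hessian g a *v h) \<bullet> h / 2\<bar> \<le> \<epsilon> * (norm h)\<^sup>2" if h: "norm h < \<delta>" for h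
  proof -
    define f where "f s = g (a + s *\<^sub>R h) - s * (grad g a \<bullet> h) - s\<^sup>2 * ((hessian g a *v h) \<bullet> h) / 2" for s
    have df: "(f has_real_derivative (grad g (a + s *\<^sub>R h) - grad g a - hessian g a *v (s *\<^sub>R h)) \<bullet> h) (at s)" for s
    proof -
      have "((\<lambda>s. a + s *\<^sub>R h) has_derivative (\<lambda>t. t *\<^sub>R h)) (at s)"
        by (auto intro!: derivative_eq_intros)
      from has_derivative_compose[OF this C2_on_grad(1)[OF g]]
      have "((\<lambda>s. g (a + s *\<^sub>R h)) has_real_derivative grad g (a + s *\<^sub>R h) \<bullet> h) (at s)"
        unfolding has_field_derivative_def by (rule has_derivative_eq_rhs) (auto simp: mult.commute)
      then have "(f has_real_derivative grad g (a + s *\<^sub>R h) \<bullet> h - grad g a \<bullet> h - s * ((hessian g a *v h) \<bullet> h)) (at s)"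
        unfolding f_def by (auto intro!: derivative_eq_intros)
      moreover have "hessian g a *v (s *\<^sub>R h) = s *\<^sub>R (hessian g a *v h)"
        by (simp add: matrix_vector_mult_scaleR)
      ultimately show ?thesis by (simp add: inner_diff_left)
    qed
    obtain s where s: "0 < s" "s < 1" "f 1 - f 0 = (1 - 0) * ((grad g (a + s *\<^sub>R h) - grad g a - hessian g a *v (s *\<^sub>R h)) \<bullet> h)"
      using MVT2[of 0 1 f "\<lambda>s. (grad g (a + s *\<^sub>R h) - grad g a - hessian g a *v (s *\<^sub>R h)) \<bullet> h"] df by auto
    have "norm (s *\<^sub>R h) \<le> norm h" using s by (simp add: mult_left_le_one_le)
    then have "norm (grad g (a + s *\<^sub>R h) - grad g a - hessian g a *v (s *\<^sub>R h)) \<le> \<epsilon> * norm h"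
      using \<delta>(2)[of "a + s *\<^sub>R h"] h \<epsilon> by (smt (verit) add_diff_cancel_left' mult_left_mono)
    then have "\<bar>f 1 - f 0\<bar> \<le> \<epsilon> * norm h * norm h"
      unfolding s(3) using Cauchy_Schwarz_ineq2[of "grad g (a + s *\<^sub>R h) - grad g a - hessian g a *v (s *\<^sub>R h)" h]
      by (smt (verit, best) mult_right_mono norm_ge_zero mult_cancel_right1)
    then show ?thesis by (simp add: f_def power2_eq_square algebra_simps)
  qed
  then show thesis using that \<delta>(1) by blast
qed

text \<open>Fixes one choice of the graph and of the principal directions whose existence
  \<open>principal_curvatures\<close> asserts.\<close>

locale curvature_frame =
  fixes \<Omega> :: "(real^'n) set" and y e :: "real^'n" and g :: "real^'n \<Rightarrow> real"
    and v :: "nat \<Rightarrow> real^'n" and \<kappa> :: "nat \<Rightarrow> real" and J :: "nat set"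
  assumes dim: "2 \<le> CARD('n)" and dom: "C2_domain \<Omega>" and yfr: "y \<in> frontier \<Omega>"
    and gr: "C2_graph_at \<Omega> y e g"
    and J: "J = {1..CARD('n) - 1}"
    and tangent: "\<And>h. h \<bullet> e = 0 \<Longrightarrow> grad g (hyperplane_proj e y) \<bullet> h = 0"
    and ve: "\<And>i. i \<in> J \<Longrightarrow> v i \<bullet> e = 0"
    and vv: "\<And>i j. i \<in> J \<Longrightarrow> j \<in> J \<Longrightarrow> v i \<bullet> v j = (if i = j then 1 else 0)"
    and principal: "\<And>i h. i \<in> J \<Longrightarrow> h \<bullet> e = 0 \<Longrightarrow> (hessian g (hyperplane_proj e y) *v v i) \<bullet> h = \<kappa> i * (v i \<bullet> h)"
begin

lemma unit: "norm e = 1" and C2: "C2_on g UNIV" and open_domain: "open \<Omega>"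
  using gr dom by (auto simp: C2_graph_at_def C2_domain_def)

lemma ee: "e \<bullet> e = 1"
  using unit by (simp add: power2_norm_eq_inner[symmetric])

lemma finite_J [simp]: "finite J" and card_J: "card J = CARD('n) - 1"
  by (simp_all add: J)

lemma normal_at: "graph_normal g e y = e"
proof -
  let ?w = "hyperplane_proj e (grad g (hyperplane_proj e y))"
  have "?w \<bullet> ?w = grad g (hyperplane_proj e y) \<bullet> hyperplane_proj e ?w"
    by (rule hyperplane_proj_swap)
  also have "\<dots> = 0" by (intro tangent hyperplane_proj_inner unit)
  finally show ?thesis by (simp add: graph_normal_def)
qed

text \<open>Together with \<open>e\<close> the vectors \<open>v i\<close> are orthonormal and as
  many as the dimension, so a vector orthogonal to all of them vanishes.\<close>

lemma frame_expansion:
  assumes h: "h \<bullet> e = 0"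
  shows "h = (\<Sum>i\<in>J. (h \<bullet> v i) *\<^sub>R v i)"
proof -
  define w where "w = h - (\<Sum>i\<in>J. (h \<bullet> v i) *\<^sub>R v i)"
  have inj: "inj_on v J" using vv by (intro inj_onI) (metis zero_neq_one)
  have ev: "e \<notin> v ` J" using ve ee by (metis imageE zero_neq_one)
  let ?B = "insert e (v ` J)"
  have "pairwise orthogonal ?B"
    using ve vv by (auto simp: pairwise_def orthogonal_def inner_commute)
  moreover have "0 \<notin> ?B" using ee vv by (metis (no_types, lifting) image_iff inner_zero_left insert_iff zero_neq_one)
  ultimately have ind: "independent ?B" by (rule pairwise_orthogonal_independent)
  have "card ?B = CARD('n)"
    using inj ev card_J dim by (simp add: card_image)
  then have "span ?B = UNIV"
    using card_ge_dim_independent[of ?B UNIV] ind by (auto simp: dim_UNIV)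
  moreover have "orthogonal w b" if b: "b \<in> ?B" for b
  proof -
    consider "b = e" | j where "j \<in> J" "b = v j" using b by blast
    then show ?thesis
    proof cases
      case 1
      then show ?thesis using h ve by (simp add: w_def orthogonal_def inner_diff_left inner_sum_left)
    next
      case 2
      have "(\<Sum>i\<in>J. (h \<bullet> v i) * (v i \<bullet> v j)) = (\<Sum>i\<in>J. if i = j then h \<bullet> v j else 0)"
        using vv 2 by (intro sum.cong) auto
      then show ?thesis using 2 by (simp add: w_def orthogonal_def inner_diff_left inner_sum_left)
    qed
  qed
  ultimately have "orthogonal w w" using orthogonal_to_span[of w ?B w] by (metis UNIV_I)
  then show ?thesis by (simp add: orthogonal_self w_def)
qed

lemma norm_frame:
  assumes "h \<bullet> e = 0"
  shows "(norm h)\<^sup>2 = (\<Sum>i\<in>J. (h \<bullet> v i)\<^sup>2)"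
proof -
  have "h \<bullet> h = (\<Sum>i\<in>J. (h \<bullet> v i) *\<^sub>R v i) \<bullet> h" using frame_expansion[OF assms] by simp
  also have "\<dots> = (\<Sum>i\<in>J. (h \<bullet> v i) * (v i \<bullet> h))" by (simp only: inner_sum_left inner_scaleR_left)
  finally show ?thesis
    unfolding power2_norm_eq_inner by (simp only: power2_eq_square inner_commute[of "v _" h])
qed

lemma hessian_frame:
  assumes "h \<bullet> e = 0"
  shows "(hessian g (hyperplane_proj e y) *v h) \<bullet> h = (\<Sum>i\<in>J. \<kappa> i * (h \<bullet> v i)\<^sup>2)"
proof -
  let ?H = "hessian g (hyperplane_proj e y)"
  have "?H *v h = (\<Sum>i\<in>J. (h \<bullet> v i) *\<^sub>R (?H *v v i))"
    by (subst frame_expansion[OF assms]) (simp add: matrix_vector_mult_scaleR linear_sum[OF matrix_vector_mul_linear])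
  then have "(?H *v h) \<bullet> h = (\<Sum>i\<in>J. (h \<bullet> v i) * ((?H *v v i) \<bullet> h))"
    by (simp only: inner_sum_left inner_scaleR_left)
  also have "\<dots> = (\<Sum>i\<in>J. \<kappa> i * (h \<bullet> v i)\<^sup>2)"
  proof (rule sum.cong[OF refl])
    fix i assume "i \<in> J"
    from principal[OF this assms] show "(h \<bullet> v i) * ((?H *v v i) \<bullet> h) = \<kappa> i * (h \<bullet> v i)\<^sup>2"
      using inner_commute[of "v i" h] by (simp add: power2_eq_square)
  qed
  finally show ?thesis .
qed

lemma graph_expansion:
  assumes "0 < \<epsilon>"
  obtains \<delta> where "\<delta> > 0"
    "\<And>h. h \<bullet> e = 0 \<Longrightarrow> norm h < \<delta> \<Longrightarrow>
       \<bar>g (hyperplane_proj e y + h) - g (hyperplane_proj e y) - (\<Sum>i\<in>J. \<kappa> i * (h \<bullet> v i)\<^sup>2) / 2\<bar> \<le> \<epsilon> * (norm h)\<^sup>2"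
proof -
  obtain \<delta> where \<delta>: "\<delta> > 0"
    "\<And>h. norm h < \<delta> \<Longrightarrow> \<bar>g (hyperplane_proj e y + h) - g (hyperplane_proj e y) - grad g (hyperplane_proj e y) \<bullet> h
       - (hessian g (hyperplane_proj e y) *v h) \<bullet> h / 2\<bar> \<le> \<epsilon> * (norm h)\<^sup>2"
    using C2_on_Taylor2[OF C2 assms] by metis
  show thesis by (rule that[OF \<delta>(1)]) (use \<delta>(2) tangent hessian_frame in force)
qed

lemma y_graph: "y \<bullet> e = g (hyperplane_proj e y)"
proof -
  obtain h where "h > (0::real)"
    "\<And>P. norm (P - y) < h \<Longrightarrow> P \<in> frontier \<Omega> \<Longrightarrow> P \<bullet> e = g (hyperplane_proj e P)"
    using graph_tangent_balls[OF gr open_domain] by metis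
  then show ?thesis using yfr by simp
qed

lemma graph_along_ray:
  assumes h: "h \<bullet> e = 0"
  shows "((\<lambda>s. (g (hyperplane_proj e y + s *\<^sub>R h) - g (hyperplane_proj e y)) / s\<^sup>2) \<longlongrightarrow>
    (\<Sum>i\<in>J. \<kappa> i * (h \<bullet> v i)\<^sup>2) / 2) (at_right 0)"
proof (rule tendstoI)
  fix \<epsilon> :: real assume \<epsilon>: "0 < \<epsilon>"
  \<comment> \<open>The summand 1 keeps \<open>C\<close> positive for \<open>h = 0\<close> and makes
    the final inequality strict.\<close>
  define C where "C = (norm h)\<^sup>2 + 1"
  have C: "0 < C" by (simp add: C_def add_nonneg_pos)
  obtain \<delta> where \<delta>: "\<delta> > 0"
    "\<And>h. h \<bullet> e = 0 \<Longrightarrow> norm h < \<delta> \<Longrightarrow>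
       \<bar>g (hyperplane_proj e y + h) - g (hyperplane_proj e y) - (\<Sum>i\<in>J. \<kappa> i * (h \<bullet> v i)\<^sup>2) / 2\<bar> \<le> \<epsilon> / C * (norm h)\<^sup>2"
    using graph_expansion[of "\<epsilon> / C"] \<epsilon> C by auto
  let ?A = "(\<Sum>i\<in>J. \<kappa> i * (h \<bullet> v i)\<^sup>2) / 2"
  have "dist ((g (hyperplane_proj e y + s *\<^sub>R h) - g (hyperplane_proj e y)) / s\<^sup>2) ?A < \<epsilon>"
    if s: "0 < s" "s < \<delta> / (norm h + 1)" for s
  proof -
    define D where "D = g (hyperplane_proj e y + s *\<^sub>R h) - g (hyperplane_proj e y)"
    have "s * (norm h + 1) < \<delta>" using s by (simp add: pos_less_divide_eq add_nonneg_pos)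
    moreover have "s * norm h \<le> s * (norm h + 1)" using s by simp
    ultimately have "s * norm h < \<delta>" by linarith
    then have "norm (s *\<^sub>R h) < \<delta>" using s by simp
    moreover have "(s *\<^sub>R h) \<bullet> e = 0" using h by simp
    moreover have "(\<Sum>i\<in>J. \<kappa> i * ((s *\<^sub>R h) \<bullet> v i)\<^sup>2) / 2 = s\<^sup>2 * ?A"
      by (simp add: sum_distrib_left power_mult_distrib mult_ac sum_divide_distrib)
    ultimately have "\<bar>D - s\<^sup>2 * ?A\<bar> \<le> \<epsilon> / C * (s\<^sup>2 * (norm h)\<^sup>2)"
      using \<delta>(2)[of "s *\<^sub>R h"] s by (simp add: D_def power_mult_distrib)
    also have "\<dots> < s\<^sup>2 * \<epsilon>"
    proof -
      have "(norm h)\<^sup>2 / C < 1" using C by (simp add: C_def)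
      then have "s\<^sup>2 * \<epsilon> * ((norm h)\<^sup>2 / C) < s\<^sup>2 * \<epsilon> * 1" using s \<epsilon> by (intro mult_strict_left_mono) auto
      then show ?thesis by (simp add: mult_ac)
    qed
    finally have "\<bar>D - s\<^sup>2 * ?A\<bar> / s\<^sup>2 < \<epsilon>" using s by (simp add: pos_divide_less_eq mult.commute)
    moreover have "\<bar>D - s\<^sup>2 * ?A\<bar> / s\<^sup>2 = \<bar>D / s\<^sup>2 - ?A\<bar>"
    proof -
      have "D / s\<^sup>2 - ?A = (D - s\<^sup>2 * ?A) / s\<^sup>2" using s by (simp add: diff_divide_distrib)
      then show ?thesis by simp
    qed
    ultimately show ?thesis by (simp add: dist_real_def D_def)
  qed
  then show "\<forall>\<^sub>F s in at_right 0. dist ((g (hyperplane_proj e y + s *\<^sub>R h) - g (hyperplane_proj e y)) / s\<^sup>2) ?A < \<epsilon>"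
    unfolding eventually_at_right_field using \<delta>(1) by (intro exI[of _ "\<delta> / (norm h + 1)"]) (auto simp: add_nonneg_pos)
qed

text \<open>The exterior tangent ball at \<open>y\<close> cannot overlap \<open>cball x R\<close>,
  so the two centres are at distance at least \<open>R + r\<close>. The path through
  \<open>y\<close> is no longer than that, and equality in the triangle inequality puts
  \<open>x\<close> on the inner normal.\<close>

lemma centre_of_touching_ball:
  assumes R: "0 < R" and touch: "cball x R \<inter> (UNIV - \<Omega>) = {y}"
  shows "x = y + R *\<^sub>R e"
proof -
  obtain h r where h: "h > (0::real)" "r > 0"
    "\<And>P s. norm (P - y) < h \<Longrightarrow> P \<bullet> e = g (hyperplane_proj e P) \<Longrightarrow> 0 < s \<Longrightarrow> s \<le> r \<Longrightarrow>
       ball (P + s *\<^sub>R sgn (graph_normal g e P)) s \<subseteq> \<Omega> \<and>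
       ball (P - s *\<^sub>R sgn (graph_normal g e P)) s \<inter> \<Omega> = {}"
    using graph_tangent_balls[OF gr open_domain] by metis
  have "sgn e = e" using unit by (simp add: sgn_div_norm)
  then have ext: "ball (y - r *\<^sub>R e) r \<inter> \<Omega> = {}"
    using h(3)[of y r] y_graph h normal_at by simp
  let ?c = "y - r *\<^sub>R e"
  have yc: "norm (y - ?c) = r" using h(2) unit by simp
  have yx: "norm (x - y) \<le> R" using touch by (auto simp: dist_norm)
  have "R + r \<le> norm (x - ?c)"
  proof (rule ccontr)
    assume "\<not> R + r \<le> norm (x - ?c)"
    then have lt: "norm (x - ?c) < R + r" by simp
    \<comment> \<open>The point \<open>w\<close> divides the segment between the centres in the
      ratio \<open>R : r\<close> and would lie in both balls.\<close>
    define s where "s = R / (R + r)"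
    have s: "0 < s" "1 - s = r / (R + r)" using R h(2) by (auto simp: s_def field_simps)
    define w where "w = x + s *\<^sub>R (?c - x)"
    have "norm (w - x) < R"
    proof -
      have "norm (w - x) = s * norm (x - ?c)" using s by (simp add: w_def norm_minus_commute)
      also have "\<dots> < s * (R + r)" using lt s by (intro mult_strict_left_mono) auto
      finally show ?thesis using R h(2) by (simp add: s_def)
    qed
    moreover have "norm (w - ?c) < r"
    proof -
      have "w - ?c = (1 - s) *\<^sub>R (x - ?c)" by (simp add: w_def algebra_simps)
      then have "norm (w - ?c) = (1 - s) * norm (x - ?c)" using s R h(2) by simp
      also have "\<dots> < (1 - s) * (R + r)" using lt s R h(2) by (intro mult_strict_left_mono) auto
      finally show ?thesis using R h(2) by (simp add: s)
    qed
    ultimately have "w \<in> cball x R" "w \<in> ball ?c r" by (auto simp: dist_norm norm_minus_commute)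
    then have "w \<in> cball x R \<inter> (UNIV - \<Omega>)" using ext by blast
    then have "w = y" using touch by blast
    then show False using \<open>w \<in> ball ?c r\<close> yc by (simp add: dist_norm norm_minus_commute)
  qed
  moreover have "norm (x - ?c) \<le> norm (x - y) + norm (y - ?c)"
    using norm_triangle_ineq[of "x - y" "y - ?c"] by (simp only: diff_add_cancel add_diff_eq)
  moreover have "x - ?c = (x - y) + (y - ?c)" by simp
  ultimately have eq: "norm (x - y) = R" "norm ((x - y) + (y - ?c)) = norm (x - y) + norm (y - ?c)"
    using yx yc by (simp_all only:)
  then have "norm (x - y) *\<^sub>R (y - ?c) = norm (y - ?c) *\<^sub>R (x - y)"
    using norm_triangle_eq[of "x - y" "y - ?c"] by blast
  then have "R *\<^sub>R (r *\<^sub>R e) = r *\<^sub>R (x - y)" using eq yc by simp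
  then have "r *\<^sub>R (R *\<^sub>R e) = r *\<^sub>R (x - y)" by (simp add: mult.commute)
  then have "R *\<^sub>R e = x - y"
    using h(2) scaleR_cancel_left[of r "R *\<^sub>R e" "x - y"] by blast
  then show ?thesis by (simp add: algebra_simps)
qed

text \<open>Near \<open>y\<close> the graph lies below a paraboloid of curvature
  \<open>k < 1 / R\<close>, so tangent balls up to radius \<open>1 / k\<close> stay in \<Omega>
  there. Away from \<open>y\<close> the closed ball is a compact subset of \<Omega> with a positive
  margin. A slightly larger radius respects both constraints.\<close>

lemma larger_interior_ball:
  assumes R: "0 < R" and touch: "cball x R \<inter> (UNIV - \<Omega>) = {y}"
    and curv: "\<And>j. j \<in> J \<Longrightarrow> \<kappa> j < 1 / R"
  obtains R' where "R < R'" "ball (y + R' *\<^sub>R e) R' \<subseteq> \<Omega>"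
proof -
  have x: "x = y + R *\<^sub>R e" by (rule centre_of_touching_ball[OF R touch])
  have Jne: "J \<noteq> {}" using dim by (simp add: J)
  define m where "m = Max (\<kappa> ` J)"
  have m: "m < 1 / R" "\<And>j. j \<in> J \<Longrightarrow> \<kappa> j \<le> m" using curv Jne by (auto simp: m_def)
  define m' where "m' = max m 0"
  have m': "0 \<le> m'" "m \<le> m'" "m' < 1 / R" using m(1) R by (auto simp: m'_def)
  \<comment> \<open>Strictly between all the curvatures and \<open>1 / R\<close>, and positive even
    if all curvatures are negative, so that \<open>1 / k\<close> is a radius.\<close>
  define k where "k = (m' + 1 / R) / 2"
  have k: "m < k" "k < 1 / R" "0 < k" using m' unfolding k_def by auto
  obtain \<delta> where \<delta>: "\<delta> > 0"
    "\<And>h. h \<bullet> e = 0 \<Longrightarrow> norm h < \<delta> \<Longrightarrow>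
       \<bar>g (hyperplane_proj e y + h) - g (hyperplane_proj e y) - (\<Sum>i\<in>J. \<kappa> i * (h \<bullet> v i)\<^sup>2) / 2\<bar> \<le> (k - m) / 2 * (norm h)\<^sup>2"
    using graph_expansion[of "(k - m) / 2"] k by auto
  obtain U where U: "open U" "y \<in> U" "\<Omega> \<inter> U = {z \<in> U. g (hyperplane_proj e z) < z \<bullet> e}"
    using gr unfolding C2_graph_at_def hyperplane_proj_def by blast
  obtain d0 where d0: "d0 > 0" "ball y d0 \<subseteq> U" using U openE by blast
  define d where "d = min \<delta> d0"
  have d: "d > 0" using \<delta> d0 by (simp add: d_def)
  define R1 where "R1 = 1 / k"
  have R1: "R < R1" using k R by (simp add: R1_def field_simps)
  have mem: "z \<in> ball (y + s *\<^sub>R e) s \<longleftrightarrow> 0 < s \<and> (norm (z - y))\<^sup>2 < 2 * s * ((z - y) \<bullet> e)" for z s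
    by (rule ball_translate_iff[OF unit])
  have local: "z \<in> \<Omega>" if z: "norm (z - y) < d" "z \<in> ball (y + s *\<^sub>R e) s" "s \<le> R1" for z s
  proof -
    define h where "h = hyperplane_proj e (z - y)"
    have he: "h \<bullet> e = 0" unfolding h_def by (rule hyperplane_proj_inner[OF unit])
    have hn: "norm h \<le> norm (z - y)" unfolding h_def by (rule norm_hyperplane_proj_le[OF unit])
    have s: "0 < s" "(norm (z - y))\<^sup>2 < 2 * s * ((z - y) \<bullet> e)" using z(2) mem by auto
    have "(\<Sum>i\<in>J. \<kappa> i * (h \<bullet> v i)\<^sup>2) \<le> (\<Sum>i\<in>J. m * (h \<bullet> v i)\<^sup>2)"
      by (intro sum_mono mult_right_mono m) auto
    also have "\<dots> = m * (norm h)\<^sup>2" by (simp add: norm_frame[OF he] sum_distrib_left)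
    finally have sum_le: "(\<Sum>i\<in>J. \<kappa> i * (h \<bullet> v i)\<^sup>2) \<le> m * (norm h)\<^sup>2" .
    have "g (hyperplane_proj e y + h) - g (hyperplane_proj e y) \<le> m * (norm h)\<^sup>2 / 2 + (k - m) / 2 * (norm h)\<^sup>2"
    proof -
      have "norm h < \<delta>" using hn z(1) by (simp add: d_def)
      from \<delta>(2)[OF he this] sum_le show ?thesis by linarith
    qed
    also have "\<dots> = k / 2 * (norm h)\<^sup>2" by (simp add: field_simps)
    also have "\<dots> \<le> k / 2 * (norm (z - y))\<^sup>2" using k hn by (intro mult_left_mono power_mono) auto
    also have "\<dots> < k / 2 * (2 * s * ((z - y) \<bullet> e))" using k s by (intro mult_strict_left_mono) auto
    also have "\<dots> = (k * s) * ((z - y) \<bullet> e)" by simp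
    also have "\<dots> \<le> 1 * ((z - y) \<bullet> e)"
    proof (intro mult_right_mono)
      show "k * s \<le> 1" using z(3) k by (simp add: R1_def field_simps)
      have "0 \<le> (norm (z - y))\<^sup>2" by simp
      then have "0 < 2 * s * ((z - y) \<bullet> e)" using s(2) by linarith
      then show "0 \<le> (z - y) \<bullet> e" using s(1) by (simp add: zero_less_mult_iff)
    qed
    finally have "g (hyperplane_proj e y + h) < g (hyperplane_proj e y) + (z - y) \<bullet> e" by simp
    moreover have "hyperplane_proj e y + h = hyperplane_proj e z" by (simp add: h_def hyperplane_proj_diff)
    moreover have "g (hyperplane_proj e y) + (z - y) \<bullet> e = z \<bullet> e" by (simp add: y_graph[symmetric] inner_diff_left)
    moreover have "z \<in> U" using z(1) d0 by (auto simp: d_def dist_norm norm_minus_commute)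
    ultimately show "z \<in> \<Omega>" using U(3) by auto
  qed
  define K where "K = cball x R - ball y (d / 2)"
  have "compact K" unfolding K_def by (intro compact_diff) auto
  moreover have "K \<subseteq> \<Omega>"
  proof
    fix z assume z: "z \<in> K"
    then have "z \<noteq> y" using d by (auto simp: K_def)
    moreover have "z \<in> cball x R" using z unfolding K_def by blast
    ultimately show "z \<in> \<Omega>" using touch by blast
  qed
  ultimately obtain \<epsilon> where \<epsilon>: "\<epsilon> > 0" "(\<Union>w\<in>K. ball w \<epsilon>) \<subseteq> \<Omega>"
    using compact_subset_open_imp_ball_epsilon_subset[OF _ open_domain] by metis
  \<comment> \<open>A point of the enlarged ball is within \<open>2 (R2 - R)\<close> of
    \<open>cball x R\<close>; the divisor 4 keeps this below \<epsilon> and the nearby point outside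
    \<open>ball y (d / 2)\<close>.\<close>
  define R2 where "R2 = min R1 (R + min \<epsilon> (d / 2) / 4)"
  have R2: "R < R2" "R2 \<le> R1" "R2 - R \<le> \<epsilon> / 4" "R2 - R \<le> d / 8"
    using R1 \<epsilon> d by (auto simp: R2_def min_def)
  have "z \<in> \<Omega>" if z: "z \<in> ball (y + R2 *\<^sub>R e) R2" for z
  proof (cases "norm (z - y) < d")
    case True
    then show ?thesis using local z R2 by blast
  next
    case False
    have zx: "norm (z - x) \<le> R + 2 * (R2 - R)"
    proof -
      have "norm (z - x) \<le> norm (z - (y + R2 *\<^sub>R e)) + norm ((R2 - R) *\<^sub>R e)"
        using norm_triangle_ineq[of "z - (y + R2 *\<^sub>R e)" "(R2 - R) *\<^sub>R e"] by (simp add: x algebra_simps)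
      also have "norm ((R2 - R) *\<^sub>R e) = R2 - R" using R2 unit by simp
      also have "norm (z - (y + R2 *\<^sub>R e)) \<le> R2" using z by (simp add: dist_norm norm_minus_commute)
      finally show ?thesis by simp
    qed
    obtain w where w: "w \<in> cball x R" "norm (w - z) \<le> 2 * (R2 - R)"
    proof (cases "norm (z - x) \<le> R")
      case True
      then show ?thesis using that[of z] R2 by (simp add: dist_norm norm_minus_commute)
    next
      case False
      define n where "n = norm (z - x)"
      have n: "R < n" using False by (simp add: n_def)
      have "z \<noteq> x" using False R by auto
      then have "norm ((R / n) *\<^sub>R (z - x)) = R" using R by (simp add: n_def)
      moreover have "x + (R / n) *\<^sub>R (z - x) - z = - ((1 - R / n) *\<^sub>R (z - x))" by (simp add: algebra_simps)
      then have "norm (x + (R / n) *\<^sub>R (z - x) - z) = \<bar>1 - R / n\<bar> * n" by (simp add: n_def)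
      moreover have "\<bar>1 - R / n\<bar> * n = n - R" using n R by (simp add: field_simps abs_if)
      ultimately show ?thesis using that[of "x + (R / n) *\<^sub>R (z - x)"] zx by (simp add: dist_norm n_def)
    qed
    have "norm (z - y) \<le> norm (w - y) + norm (w - z)"
      using norm_triangle_ineq[of "w - y" "z - w"] by (simp add: norm_minus_commute)
    moreover have "d \<le> norm (z - y)" using False by simp
    ultimately have "d / 2 \<le> norm (w - y)" using w(2) R2(4) d by argo
    then have "w \<in> K" using w by (simp add: K_def dist_norm norm_minus_commute)
    moreover have "z \<in> ball w \<epsilon>" using w(2) R2 \<epsilon> by (simp add: dist_norm)
    ultimately show ?thesis using \<epsilon>(2) by blast
  qed
  then show thesis using that[of R2] R2(1) by blast
qed

end

lemma curvature_frame_exists: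
  fixes \<Omega> :: "(real^'n) set"
  assumes "2 \<le> CARD('n)" "C2_domain \<Omega>" "y \<in> frontier \<Omega>" "principal_curvatures \<Omega> y \<kappa>"
  obtains e g v where "curvature_frame \<Omega> y e g v \<kappa> {1..CARD('n) - 1}"
proof -
  obtain e g v where "C2_graph_at \<Omega> y e g"
    "let y' = y - (y \<bullet> e) *\<^sub>R e; J = {1..CARD('n) - 1} in
          (\<forall>h. h \<bullet> e = 0 \<longrightarrow> grad g y' \<bullet> h = 0) \<and>
          (\<forall>i\<in>J. v i \<bullet> e = 0) \<and>
          (\<forall>i\<in>J. \<forall>j\<in>J. v i \<bullet> v j = (if i = j then 1 else 0)) \<and>
          (\<forall>i\<in>J. \<forall>h. h \<bullet> e = 0 \<longrightarrow> (hessian g y' *v v i) \<bullet> h = \<kappa> i * (v i \<bullet> h))"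
    using assms(4) unfolding principal_curvatures_def by blast
  then have "curvature_frame \<Omega> y e g v \<kappa> {1..CARD('n) - 1}"
    unfolding curvature_frame_def hyperplane_proj_def using assms by (auto simp: Let_def)
  then show thesis by (rule that)
qed

section \<open>\<open>q\<close>-means\<close>

definition pos_powr :: "real \<Rightarrow> real \<Rightarrow> real" where
  "pos_powr a x = max 0 x powr a"

text \<open>The function \<open>sgn x |x|^a\<close>, up to a factor the derivative of
  \<open>|x|^(a + 1)\<close>; for \<open>a = q - 1\<close> its vanishing integral characterises the
  \<open>q\<close>-mean. The two one-sided powers are kept apart because the asymptotics estimate
  them separately.\<close>

definition signed_powr :: "real \<Rightarrow> real \<Rightarrow> real" where
  "signed_powr a x = pos_powr a x - pos_powr a (- x)"

lemma pos_powr_nonneg [simp]: "0 \<le> pos_powr a x"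
  by (simp add: pos_powr_def)

lemma pos_powr_nonpos [simp]: "x \<le> 0 \<Longrightarrow> pos_powr a x = 0"
  by (simp add: pos_powr_def max_def)

lemma pos_powr_pos [simp]: "0 \<le> x \<Longrightarrow> pos_powr a x = x powr a"
  by (simp add: pos_powr_def max_def)

lemma pos_powr_mono: "0 < a \<Longrightarrow> x \<le> y \<Longrightarrow> pos_powr a x \<le> pos_powr a y"
  by (auto simp: pos_powr_def intro!: powr_mono2)

lemma pos_powr_strict_mono: "0 < a \<Longrightarrow> x < y \<Longrightarrow> 0 < y \<Longrightarrow> pos_powr a x < pos_powr a y"
  by (auto simp: pos_powr_def max_def intro!: powr_less_mono2)

lemma continuous_on_pos_powr [continuous_intros]:
  "0 < a \<Longrightarrow> continuous_on S f \<Longrightarrow> continuous_on S (\<lambda>x. pos_powr a (f x))"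
  unfolding pos_powr_def by (intro continuous_on_powr' continuous_intros) auto

lemma tendsto_pos_powr [tendsto_intros]:
  assumes "0 < a" "(f \<longlongrightarrow> l) F"
  shows "((\<lambda>x. pos_powr a (f x)) \<longlongrightarrow> pos_powr a l) F"
proof -
  have "continuous_on UNIV (pos_powr a)" using continuous_on_pos_powr[OF assms(1) continuous_on_id] by simp
  then have "isCont (pos_powr a) l" by (simp add: continuous_on_eq_continuous_at)
  then show ?thesis using assms(2) by (rule isCont_tendsto_compose)
qed

lemma borel_measurable_pos_powr [measurable]: "pos_powr a \<in> borel_measurable borel"
  unfolding pos_powr_def[abs_def] by measurable

lemma borel_measurable_signed_powr [measurable]: "signed_powr a \<in> borel_measurable borel"
  unfolding signed_powr_def[abs_def] by measurable

lemma pos_powr_mult: "0 \<le> c \<Longrightarrow> pos_powr a (c * x) = c powr a * pos_powr a x"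
  by (cases "0 \<le> x") (auto simp: powr_mult mult_nonneg_nonpos)

lemma signed_powr_strict_mono:
  assumes "0 < a" "x < y"
  shows "signed_powr a x < signed_powr a y"
proof (cases "0 < y")
  case True
  have "pos_powr a x < pos_powr a y" by (rule pos_powr_strict_mono) (use True assms in auto)
  moreover have "pos_powr a (- y) \<le> pos_powr a (- x)" by (rule pos_powr_mono) (use assms in auto)
  ultimately show ?thesis by (simp only: signed_powr_def)
next
  case False
  have "pos_powr a (- y) < pos_powr a (- x)" by (rule pos_powr_strict_mono) (use False assms in auto)
  moreover have "pos_powr a x \<le> pos_powr a y" by (rule pos_powr_mono) (use assms in auto)
  ultimately show ?thesis by (simp only: signed_powr_def)
qed

lemma pos_powr_Suc: "pos_powr (1 + a) x = x * pos_powr a x"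
proof (cases "0 < x")
  case True
  then show ?thesis by (simp add: powr_add)
qed simp

lemma has_real_derivative_pos_powr:
  assumes q: "1 < q"
  shows "(pos_powr q has_real_derivative q * pos_powr (q - 1) x) (at x)"
proof -
  consider "0 < x" | "x < 0" | "x = 0" by linarith
  then show ?thesis
  proof cases
    case 1
    have "((\<lambda>x. x powr q) has_real_derivative q * x powr (q - 1)) (at x)"
      by (rule has_real_derivative_powr[OF 1])
    then have "(pos_powr q has_real_derivative q * x powr (q - 1)) (at x)"
      by (rule has_field_derivative_transform_within_open[where S="{0<..}"]) (use 1 in auto)
    then show ?thesis using 1 by simp
  next
    case 2
    have "((\<lambda>x. 0) has_real_derivative 0) (at x)" by simp
    then have "(pos_powr q has_real_derivative 0) (at x)"
      by (rule has_field_derivative_transform_within_open[where S="{..<0}"]) (use 2 in auto)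
    then show ?thesis using 2 by simp
  next
    case 3
    \<comment> \<open>At 0 the difference quotient is itself \<open>pos_powr (q - 1) h\<close>,
      which tends to 0.\<close>
    have "(\<lambda>h. pos_powr (q - 1) h) \<midarrow>0\<rightarrow> pos_powr (q - 1) 0"
      using q by (intro tendsto_intros) auto
    moreover have "\<forall>\<^sub>F h in at 0. pos_powr (q - 1) h = (pos_powr q (0 + h) - pos_powr q 0) / h"
      using pos_powr_Suc[of "q - 1"] by (auto simp: eventually_at_filter)
    ultimately have "(\<lambda>h. (pos_powr q (0 + h) - pos_powr q 0) / h) \<midarrow>0\<rightarrow> pos_powr (q - 1) 0"
      by (rule Lim_transform_eventually)
    then show ?thesis using 3 by (simp add: DERIV_def)
  qed
qed

lemma abs_powr_split: "\<bar>x\<bar> powr q = pos_powr q x + pos_powr q (- x)"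
  by (cases "0 \<le> x") auto

lemma has_real_derivative_abs_powr:
  assumes q: "1 < q"
  shows "((\<lambda>x. \<bar>x\<bar> powr q) has_real_derivative q * signed_powr (q - 1) x) (at x)"
proof -
  have "((\<lambda>x. pos_powr q x + pos_powr q (- x)) has_real_derivative
      q * pos_powr (q - 1) x + (q * pos_powr (q - 1) (- x)) * (- 1)) (at x)"
    by (intro DERIV_add has_real_derivative_pos_powr[OF q] DERIV_chain2[OF has_real_derivative_pos_powr[OF q]] DERIV_minus DERIV_ident)
  then show ?thesis by (simp add: abs_powr_split signed_powr_def algebra_simps)
qed

lemma abs_powr_strictly_convex:
  assumes q: "1 < q" and "x \<noteq> y"
  shows "\<bar>x\<bar> powr q + q * signed_powr (q - 1) x * (y - x) < \<bar>y\<bar> powr q"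
proof -
  let ?F = "\<lambda>x. \<bar>x\<bar> powr q" and ?f = "\<lambda>x. q * signed_powr (q - 1) x"
  have mono: "?f s < ?f t" if "s < t" for s t
    using signed_powr_strict_mono[of "q - 1" s t] q that by simp
  consider "x < y" | "y < x" using assms(2) by linarith
  then show ?thesis
  proof cases
    case 1
    obtain z where z: "x < z" "?F y - ?F x = (y - x) * ?f z"
      using MVT2[OF 1, of ?F ?f] has_real_derivative_abs_powr[OF q] by auto
    have "(y - x) * ?f x < (y - x) * ?f z" using 1 by (intro mult_strict_left_mono[OF mono[OF z(1)]]) auto
    then show ?thesis using z(2) by (simp add: mult.commute)
  next
    case 2
    obtain z where z: "z < x" "?F x - ?F y = (x - y) * ?f z"
      using MVT2[OF 2, of ?F ?f] has_real_derivative_abs_powr[OF q] by auto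
    have "(x - y) * ?f z < (x - y) * ?f x" using 2 by (intro mult_strict_left_mono[OF mono[OF z(1)]]) auto
    then show ?thesis using z(2) by (simp add: algebra_simps)
  qed
qed

text \<open>Intermediate value theorem: the integral is nonnegative for \<open>m = 0\<close>,
  nonpositive for \<open>m = 1\<close>, and continuous in \<open>m\<close> by dominated
  convergence.\<close>

lemma (in finite_measure) signed_powr_root_exists:
  fixes v :: "'a \<Rightarrow> real"
  assumes a: "0 < a" and v [measurable]: "v \<in> borel_measurable M"
    and rng: "\<And>z. z \<in> space M \<Longrightarrow> 0 \<le> v z \<and> v z \<le> 1"
  obtains m where "0 \<le> m" "m \<le> 1" "(LINT z|M. signed_powr a (v z - m)) = 0"
proof -
  have bd: "\<bar>signed_powr a (v z - l)\<bar> \<le> 1" if "z \<in> space M" "0 \<le> l" "l \<le> 1" for z l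
  proof (cases "0 \<le> v z - l")
    case True
    then have "(v z - l) powr a \<le> 1 powr a" using rng[OF that(1)] that a by (intro powr_mono2) auto
    then show ?thesis using True by (simp add: signed_powr_def)
  next
    case False
    then have "(l - v z) powr a \<le> 1 powr a" using rng[OF that(1)] that a by (intro powr_mono2) auto
    then show ?thesis using False by (simp add: signed_powr_def)
  qed
  let ?J = "\<lambda>l. LINT z|M. signed_powr a (v z - l)"
  have "continuous_on {0..1} ?J"
    unfolding continuous_on_sequentially comp_def
  proof (intro allI ballI impI)
    fix l and x assume x: "x \<in> {0..1::real}" "(\<forall>n. l n \<in> {0..1}) \<and> l \<longlonglongrightarrow> x"
    show "(\<lambda>n. ?J (l n)) \<longlonglongrightarrow> ?J x"
    proof (rule integral_dominated_convergence[where w="\<lambda>z. 1"])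
      show "AE z in M. (\<lambda>n. signed_powr a (v z - l n)) \<longlonglongrightarrow> signed_powr a (v z - x)"
        unfolding signed_powr_def using x a by (intro AE_I2 tendsto_intros) auto
      show "AE z in M. norm (signed_powr a (v z - l n)) \<le> 1" for n
        using x bd by (intro AE_I2) auto
    qed auto
  qed
  moreover have "0 \<le> ?J 0"
    by (rule Bochner_Integration.integral_nonneg_AE) (use rng in \<open>auto simp: signed_powr_def intro!: AE_I2\<close>)
  moreover have "?J 1 \<le> 0"
  proof -
    have "0 \<le> (LINT z|M. - signed_powr a (v z - 1))"
      by (rule Bochner_Integration.integral_nonneg_AE) (use rng in \<open>auto simp: signed_powr_def intro!: AE_I2\<close>)
    then show ?thesis by simp
  qed
  ultimately obtain m where "0 \<le> m" "m \<le> 1" "?J m = 0"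
    using IVT2'[of ?J 1 0 0] by auto
  then show thesis by (rule that)
qed

text \<open>By strict convexity the tangent to \<open>|x|^q\<close> at \<open>v z - m\<close> lies
  below its graph. For the root \<open>m\<close> the linear term integrates to 0, so
  \<open>m\<close> is the strict minimiser and the definite description in \<open>q_mean\<close>
  denotes it.\<close>

lemma q_mean_finite_exponent:
  fixes B :: "(real^'n) set" and v :: "real^'n \<Rightarrow> real"
  assumes q: "1 < q" and B: "B \<in> lmeasurable" "0 < measure lebesgue B"
    and v [measurable]: "v \<in> borel_measurable (lebesgue_on B)"
    and rng: "\<And>z. z \<in> B \<Longrightarrow> 0 \<le> v z \<and> v z \<le> 1"
  shows "0 \<le> q_mean (ereal q) B v" "q_mean (ereal q) B v \<le> 1"
    "(LINT z|lebesgue_on B. signed_powr (q - 1) (v z - q_mean (ereal q) B v)) = 0"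
proof -
  let ?M = "lebesgue_on B"
  have fin: "finite_measure ?M" using B(1) by (rule finite_measure_lebesgue_on)
  interpret finite_measure ?M by (rule fin)
  have ne: "emeasure ?M (space ?M) \<noteq> 0"
    using B by (simp add: emeasure_restrict_space emeasure_eq_measure2 fmeasurableD)
  obtain m where m: "0 \<le> m" "m \<le> 1" "(LINT z|?M. signed_powr (q - 1) (v z - m)) = 0"
    using signed_powr_root_exists[of "q - 1" v] q rng by auto
  have int: "integrable ?M (\<lambda>z. \<bar>v z - c\<bar> powr q)" for c
  proof (rule integrable_const_bound[of _ "(1 + \<bar>c\<bar>) powr q"])
    have "\<bar>v z - c\<bar> powr q \<le> (1 + \<bar>c\<bar>) powr q" if "z \<in> B" for z
      using rng[OF that] q by (intro powr_mono2) auto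
    then show "AE z in ?M. norm (\<bar>v z - c\<bar> powr q) \<le> (1 + \<bar>c\<bar>) powr q" by (intro AE_I2) auto
  qed measurable
  have int': "integrable ?M (\<lambda>z. signed_powr (q - 1) (v z - m))"
  proof (rule integrable_const_bound[of _ 1])
    have "\<bar>signed_powr (q - 1) (v z - m)\<bar> \<le> 1" if "z \<in> B" for z
    proof -
      have "signed_powr (q - 1) (v z - m) = (v z - m) powr (q - 1) \<and> 0 \<le> v z - m \<or>
          signed_powr (q - 1) (v z - m) = - ((m - v z) powr (q - 1)) \<and> 0 \<le> m - v z"
        by (cases "0 \<le> v z - m") (auto simp: signed_powr_def)
      moreover have "t powr (q - 1) \<le> 1 powr (q - 1)" if "0 \<le> t" "t \<le> 1" for t :: real
        using that q by (intro powr_mono2) auto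
      moreover have "0 \<le> (v z - m) powr (q - 1)" "0 \<le> (m - v z) powr (q - 1)" by simp_all
      ultimately show ?thesis using rng[OF that] m by (fastforce simp: abs_le_iff)
    qed
    then show "AE z in ?M. norm (signed_powr (q - 1) (v z - m)) \<le> 1" by (intro AE_I2) auto
  qed measurable
  have less: "Lq_norm (ereal q) B (\<lambda>z. v z - m) < Lq_norm (ereal q) B (\<lambda>z. v z - c)" if "c \<noteq> m" for c
  proof -
    have "(LINT z|?M. \<bar>v z - m\<bar> powr q + q * signed_powr (q - 1) (v z - m) * (m - c)) < (LINT z|?M. \<bar>v z - c\<bar> powr q)"
    proof (rule integral_less_AE_space)
      have "\<bar>v z - m\<bar> powr q + q * signed_powr (q - 1) (v z - m) * (m - c) < \<bar>v z - c\<bar> powr q" for z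
        using abs_powr_strictly_convex[OF q, of "v z - m" "v z - c"] that by simp
      then show "AE z in ?M. \<bar>v z - m\<bar> powr q + q * signed_powr (q - 1) (v z - m) * (m - c) < \<bar>v z - c\<bar> powr q" by simp
    qed (use int int' ne in \<open>auto intro!: integrable_mult_left integrable_mult_right\<close>)
    also have "(LINT z|?M. \<bar>v z - m\<bar> powr q + q * signed_powr (q - 1) (v z - m) * (m - c)) = (LINT z|?M. \<bar>v z - m\<bar> powr q)"
      using int int' m(3) by (simp add: integrable_mult_left integrable_mult_right)
    finally have "(LINT z|?M. \<bar>v z - m\<bar> powr q) < (LINT z|?M. \<bar>v z - c\<bar> powr q)" .
    moreover have "0 \<le> (LINT z|?M. \<bar>v z - m\<bar> powr q)" by simp
    ultimately show ?thesis using q by (simp add: Lq_norm_def powr_less_mono2)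
  qed
  have "q_mean (ereal q) B v = m"
    unfolding q_mean_def
  proof (rule the_equality)
    show "\<forall>c. Lq_norm (ereal q) B (\<lambda>z. v z - m) \<le> Lq_norm (ereal q) B (\<lambda>z. v z - c)"
      using less by (metis less_imp_le order_refl)
    show "l = m" if "\<forall>c. Lq_norm (ereal q) B (\<lambda>z. v z - l) \<le> Lq_norm (ereal q) B (\<lambda>z. v z - c)" for l
      using less[of l] that by (metis not_le)
  qed
  then show "0 \<le> q_mean (ereal q) B v" "q_mean (ereal q) B v \<le> 1"
    "(LINT z|lebesgue_on B. signed_powr (q - 1) (v z - q_mean (ereal q) B v)) = 0" using m by auto
qed

text \<open>A nonempty open set is never negligible, so a continuous function cannot exceed its
  essential supremum at any point. The bound \<open>C\<close> keeps the value finite, so that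
  \<open>real_of_ereal\<close> is faithful.\<close>

lemma real_esssup_abs_bounds:
  fixes f :: "real^'n \<Rightarrow> real"
  assumes B: "open B" "B \<noteq> {}" and f: "continuous_on B f" and C: "\<And>z. z \<in> B \<Longrightarrow> \<bar>f z\<bar> \<le> C"
  shows "real_of_ereal (esssup (lebesgue_on B) (\<lambda>z. ereal \<bar>f z\<bar>)) \<le> C"
    "z \<in> B \<Longrightarrow> \<bar>f z\<bar> \<le> real_of_ereal (esssup (lebesgue_on B) (\<lambda>z. ereal \<bar>f z\<bar>))"
proof -
  let ?E = "esssup (lebesgue_on B) (\<lambda>z. ereal \<bar>f z\<bar>)"
  have meas: "f \<in> borel_measurable (lebesgue_on B)"
    using f B(1) by (intro continuous_imp_measurable_on_sets_lebesgue) auto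
  have up: "?E \<le> ereal C"
    using meas C by (intro esssup_I) (auto intro!: AE_I2)
  have low: "ereal \<bar>f z\<bar> \<le> ?E" if z: "z \<in> B" for z
  proof (rule ccontr)
    assume "\<not> ereal \<bar>f z\<bar> \<le> ?E"
    then have lt: "?E < ereal \<bar>f z\<bar>" by simp
    define S where "S = {w \<in> B. ?E < ereal \<bar>f w\<bar>}"
    have "continuous_on B (\<lambda>w. ereal \<bar>f w\<bar>)" using f by (intro continuous_intros)
    then have "open (B \<inter> (\<lambda>w. ereal \<bar>f w\<bar>) -` {?E<..})"
      using B(1) by (simp add: continuous_on_open_vimage Int_commute)
    moreover have "S = B \<inter> (\<lambda>w. ereal \<bar>f w\<bar>) -` {?E<..}" by (auto simp: S_def)
    ultimately have oS: "open S" by simp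
    have "z \<in> S" using z lt by (simp add: S_def)
    have "emeasure (lebesgue_on B) S = 0"
      using esssup_zero_measure[of "lebesgue_on B" "\<lambda>z. ereal \<bar>f z\<bar>"] by (simp add: S_def)
    then have "emeasure lebesgue S = 0"
      using B(1) by (subst (asm) emeasure_restrict_space) (auto simp: S_def)
    then have "S \<in> null_sets lebesgue" using oS by (auto simp: null_sets_def)
    then show False using open_not_negligible[OF oS] \<open>z \<in> S\<close> by (auto simp: negligible_iff_null_sets)
  qed
  obtain z0 where "z0 \<in> B" using B(2) by blast
  then obtain s where s: "?E = ereal s" using low[of z0] up by (cases ?E) auto
  show "real_of_ereal ?E \<le> C" using up s by simp
  show "z \<in> B \<Longrightarrow> \<bar>f z\<bar> \<le> real_of_ereal ?E" using low[of z] s by simp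
qed

text \<open>Any other constant \<open>c\<close> costs at least \<open>|c - m|\<close> more than half
  the oscillation, so the midpoint is the unique minimiser.\<close>

lemma q_mean_infinity:
  fixes v :: "real^'n \<Rightarrow> real"
  assumes B: "open B" "B \<noteq> {}" and v: "continuous_on B v" and bdd: "bounded (v ` B)"
  shows "q_mean \<infinity> B v = (Sup (v ` B) + Inf (v ` B)) / 2"
proof -
  define S I where "S = Sup (v ` B)" and "I = Inf (v ` B)"
  have le: "I \<le> v z" "v z \<le> S" if "z \<in> B" for z
    using that bdd by (auto simp: S_def I_def intro!: cInf_lower cSup_upper bounded_imp_bdd_below bounded_imp_bdd_above)
  define m where "m = (S + I) / 2"
  have norm: "Lq_norm \<infinity> B f = real_of_ereal (esssup (lebesgue_on B) (\<lambda>z. ereal \<bar>f z\<bar>))" for f :: "real^'n \<Rightarrow> real"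
    by (simp add: Lq_norm_def)
  have at_m: "Lq_norm \<infinity> B (\<lambda>z. v z - m) \<le> (S - I) / 2"
    unfolding norm using le by (intro real_esssup_abs_bounds B continuous_intros v) (force simp: m_def abs_le_iff field_simps)
  have other: "(S - I) / 2 + \<bar>c - m\<bar> \<le> Lq_norm \<infinity> B (\<lambda>z. v z - c)" for c
  proof -
    define K where "K = max \<bar>S\<bar> \<bar>I\<bar> + \<bar>c\<bar>"
    have "\<bar>v z - c\<bar> \<le> K" if "z \<in> B" for z using le[OF that] by (auto simp: K_def)
    then have ge: "\<bar>v z - c\<bar> \<le> Lq_norm \<infinity> B (\<lambda>z. v z - c)" if "z \<in> B" for z
      unfolding norm using that by (intro real_esssup_abs_bounds(2)[of B "\<lambda>z. v z - c" K] B continuous_intros v)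
    then have "v z \<le> Lq_norm \<infinity> B (\<lambda>z. v z - c) + c" "c - Lq_norm \<infinity> B (\<lambda>z. v z - c) \<le> v z" if "z \<in> B" for z
      using that by (force simp: abs_le_iff)+
    then have "S \<le> Lq_norm \<infinity> B (\<lambda>z. v z - c) + c" "c - Lq_norm \<infinity> B (\<lambda>z. v z - c) \<le> I"
      unfolding S_def I_def using B(2) by (auto intro!: cSUP_least cINF_greatest)
    then show ?thesis by (auto simp: m_def abs_if field_simps)
  qed
  have "q_mean \<infinity> B v = m"
    unfolding q_mean_def
  proof (rule the_equality)
    show "\<forall>c. Lq_norm \<infinity> B (\<lambda>z. v z - m) \<le> Lq_norm \<infinity> B (\<lambda>z. v z - c)"
      using at_m other by (smt (verit))
    show "l = m" if "\<forall>c. Lq_norm \<infinity> B (\<lambda>z. v z - l) \<le> Lq_norm \<infinity> B (\<lambda>z. v z - c)" for l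
    proof -
      have "\<bar>l - m\<bar> \<le> 0" using that[rule_format, of m] at_m other[of l] by linarith
      then show ?thesis by simp
    qed
  qed
  then show ?thesis by (simp add: m_def S_def I_def)
qed

text \<open>If \<open>v\<close> is small outside a set of small measure, then \<open>\<integral>(v - m)\<^sub>+\<^sup>a = \<integral>(m - v)\<^sub>+\<^sup>a\<close> forces
  \<open>m\<^sup>a |M|\<close> to be asymptotic to the left-hand side.\<close>

lemma (in finite_measure) signed_powr_root_asymptotics:
  fixes v :: "nat \<Rightarrow> 'a \<Rightarrow> real" and m T :: "nat \<Rightarrow> real"
  assumes a: "0 < a" and ne: "0 < measure M (space M)"
    and v [measurable]: "\<And>n. v n \<in> borel_measurable M"
    and rng: "\<And>n z. z \<in> space M \<Longrightarrow> 0 \<le> v n z \<and> v n z \<le> 1"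
    and m: "\<And>n. 0 \<le> m n" "\<And>n. m n \<le> 1" "\<And>n. (LINT z|M. signed_powr a (v n z - m n)) = 0"
    and T: "\<And>n. 0 < T n" and L: "0 < L"
    and lim: "\<And>e. (\<And>n. 0 \<le> e n) \<Longrightarrow> e \<longlonglongrightarrow> 0 \<Longrightarrow> (\<lambda>n. T n * (LINT z|M. pos_powr a (v n z - e n))) \<longlonglongrightarrow> L"
    and v0: "\<And>z. z \<in> space M \<Longrightarrow> (\<lambda>n. v n z) \<longlonglongrightarrow> 0"
    and vT: "\<And>z. z \<in> space M \<Longrightarrow> (\<lambda>n. T n powr (1 / a) * v n z) \<longlonglongrightarrow> 0"
  shows "(\<lambda>n. T n * m n powr a) \<longlonglongrightarrow> L / measure M (space M)"
proof -
  let ?V = "measure M (space M)"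
  have pp1: "pos_powr a x \<le> 1" if "x \<le> 1" for x
    using pos_powr_mono[OF a that] by simp
  have int: "integrable M (\<lambda>z. pos_powr a (v n z - c))" "integrable M (\<lambda>z. pos_powr a (c - v n z))" if "0 \<le> c" "c \<le> 1" for n c
  proof -
    have "norm (pos_powr a (v n z - c)) \<le> 1" "norm (pos_powr a (c - v n z)) \<le> 1" if "z \<in> space M" for z
      using pp1[of "v n z - c"] pp1[of "c - v n z"] rng[OF that, of n] \<open>0 \<le> c\<close> \<open>c \<le> 1\<close> by auto
    then show "integrable M (\<lambda>z. pos_powr a (v n z - c))" "integrable M (\<lambda>z. pos_powr a (c - v n z))"
      by (intro integrable_const_bound[of _ 1] AE_I2; simp)+
  qed
  have eq: "(LINT z|M. pos_powr a (v n z - m n)) = (LINT z|M. pos_powr a (m n - v n z))" for n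
    using m(3)[of n] int[OF m(1,2), of n n] by (simp add: signed_powr_def)
  have lim0: "(\<lambda>n. LINT z|M. pos_powr a (v n z)) \<longlonglongrightarrow> 0"
  proof -
    have "(\<lambda>n. LINT z|M. pos_powr a (v n z)) \<longlonglongrightarrow> (LINT z|M. 0)"
    proof (rule integral_dominated_convergence[where w="\<lambda>z. 1"])
      show "AE z in M. (\<lambda>n. pos_powr a (v n z)) \<longlonglongrightarrow> 0"
        using tendsto_pos_powr[OF a v0] by (intro AE_I2) simp
      have "norm (pos_powr a (v n z)) \<le> 1" if "z \<in> space M" for n z
        using pp1[of "v n z"] rng[OF that, of n] by (simp del: pos_powr_pos)
      then show "AE z in M. norm (pos_powr a (v n z)) \<le> 1" for n by (intro AE_I2)
    qed auto
    then show ?thesis by simp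
  qed
  have m0: "m \<longlonglongrightarrow> 0"
  proof (rule order_tendstoI)
    fix e :: real assume "e < 0"
    then show "\<forall>\<^sub>F n in sequentially. e < m n" using m(1) by (intro always_eventually allI) (rule less_le_trans)
  next
    fix e :: real assume e: "0 < e"
    \<comment> \<open>If \<open>m n \<ge> d\<close>, then the integral of the positive part of
      \<open>d - v n\<close> to the power \<open>a\<close>, which tends to a positive limit, would
      be at most that of \<open>v n\<close> to the power \<open>a\<close>, which tends to 0.\<close>
    define d where "d = min e 1"
    have d: "0 < d" "d \<le> 1" "d \<le> e" using e by (auto simp: d_def)
    have "(\<lambda>n. LINT z|M. pos_powr a (d - v n z)) \<longlonglongrightarrow> (LINT z|M. pos_powr a (d - 0))"
    proof (rule integral_dominated_convergence[where w="\<lambda>z. 1"])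
      show "AE z in M. (\<lambda>n. pos_powr a (d - v n z)) \<longlonglongrightarrow> pos_powr a (d - 0)"
        using a v0 by (intro AE_I2 tendsto_intros)
      have "norm (pos_powr a (d - v n z)) \<le> 1" if "z \<in> space M" for n z
        using pp1[of "d - v n z"] rng[OF that, of n] d by (simp del: pos_powr_pos)
      then show "AE z in M. norm (pos_powr a (d - v n z)) \<le> 1" for n by (intro AE_I2)
    qed auto
    from tendsto_diff[OF this lim0]
    have "(\<lambda>n. (LINT z|M. pos_powr a (d - v n z)) - (LINT z|M. pos_powr a (v n z))) \<longlonglongrightarrow> d powr a * ?V"
      using d by (simp add: mult.commute)
    moreover have "0 < d powr a * ?V" using d ne by simp
    ultimately have "\<forall>\<^sub>F n in sequentially. 0 < (LINT z|M. pos_powr a (d - v n z)) - (LINT z|M. pos_powr a (v n z))"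
      by (rule order_tendstoD(1))
    then show "\<forall>\<^sub>F n in sequentially. m n < e"
    proof eventually_elim
      case (elim n)
      show ?case
      proof (rule ccontr)
        assume "\<not> m n < e"
        then have "d \<le> m n" using d by simp
        then have "(LINT z|M. pos_powr a (d - v n z)) \<le> (LINT z|M. pos_powr a (m n - v n z))"
          using d m(1,2)[of n] by (intro integral_mono int pos_powr_mono a) auto
        also have "\<dots> = (LINT z|M. pos_powr a (v n z - m n))" by (rule eq[symmetric])
        also have "\<dots> \<le> (LINT z|M. pos_powr a (v n z))"
          using int(1)[of 0 n] m(1,2)[of n] by (intro integral_mono int pos_powr_mono a) auto
        finally show False using elim by simp
      qed
    qed
  qed
  \<comment> \<open>The hypothesis \<open>lim\<close> covers every nonnegative null sequence, so
    \<open>m\<close> can be inserted although its rate is still unknown.\<close>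
  have I: "(\<lambda>n. T n * (LINT z|M. pos_powr a (m n - v n z))) \<longlonglongrightarrow> L"
    using lim[OF m(1) m0] by (simp add: eq)
  have I_le: "(LINT z|M. pos_powr a (m n - v n z)) \<le> m n powr a * ?V" for n
  proof -
    have "pos_powr a (m n - v n z) \<le> m n powr a" if "z \<in> space M" for z
      using pos_powr_mono[OF a, of "m n - v n z" "m n"] rng[OF that, of n] m(1)[of n] by simp
    then have "(LINT z|M. pos_powr a (m n - v n z)) \<le> (LINT z|M. m n powr a)"
      using m by (intro integral_mono int) auto
    then show ?thesis by (simp add: mult.commute)
  qed
  define c where "c = L / (2 * ?V)"
  have c: "0 < c" using L ne by (simp add: c_def)
  have "\<forall>\<^sub>F n in sequentially. L / 2 < T n * (LINT z|M. pos_powr a (m n - v n z))"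
    using L by (intro order_tendstoD(1)[OF I]) auto
  \<comment> \<open>A first lower bound of the right order for \<open>m n\<close>. With
    \<open>vT\<close> it makes \<open>v n z / m n\<close> tend to 0, and this identifies the
    constant.\<close>
  then have ev: "\<forall>\<^sub>F n in sequentially. c < T n * m n powr a"
  proof eventually_elim
    case (elim n)
    also have "T n * (LINT z|M. pos_powr a (m n - v n z)) \<le> T n * (m n powr a * ?V)"
      using I_le[of n] T[of n] by simp
    finally show ?case using ne by (simp add: c_def field_simps)
  qed
  have ratio: "(\<lambda>n. v n z / m n) \<longlonglongrightarrow> 0" if z: "z \<in> space M" for z
  proof (rule tendsto_sandwich[OF _ _ tendsto_const])
    show "\<forall>\<^sub>F n in sequentially. 0 \<le> v n z / m n" using rng[OF z] m(1) by simp
    show "\<forall>\<^sub>F n in sequentially. v n z / m n \<le> T n powr (1 / a) * v n z / c powr (1 / a)"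
      using ev
    proof eventually_elim
      case (elim n)
      have mp: "0 < m n" using elim c m(1)[of n] by (cases "m n = 0") (auto simp: less_le)
      have "c powr (1 / a) \<le> (T n * m n powr a) powr (1 / a)" using elim c a by (intro powr_mono2) auto
      also have "\<dots> = T n powr (1 / a) * m n" using T[of n] mp a by (simp add: powr_mult powr_powr)
      finally have "v n z * c powr (1 / a) \<le> v n z * (T n powr (1 / a) * m n)"
        using rng[OF z, of n] by (intro mult_left_mono) auto
      then show ?case using mp c by (simp add: field_simps)
    qed
    show "(\<lambda>n. T n powr (1 / a) * v n z / c powr (1 / a)) \<longlonglongrightarrow> 0"
      using tendsto_divide[OF vT[OF z] tendsto_const, of "c powr (1 / a)"] c by simp
  qed
  have "(\<lambda>n. LINT z|M. pos_powr a (1 - v n z / m n)) \<longlonglongrightarrow> (LINT z|M. pos_powr a (1 - 0))"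
  proof (rule integral_dominated_convergence[where w="\<lambda>z. 1"])
    show "AE z in M. (\<lambda>n. pos_powr a (1 - v n z / m n)) \<longlonglongrightarrow> pos_powr a (1 - 0)"
      using a ratio by (intro AE_I2 tendsto_intros)
    have "norm (pos_powr a (1 - v n z / m n)) \<le> 1" if "z \<in> space M" for n z
      using pp1[of "1 - v n z / m n"] rng[OF that, of n] m(1)[of n] by (simp del: pos_powr_pos)
    then show "AE z in M. norm (pos_powr a (1 - v n z / m n)) \<le> 1" for n by (intro AE_I2)
  qed auto
  then have D: "(\<lambda>n. LINT z|M. pos_powr a (1 - v n z / m n)) \<longlonglongrightarrow> ?V" by simp
  have "(\<lambda>n. (T n * (LINT z|M. pos_powr a (m n - v n z))) / (LINT z|M. pos_powr a (1 - v n z / m n))) \<longlonglongrightarrow> L / ?V"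
    using ne by (intro tendsto_divide I D) auto
  moreover have "\<forall>\<^sub>F n in sequentially. 0 < (LINT z|M. pos_powr a (1 - v n z / m n))"
    using ne by (intro order_tendstoD(1)[OF D])
  then have "\<forall>\<^sub>F n in sequentially. (T n * (LINT z|M. pos_powr a (m n - v n z))) / (LINT z|M. pos_powr a (1 - v n z / m n)) = T n * m n powr a"
    using ev
  proof eventually_elim
    case (elim n)
    have mp: "0 < m n" using elim(2) c m(1)[of n] by (cases "m n = 0") (auto simp: less_le)
    have "pos_powr a (m n - v n z) = m n powr a * pos_powr a (1 - v n z / m n)" for z
      using mp pos_powr_mult[of "m n" a "1 - v n z / m n"] by (simp add: right_diff_distrib)
    then show ?case using elim(1) by simp
  qed
  ultimately show ?thesis by (rule Lim_transform_eventually)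
qed

section \<open>Integration in an orthonormal frame\<close>

lemma nn_integral_lborel_shift:
  fixes f :: "'a::euclidean_space \<Rightarrow> ennreal"
  assumes [measurable]: "f \<in> borel_measurable borel"
  shows "(\<integral>\<^sup>+x. f (a + x) \<partial>lborel) = (\<integral>\<^sup>+x. f x \<partial>lborel)"
proof -
  have "(\<integral>\<^sup>+x. f x \<partial>lborel) = (\<integral>\<^sup>+x. f x \<partial>distr lborel borel ((+) a))" by (simp add: lborel_distr_plus)
  also have "\<dots> = (\<integral>\<^sup>+x. f (a + x) \<partial>lborel)" by (subst nn_integral_distr) auto
  finally show ?thesis by simp
qed

text \<open>Compare both integrals with the translation-invariant double integral of
  \<open>f (T x + y)\<close> over \<open>y\<close> in the unit ball.\<close>

lemma nn_integral_lborel_isometry: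
  fixes T S :: "'a::euclidean_space \<Rightarrow> 'a"
  assumes T: "linear T" and iso: "\<And>x. norm (T x) = norm x" and inv: "\<And>y. T (S y) = y"
    and [measurable]: "f \<in> borel_measurable borel"
  shows "(\<integral>\<^sup>+x. f (T x) \<partial>lborel) = (\<integral>\<^sup>+x. f x \<partial>lborel)"
proof -
  have [measurable]: "T \<in> borel_measurable borel"
    using T by (intro borel_measurable_continuous_onI linear_continuous_on linear_linear[THEN iffD2])
  let ?B = "indicator (ball (0::'a) 1) :: 'a \<Rightarrow> ennreal"
  let ?c = "emeasure lborel (ball (0::'a) 1)"
  have Bm [measurable]: "?B \<in> borel_measurable borel" by (rule borel_measurable_indicator) simp
  have c: "?c \<noteq> 0" "?c \<noteq> top"
  proof -
    have "0 < unit_ball_vol (real DIM('a))" by (rule unit_ball_vol_pos) simp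
    moreover have c: "?c = ennreal (unit_ball_vol (real DIM('a)))" using emeasure_ball[of 1 "0::'a"] by simp
    ultimately show "?c \<noteq> 0" by (simp only: ennreal_eq_0_iff not_le)
    show "?c \<noteq> top" by (simp add: c)
  qed
  have Bc: "(\<integral>\<^sup>+x. ?B (y - T x) \<partial>lborel) = ?c" for y
  proof -
    have "y - T x \<in> ball 0 1 \<longleftrightarrow> S y - x \<in> ball 0 1" for x
    proof -
      have "T (S y - x) = y - T x" using T inv by (simp add: linear_diff)
      then show ?thesis using iso[of "S y - x"] by simp
    qed
    then have "(\<integral>\<^sup>+x. ?B (y - T x) \<partial>lborel) = (\<integral>\<^sup>+x. ?B (S y - x) \<partial>lborel)"
      by (simp add: indicator_def)
    also have "\<dots> = (\<integral>\<^sup>+x. indicator (ball (S y) 1) x \<partial>lborel)"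
      by (intro nn_integral_cong) (simp add: indicator_def dist_norm norm_minus_commute)
    also have "\<dots> = emeasure lborel (ball (S y) 1)" by simp
    also have "\<dots> = ?c" by (simp add: emeasure_ball)
    finally show ?thesis .
  qed
  have "?c * (\<integral>\<^sup>+x. f (T x) \<partial>lborel) = (\<integral>\<^sup>+y. ?B y * (\<integral>\<^sup>+x. f (T x) \<partial>lborel) \<partial>lborel)"
    by (subst nn_integral_multc) (auto simp: Bm)
  also have "\<dots> = (\<integral>\<^sup>+y. \<integral>\<^sup>+x. ?B y * f (y + T x) \<partial>lborel \<partial>lborel)"
  proof (rule nn_integral_cong)
    fix y
    have "(\<integral>\<^sup>+x. f (T x) \<partial>lborel) = (\<integral>\<^sup>+x. f (T (S y + x)) \<partial>lborel)"
      by (rule nn_integral_lborel_shift[symmetric]) measurable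
    then show "?B y * (\<integral>\<^sup>+x. f (T x) \<partial>lborel) = (\<integral>\<^sup>+x. ?B y * f (y + T x) \<partial>lborel)"
      using T inv by (simp add: linear_add nn_integral_cmult)
  qed
  also have "\<dots> = (\<integral>\<^sup>+x. \<integral>\<^sup>+y. ?B y * f (y + T x) \<partial>lborel \<partial>lborel)"
    by (rule lborel_pair.Fubini') measurable
  also have "\<dots> = (\<integral>\<^sup>+x. \<integral>\<^sup>+y. ?B (y - T x) * f y \<partial>lborel \<partial>lborel)"
  proof (rule nn_integral_cong)
    fix x
    have "(\<integral>\<^sup>+y. ?B (y - T x) * f y \<partial>lborel) = (\<integral>\<^sup>+y. ?B (T x + y - T x) * f (T x + y) \<partial>lborel)"
      by (rule nn_integral_lborel_shift[symmetric]) measurable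
    then show "(\<integral>\<^sup>+y. ?B y * f (y + T x) \<partial>lborel) = (\<integral>\<^sup>+y. ?B (y - T x) * f y \<partial>lborel)"
      by (simp add: add.commute)
  qed
  also have "\<dots> = (\<integral>\<^sup>+y. \<integral>\<^sup>+x. ?B (y - T x) * f y \<partial>lborel \<partial>lborel)"
    by (rule lborel_pair.Fubini') measurable
  also have "\<dots> = (\<integral>\<^sup>+y. ?c * f y \<partial>lborel)"
    by (intro nn_integral_cong) (simp add: nn_integral_multc Bc)
  also have "\<dots> = ?c * (\<integral>\<^sup>+y. f y \<partial>lborel)" by (simp add: nn_integral_cmult)
  finally show ?thesis using c by (simp add: ennreal_mult_cancel_left)
qed

text \<open>The substitution is composed of a diagonal scaling, an isometry and a translation; only
  the scaling contributes to the Jacobian.\<close>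

lemma nn_integral_lborel_frame:
  fixes V :: "'a::euclidean_space \<Rightarrow> 'a" and s :: "'a \<Rightarrow> real"
  assumes V: "\<And>b c. b \<in> Basis \<Longrightarrow> c \<in> Basis \<Longrightarrow> V b \<bullet> V c = (if b = c then 1 else 0)"
    and s: "\<And>b. b \<in> Basis \<Longrightarrow> 0 < s b"
    and f [measurable]: "f \<in> borel_measurable borel"
  shows "(\<integral>\<^sup>+z. f z \<partial>lborel) = ennreal (\<Prod>b\<in>Basis. s b) * (\<integral>\<^sup>+w. f (y + (\<Sum>b\<in>Basis. (s b * (w \<bullet> b)) *\<^sub>R V b)) \<partial>lborel)"
proof -
  define T where "T w = (\<Sum>b\<in>Basis. (w \<bullet> b) *\<^sub>R V b)" for w
  define S where "S z = (\<Sum>b\<in>Basis. (z \<bullet> V b) *\<^sub>R b)" for z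
  have lin: "linear T" unfolding T_def
    by (intro linearI) (simp_all add: inner_add_left scaleR_add_left sum.distrib scaleR_sum_right)
  have inner_T: "T w \<bullet> V c = w \<bullet> c" if "c \<in> Basis" for w c
  proof -
    have "T w \<bullet> V c = (\<Sum>b\<in>Basis. (w \<bullet> b) * (V b \<bullet> V c))" by (simp add: T_def inner_sum_left)
    also have "\<dots> = (\<Sum>b\<in>Basis. if b = c then w \<bullet> c else 0)" using V that by (intro sum.cong) auto
    finally show ?thesis using that by simp
  qed
  have ST: "S (T w) = w" for w
    by (simp add: S_def inner_T euclidean_representation)
  have iso: "norm (T w) = norm w" for w
  proof -
    have "T w \<bullet> T w = (\<Sum>b\<in>Basis. (w \<bullet> b) * (T w \<bullet> V b))"
      by (subst (2) T_def) (simp add: inner_sum_right)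
    also have "\<dots> = w \<bullet> w" by (simp add: inner_T euclidean_inner[of w w])
    finally show ?thesis by (simp add: norm_eq_sqrt_inner)
  qed
  have "inj T" using ST by (metis injI)
  then have "surj T" by (rule linear_injective_imp_surjective[OF lin]) (rule refl)
  then have TS: "T (S y) = y" for y using ST by (metis surjD)
  have [measurable]: "T \<in> borel_measurable borel"
    using lin by (intro borel_measurable_continuous_onI linear_continuous_on linear_linear[THEN iffD2])
  have "(\<integral>\<^sup>+z. f z \<partial>lborel) = (\<integral>\<^sup>+z. f (y + z) \<partial>lborel)" by (rule nn_integral_lborel_shift[symmetric]) fact
  also have "\<dots> = (\<integral>\<^sup>+z. f (y + T z) \<partial>lborel)"
    by (rule nn_integral_lborel_isometry[OF lin iso TS, symmetric]) measurable
  also have "\<dots> = (\<integral>\<^sup>+z. f (y + T z) \<partial>density (distr lborel borel (\<lambda>x. 0 + (\<Sum>j\<in>Basis. (s j * (x \<bullet> j)) *\<^sub>R j))) (\<lambda>_. \<Prod>j\<in>Basis. \<bar>s j\<bar>))"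
    using s by (subst lborel_affine_euclidean[of s 0]) (auto dest: s)
  also have "\<dots> = (\<integral>\<^sup>+w. ennreal (\<Prod>j\<in>Basis. \<bar>s j\<bar>) * f (y + T (\<Sum>j\<in>Basis. (s j * (w \<bullet> j)) *\<^sub>R j)) \<partial>lborel)"
    by (subst nn_integral_density, measurable, subst nn_integral_distr, measurable)
  also have "\<dots> = ennreal (\<Prod>j\<in>Basis. \<bar>s j\<bar>) * (\<integral>\<^sup>+w. f (y + T (\<Sum>j\<in>Basis. (s j * (w \<bullet> j)) *\<^sub>R j)) \<partial>lborel)"
    by (rule nn_integral_cmult) measurable
  also have "(\<Prod>j\<in>Basis. \<bar>s j\<bar>) = (\<Prod>j\<in>Basis. s j)" using s by (intro prod.cong) (auto simp: less_imp_le)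
  finally show ?thesis
    unfolding T_def by (simp add: inner_sum_left inner_Basis if_distrib sum.delta cong: if_cong)
qed

text \<open>Shifting the coordinate along \<open>e\<close> by the form with coefficients
  \<open>k\<close> leaves the condition \<open>c |w'|^2 < \<sigma>\<close> on the tangential part
  \<open>w'\<close>; by Fubini the slices are balls of dimension \<open>N - 1\<close> and radius
  \<open>sqrt (\<sigma> / c)\<close>. With both \<open>k\<close> and \<open>c\<close> as parameters
  the formula covers the limit integrand as well as the dominating function.\<close>

lemma nn_integral_paraboloid:
  fixes k :: "'a::euclidean_space \<Rightarrow> real" and h :: "real \<Rightarrow> ennreal"
  assumes e: "e \<in> Basis" and c: "0 < c" and [measurable]: "h \<in> borel_measurable borel"
  shows "(\<integral>\<^sup>+w. h (w \<bullet> e - (\<Sum>b\<in>Basis - {e}. k b * (w \<bullet> b)\<^sup>2)) *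
      indicator {w. c * (\<Sum>b\<in>Basis - {e}. (w \<bullet> b)\<^sup>2) < w \<bullet> e - (\<Sum>b\<in>Basis - {e}. k b * (w \<bullet> b)\<^sup>2)} w \<partial>lborel) =
    ennreal (unit_ball_vol (real (DIM('a) - 1))) *
      (\<integral>\<^sup>+\<sigma>. h \<sigma> * ennreal ((\<sigma> / c) powr (real (DIM('a) - 1) / 2)) * indicator {0<..} \<sigma> \<partial>lborel)"
proof -
  let ?A = "Basis - {e} :: 'a set"
  let ?P = "\<Pi>\<^sub>M b\<in>?A. (lborel :: real measure)"
  have A: "finite ?A" "e \<notin> ?A" "insert e ?A = Basis" "card ?A = DIM('a) - 1"
    using e by auto
  interpret product_sigma_finite "\<lambda>_::'a. lborel :: real measure" by standard
  interpret PA: sigma_finite_measure ?P by (rule sigma_finite) simp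
  interpret pair: pair_sigma_finite ?P "lborel :: real measure" ..
  define q where "q x = (\<Sum>b\<in>?A. k b * (x b)\<^sup>2)" for x :: "'a \<Rightarrow> real"
  define r where "r x = (\<Sum>b\<in>?A. (x b)\<^sup>2)" for x :: "'a \<Rightarrow> real"
  have [measurable]: "q \<in> borel_measurable ?P" "r \<in> borel_measurable ?P"
    unfolding q_def[abs_def] r_def[abs_def] by measurable
  define F where "F w = h (w \<bullet> e - (\<Sum>b\<in>?A. k b * (w \<bullet> b)\<^sup>2)) *
      indicator {w. c * (\<Sum>b\<in>?A. (w \<bullet> b)\<^sup>2) < w \<bullet> e - (\<Sum>b\<in>?A. k b * (w \<bullet> b)\<^sup>2)} w" for w :: 'a
  have [measurable]: "F \<in> borel_measurable borel"
    unfolding F_def[abs_def] by measurable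
  have coord: "(\<Sum>b'\<in>Basis. x b' *\<^sub>R b') \<bullet> b = x b" if "b \<in> Basis" for x and b :: 'a
    using that by (simp add: inner_sum_left inner_Basis if_distrib sum.delta cong: if_cong)
  have "(\<integral>\<^sup>+w. F w \<partial>lborel) = (\<integral>\<^sup>+x. F (\<Sum>b\<in>Basis. x b *\<^sub>R b) \<partial>(\<Pi>\<^sub>M b\<in>Basis. lborel))"
    by (subst lborel_eq) (simp add: nn_integral_distr)
  also have "\<dots> = (\<integral>\<^sup>+x. (\<integral>\<^sup>+y. F (\<Sum>b\<in>Basis. (x(e := y)) b *\<^sub>R b) \<partial>lborel) \<partial>?P)"
    using product_nn_integral_insert[OF A(1,2), of "\<lambda>x. F (\<Sum>b\<in>Basis. x b *\<^sub>R b)"] unfolding A(3) by simp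
  also have "\<dots> = (\<integral>\<^sup>+x. (\<integral>\<^sup>+\<sigma>. h \<sigma> * indicator {0<..} \<sigma> * indicator {x. c * r x \<le> \<sigma>} x \<partial>lborel) \<partial>?P)"
  proof (rule nn_integral_cong)
    fix x :: "'a \<Rightarrow> real"
    have F: "F (\<Sum>b\<in>Basis. (x(e := y)) b *\<^sub>R b) = h (y - q x) * indicator {\<sigma>. c * r x < \<sigma>} (y - q x)" for y
    proof -
      have "(\<Sum>b\<in>?A. k b * ((\<Sum>b\<in>Basis. (x(e := y)) b *\<^sub>R b) \<bullet> b)\<^sup>2) = q x"
        "(\<Sum>b\<in>?A. ((\<Sum>b\<in>Basis. (x(e := y)) b *\<^sub>R b) \<bullet> b)\<^sup>2) = r x"
        unfolding q_def r_def by (intro sum.cong; simp only: coord DiffD1; simp)+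
      moreover have "(\<Sum>b\<in>Basis. (x(e := y)) b *\<^sub>R b) \<bullet> e = y" using coord[OF e, of "x(e := y)"] by simp
      ultimately show ?thesis unfolding F_def by (simp add: indicator_def)
    qed
    have r0: "0 \<le> c * r x" using c by (simp add: r_def sum_nonneg)
    have "(\<integral>\<^sup>+y. F (\<Sum>b\<in>Basis. (x(e := y)) b *\<^sub>R b) \<partial>lborel) = (\<integral>\<^sup>+y. h (y - q x) * indicator {\<sigma>. c * r x < \<sigma>} (y - q x) \<partial>lborel)"
      by (simp only: F)
    also have "\<dots> = (\<integral>\<^sup>+y. h (q x + y - q x) * indicator {\<sigma>. c * r x < \<sigma>} (q x + y - q x) \<partial>lborel)"
      by (rule nn_integral_lborel_shift[symmetric]) measurable
    \<comment> \<open>Strict and weak inequality differ at one value of \<sigma>; the weak one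
      matches the closed balls of the volume formula.\<close>
    also have "\<dots> = (\<integral>\<^sup>+\<sigma>. h \<sigma> * indicator {0<..} \<sigma> * indicator {x. c * r x \<le> \<sigma>} x \<partial>lborel)"
    proof (rule nn_integral_cong_AE)
      have "AE \<sigma> in lborel. \<sigma> \<noteq> c * r x" by (rule AE_lborel_singleton)
      then show "AE \<sigma> in lborel. h (q x + \<sigma> - q x) * indicator {\<sigma>. c * r x < \<sigma>} (q x + \<sigma> - q x) =
          h \<sigma> * indicator {0<..} \<sigma> * indicator {x. c * r x \<le> \<sigma>} x"
        by eventually_elim (use r0 in \<open>auto simp: indicator_def\<close>)
    qed
    finally show "(\<integral>\<^sup>+y. F (\<Sum>b\<in>Basis. (x(e := y)) b *\<^sub>R b) \<partial>lborel) =
      (\<integral>\<^sup>+\<sigma>. h \<sigma> * indicator {0<..} \<sigma> * indicator {x. c * r x \<le> \<sigma>} x \<partial>lborel)" .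
  qed
  also have "\<dots> = (\<integral>\<^sup>+\<sigma>. (\<integral>\<^sup>+x. h \<sigma> * indicator {0<..} \<sigma> * indicator {x. c * r x \<le> \<sigma>} x \<partial>?P) \<partial>lborel)"
    by (rule pair.Fubini'[symmetric]) measurable
  also have "\<dots> = (\<integral>\<^sup>+\<sigma>. ennreal (unit_ball_vol (real (DIM('a) - 1))) *
      (h \<sigma> * ennreal ((\<sigma> / c) powr (real (DIM('a) - 1) / 2)) * indicator {0<..} \<sigma>) \<partial>lborel)"
  proof (rule nn_integral_cong)
    fix \<sigma> :: real
    show "(\<integral>\<^sup>+x. h \<sigma> * indicator {0<..} \<sigma> * indicator {x. c * r x \<le> \<sigma>} x \<partial>?P) =
      ennreal (unit_ball_vol (real (DIM('a) - 1))) *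
      (h \<sigma> * ennreal ((\<sigma> / c) powr (real (DIM('a) - 1) / 2)) * indicator {0<..} \<sigma>)"
    proof (cases "0 < \<sigma>")
      case True
      have eq: "c * r x \<le> \<sigma> \<longleftrightarrow> sqrt (\<Sum>i\<in>?A. (x i)\<^sup>2) \<le> sqrt (\<sigma> / c)" for x
        using c by (simp add: r_def field_simps)
      have "(\<integral>\<^sup>+x. h \<sigma> * indicator {0<..} \<sigma> * indicator {x. c * r x \<le> \<sigma>} x \<partial>?P) =
          h \<sigma> * (\<integral>\<^sup>+x. indicator ({x. c * r x \<le> \<sigma>} \<inter> space ?P) x \<partial>?P)"
        using True by (subst nn_integral_cmult[symmetric]) (auto intro!: nn_integral_cong simp: indicator_def)
      also have "\<dots> = h \<sigma> * emeasure ?P ({x. sqrt (\<Sum>i\<in>?A. (x i)\<^sup>2) \<le> sqrt (\<sigma> / c)} \<inter> space ?P)"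
        unfolding eq by (subst nn_integral_indicator) auto
      also have "\<dots> = h \<sigma> * ennreal (unit_ball_vol (real (DIM('a) - 1)) * sqrt (\<sigma> / c) ^ (DIM('a) - 1))"
        using emeasure_cball_aux[OF A(1), of "sqrt (\<sigma> / c)"] True c by (simp add: A(4))
      also have "sqrt (\<sigma> / c) ^ (DIM('a) - 1) = (\<sigma> / c) powr (real (DIM('a) - 1) / 2)"
        using True c by (simp add: powr_half_sqrt[symmetric] powr_realpow[symmetric] powr_powr)
      finally show ?thesis using True by (simp add: ennreal_mult mult_ac)
    qed simp
  qed
  also have "\<dots> = ennreal (unit_ball_vol (real (DIM('a) - 1))) *
      (\<integral>\<^sup>+\<sigma>. h \<sigma> * ennreal ((\<sigma> / c) powr (real (DIM('a) - 1) / 2)) * indicator {0<..} \<sigma> \<partial>lborel)"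
    by (rule nn_integral_cmult) measurable
  finally show ?thesis unfolding F_def .
qed

lemma nn_integral_powr_exp_finite:
  assumes m: "0 \<le> m" and d: "0 < d"
  shows "(\<integral>\<^sup>+\<sigma>. ennreal (exp (- d * \<sigma>) * \<sigma> powr m) * indicator {0<..} \<sigma> \<partial>lborel) < \<infinity>"
proof -
  have 1: "(\<integral>\<^sup>+\<sigma>. ennreal (exp (- d * \<sigma>) * \<sigma> powr m) * indicator {0<..} \<sigma> \<partial>lborel) =
      ennreal \<bar>1 / d\<bar> * (\<integral>\<^sup>+s. ennreal (exp (- d * (0 + 1 / d * s)) * (0 + 1 / d * s) powr m) * indicator {0<..} (0 + 1 / d * s) \<partial>lborel)"
    using d by (intro nn_integral_real_affine) auto
  have "(\<integral>\<^sup>+s. ennreal (exp (- d * (0 + 1 / d * s)) * (0 + 1 / d * s) powr m) * indicator {0<..} (0 + 1 / d * s) \<partial>lborel)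
     \<le> (\<integral>\<^sup>+s. ennreal ((1 / d) powr m) * ennreal (indicator {0..} s * s powr (m + 1 - 1) / exp s) \<partial>lborel)"
  proof (rule nn_integral_mono)
    fix s :: real
    show "ennreal (exp (- d * (0 + 1 / d * s)) * (0 + 1 / d * s) powr m) * indicator {0<..} (0 + 1 / d * s)
       \<le> ennreal ((1 / d) powr m) * ennreal (indicator {0..} s * s powr (m + 1 - 1) / exp s)"
    proof (cases "0 < s")
      case True
      then have "exp (- d * (0 + 1 / d * s)) * (0 + 1 / d * s) powr m = (1 / d) powr m * (s powr m / exp s)"
        using d by (simp add: powr_divide exp_minus field_simps)
      then show ?thesis using True d by (simp add: ennreal_mult'[symmetric])
    next
      case False
      then have "\<not> 0 < 0 + 1 / d * s" using d by (simp add: not_less divide_nonpos_pos)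
      then show ?thesis by simp
    qed
  qed
  also have "\<dots> = ennreal ((1 / d) powr m) * ennreal (Gamma (m + 1))"
  proof -
    have "0 < m + 1" using m by simp
    show ?thesis
      unfolding Gamma_conv_nn_integral_real[OF \<open>0 < m + 1\<close>] by (rule nn_integral_cmult) measurable
  qed
  finally show ?thesis
    unfolding 1 by (auto simp: ennreal_mult_less_top top.not_eq_extremum intro: le_less_trans)
qed

section \<open>Moments of the complementary error function\<close>

definition erfc_moment :: "real \<Rightarrow> real \<Rightarrow> real" where
  "erfc_moment a m = (LBINT \<sigma>:{0..}. Erfc \<sigma> powr a * \<sigma> powr m)"

lemma erfc_moment_integrable:
  assumes "0 < a" "0 \<le> m"
  shows "integrable lborel (\<lambda>\<sigma>. indicator {0<..} \<sigma> * (Erfc \<sigma> powr a * \<sigma> powr m))"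
proof -
  define K where "K = (2 / sqrt pi * exp (1/4)) powr a"
  have bound: "Erfc \<sigma> powr a \<le> K * exp (- a * \<sigma>)" for \<sigma>
  proof -
    have "Erfc \<sigma> \<le> (2 / sqrt pi * exp (1/4)) * exp (- \<sigma>)"
    proof -
      have "exp (1/4 - \<sigma>) = exp (1/4) * exp (- \<sigma>)" by (simp add: exp_add[symmetric])
      then show ?thesis using Erfc_le_exp[of \<sigma>] by simp
    qed
    then have "Erfc \<sigma> powr a \<le> ((2 / sqrt pi * exp (1/4)) * exp (- \<sigma>)) powr a"
      using assms Erfc_nonneg by (intro powr_mono2) auto
    also have "\<dots> = K * exp (- a * \<sigma>)"
      by (subst powr_mult) (auto simp: K_def powr_def)
    finally show ?thesis .
  qed
  show ?thesis
  proof (rule integrableI_nonneg)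
    have "(\<integral>\<^sup>+\<sigma>. ennreal (indicator {0<..} \<sigma> * (Erfc \<sigma> powr a * \<sigma> powr m)) \<partial>lborel) \<le>
       (\<integral>\<^sup>+\<sigma>. ennreal K * (ennreal (exp (- a * \<sigma>) * \<sigma> powr m) * indicator {0<..} \<sigma>) \<partial>lborel)"
    proof (rule nn_integral_mono)
      fix \<sigma> :: real
      have "Erfc \<sigma> powr a * \<sigma> powr m \<le> K * (exp (- a * \<sigma>) * \<sigma> powr m)"
        using mult_right_mono[OF bound, of "\<sigma> powr m" \<sigma>] by (simp add: mult.assoc)
      then show "ennreal (indicator {0<..} \<sigma> * (Erfc \<sigma> powr a * \<sigma> powr m)) \<le>
         ennreal K * (ennreal (exp (- a * \<sigma>) * \<sigma> powr m) * indicator {0<..} \<sigma>)"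
        by (auto simp: indicator_def K_def ennreal_mult'[symmetric] intro!: ennreal_leI)
    qed
    also have "\<dots> = ennreal K * (\<integral>\<^sup>+\<sigma>. ennreal (exp (- a * \<sigma>) * \<sigma> powr m) * indicator {0<..} \<sigma> \<partial>lborel)"
      by (rule nn_integral_cmult) measurable
    also have "\<dots> < \<infinity>"
      using nn_integral_powr_exp_finite[OF assms(2,1)] by (simp add: ennreal_mult_less_top)
    finally show "(\<integral>\<^sup>+\<sigma>. ennreal (indicator {0<..} \<sigma> * (Erfc \<sigma> powr a * \<sigma> powr m)) \<partial>lborel) < \<infinity>" .
  qed (auto intro!: AE_I2)
qed

lemma erfc_moment_eq:
  "erfc_moment a m = (LINT \<sigma>|lborel. indicator {0<..} \<sigma> * (Erfc \<sigma> powr a * \<sigma> powr m))"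
  unfolding erfc_moment_def set_lebesgue_integral_def
proof (rule integral_cong_AE)
  have "AE \<sigma> in lborel. \<sigma> \<noteq> (0::real)" by (rule AE_lborel_singleton)
  then show "AE \<sigma> in lborel. indicator {0..} \<sigma> *\<^sub>R (Erfc \<sigma> powr a * \<sigma> powr m) = indicator {0<..} \<sigma> * (Erfc \<sigma> powr a * \<sigma> powr m)"
    by eventually_elim (auto simp: indicator_def)
qed auto

lemma erfc_moment_pos:
  assumes "0 < a" "0 \<le> m"
  shows "0 < erfc_moment a m"
proof -
  have "Erfc 2 powr a = (LINT \<sigma>|lborel. indicator {1..2::real} \<sigma> * Erfc 2 powr a)" by simp
  also have "\<dots> \<le> (LINT \<sigma>|lborel. indicator {0<..} \<sigma> * (Erfc \<sigma> powr a * \<sigma> powr m))"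
  proof (rule integral_mono)
    fix \<sigma> :: real
    show "indicator {1..2} \<sigma> * Erfc 2 powr a \<le> indicator {0<..} \<sigma> * (Erfc \<sigma> powr a * \<sigma> powr m)"
    proof (cases "\<sigma> \<in> {1..2}")
      case True
      have "Erfc 2 powr a * 1 \<le> Erfc \<sigma> powr a * \<sigma> powr m"
        using True assms Erfc_nonneg Erfc_antimono[of \<sigma> 2]
        by (intro mult_mono powr_mono2 ge_one_powr_ge_zero) auto
      then show ?thesis using True by simp
    next
      case False
      then have "indicator {1..2} \<sigma> = (0::real)" by simp
      then show ?thesis by simp
    qed
  qed (use erfc_moment_integrable[OF assms] in \<open>auto intro!: integrable_mult_left\<close>)
  finally show ?thesis
    unfolding erfc_moment_eq using Erfc_pos[of 2] by (metis less_le_trans powr_gt_zero less_irrefl)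
qed

lemma erfc_moment_nn_integral:
  assumes "0 < a" "0 \<le> m"
  shows "(\<integral>\<^sup>+\<sigma>. ennreal (Erfc \<sigma> powr a * \<sigma> powr m) * indicator {0<..} \<sigma> \<partial>lborel) = ennreal (erfc_moment a m)"
proof -
  have "(\<integral>\<^sup>+\<sigma>. ennreal (Erfc \<sigma> powr a * \<sigma> powr m) * indicator {0<..} \<sigma> \<partial>lborel) =
     (\<integral>\<^sup>+\<sigma>. ennreal (indicator {0<..} \<sigma> * (Erfc \<sigma> powr a * \<sigma> powr m)) \<partial>lborel)"
    by (intro nn_integral_cong) (auto simp: indicator_def)
  also have "\<dots> = ennreal (erfc_moment a m)"
    unfolding erfc_moment_eq by (rule nn_integral_eq_integral[OF erfc_moment_integrable[OF assms]]) auto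
  finally show ?thesis .
qed

lemma erfc_moment_scaled:
  assumes "0 < a" "0 \<le> m" and c: "0 < c"
  shows "(\<integral>\<^sup>+\<sigma>. ennreal (Erfc (\<sigma> / c) powr a) * ennreal (\<sigma> powr m) * indicator {0<..} \<sigma> \<partial>lborel) =
    ennreal (c powr (m + 1) * erfc_moment a m)"
proof -
  have "(\<integral>\<^sup>+\<sigma>. ennreal (Erfc (\<sigma> / c) powr a) * ennreal (\<sigma> powr m) * indicator {0<..} \<sigma> \<partial>lborel) =
    ennreal \<bar>c\<bar> * (\<integral>\<^sup>+s. ennreal (Erfc ((0 + c * s) / c) powr a) * ennreal ((0 + c * s) powr m) * indicator {0<..} (0 + c * s) \<partial>lborel)"
    using c by (intro nn_integral_real_affine) auto
  also have "(\<integral>\<^sup>+s. ennreal (Erfc ((0 + c * s) / c) powr a) * ennreal ((0 + c * s) powr m) * indicator {0<..} (0 + c * s) \<partial>lborel) =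
    (\<integral>\<^sup>+s. ennreal (c powr m) * (ennreal (Erfc s powr a * s powr m) * indicator {0<..} s) \<partial>lborel)"
    using c by (intro nn_integral_cong)
      (auto simp: indicator_def zero_less_mult_iff powr_mult ennreal_mult'[symmetric] ennreal_mult[symmetric] mult_ac)
  also have "\<dots> = ennreal (c powr m) * ennreal (erfc_moment a m)"
    by (subst nn_integral_cmult) (auto simp: erfc_moment_nn_integral[OF assms(1,2)])
  also have "ennreal \<bar>c\<bar> * \<dots> = ennreal (c * (c powr m * erfc_moment a m))"
    using c erfc_moment_pos[OF assms(1,2)] by (simp add: ennreal_mult'[symmetric] less_imp_le)
  also have "c * (c powr m * erfc_moment a m) = c powr (m + 1) * erfc_moment a m"
    using c by (simp add: powr_add)
  finally show ?thesis .
qed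

text \<open>Legendre's duplication formula at half-integers. From \<open>n\<close> to
  \<open>Suc n\<close> the second factor becomes the first, and the first becomes the second with a
  factor \<open>(n + 1) / 2\<close> from the functional equation.\<close>

lemma Gamma_duplication_nat:
  "Gamma ((real n + 1) / 2) * Gamma (real n / 2 + 1) = sqrt pi * fact n / 2 ^ n"
proof (induction n)
  case 0
  then show ?case by (simp add: Gamma_one_half_real)
next
  case (Suc n)
  have "Gamma ((real (Suc n) + 1) / 2) = Gamma (real n / 2 + 1)"
    by (rule arg_cong[of _ _ Gamma]) (simp add: field_simps)
  moreover have "Gamma (real (Suc n) / 2 + 1) = (real n + 1) / 2 * Gamma ((real n + 1) / 2)"
  proof -
    have "(real n + 1) / 2 \<notin> \<int>\<^sub>\<le>\<^sub>0" using nonpos_Ints_nonpos[of "(real n + 1) / 2"] by force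
    from Gamma_plus1[OF this] show ?thesis by (simp add: add.commute)
  qed
  ultimately have "Gamma ((real (Suc n) + 1) / 2) * Gamma (real (Suc n) / 2 + 1) =
      (real n + 1) / 2 * (Gamma ((real n + 1) / 2) * Gamma (real n / 2 + 1))" by simp
  also have "\<dots> = sqrt pi * fact (Suc n) / 2 ^ Suc n" unfolding Suc by (simp add: field_simps)
  finally show ?case .
qed

text \<open>The constant of the theorem, with \<open>\<alpha>\<close> the reciprocal of the conjugate exponent and \<open>\<rho>\<close> the
  product of the factors \<open>1 - R \<kappa>\<^sub>j\<close>.\<close>

lemma boundary_layer_constant:
  fixes n :: nat and R \<rho> \<alpha> I :: real
  assumes n: "1 \<le> n" and R: "0 < R" and \<rho>: "0 < \<rho>" and \<alpha>: "0 < \<alpha>"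
  shows "R powr ((real n + 1) / 2) * ((2 * R) powr ((real n - 1) / 2) * \<rho> powr (- 1 / 2) *
      (unit_ball_vol (real (n - 1)) * ((2 * sqrt \<alpha>) powr ((real n + 1) / 2) * I)) / (unit_ball_vol (real n) * R ^ n)) =
    fact n * I / (Gamma ((real n + 1) / 2))\<^sup>2 * ((1 / \<alpha>) powr ((real n + 1) / 2) * \<rho>) powr (- 1 / 2)"
proof -
  have G: "0 < Gamma ((real n + 1) / 2)" "0 < Gamma (real n / 2 + 1)" by (auto intro!: Gamma_real_pos)
  have v1: "unit_ball_vol (real (n - 1)) = pi powr ((real n - 1) / 2) / Gamma ((real n + 1) / 2)"
    using n by (simp add: unit_ball_vol_def of_nat_diff field_simps)
  have v2: "unit_ball_vol (real n) = pi powr (real n / 2) / Gamma (real n / 2 + 1)"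
    by (simp add: unit_ball_vol_def)
  have p: "pi powr ((real n - 1) / 2) = pi powr (real n / 2) / sqrt pi"
    by (simp add: diff_divide_distrib powr_diff powr_half_sqrt)
  have "sqrt \<alpha> = \<alpha> powr (1 / 2)" using \<alpha> by (simp add: powr_half_sqrt)
  then have a1: "(2 * sqrt \<alpha>) powr ((real n + 1) / 2) = 2 powr ((real n + 1) / 2) * \<alpha> powr ((real n + 1) / 4)"
    using \<alpha> by (simp add: powr_mult powr_powr)
  have a2: "((1 / \<alpha>) powr ((real n + 1) / 2) * \<rho>) powr (- 1 / 2) = \<alpha> powr ((real n + 1) / 4) * \<rho> powr (- 1 / 2)"
  proof -
    have "(1 / \<alpha>) powr ((real n + 1) / 2) = \<alpha> powr (- ((real n + 1) / 2))"
      using \<alpha> by (simp add: powr_minus_divide powr_divide)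
    then show ?thesis using \<alpha> \<rho> by (simp add: powr_mult powr_powr)
  qed
  have r1: "(2 * R) powr ((real n - 1) / 2) = 2 powr ((real n - 1) / 2) * R powr ((real n - 1) / 2)"
    using R by (simp add: powr_mult)
  have r2: "R powr ((real n + 1) / 2) * R powr ((real n - 1) / 2) = R ^ n"
    using R by (simp add: powr_add[symmetric] powr_realpow[symmetric] add_divide_distrib[symmetric])
  have t2: "(2::real) powr ((real n - 1) / 2) * 2 powr ((real n + 1) / 2) = 2 ^ n"
    by (simp add: powr_add[symmetric] powr_realpow[symmetric] add_divide_distrib[symmetric])
  \<comment> \<open>The origin of the factorial: the ball volumes in dimensions \<open>n\<close> and
    \<open>n - 1\<close> leave a quotient of two Gamma values, to which duplication applies.\<close>
  have dup: "Gamma (real n / 2 + 1) / sqrt pi * 2 ^ n = fact n / Gamma ((real n + 1) / 2)"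
  proof -
    define g1 g2 where "g1 = Gamma ((real n + 1) / 2)" and "g2 = Gamma (real n / 2 + 1)"
    have "g1 * g2 = sqrt pi * fact n / 2 ^ n" "0 < g1"
      using Gamma_duplication_nat[of n] G by (simp_all only: g1_def g2_def)
    then show ?thesis unfolding g1_def[symmetric] g2_def[symmetric] by (simp add: field_simps)
  qed
  let ?G1 = "Gamma ((real n + 1) / 2)" and ?G2 = "Gamma (real n / 2 + 1)"
  have "R powr ((real n + 1) / 2) * ((2 * R) powr ((real n - 1) / 2) * \<rho> powr (- 1 / 2) *
      (unit_ball_vol (real (n - 1)) * ((2 * sqrt \<alpha>) powr ((real n + 1) / 2) * I)) / (unit_ball_vol (real n) * R ^ n)) =
    (R powr ((real n + 1) / 2) * R powr ((real n - 1) / 2)) * (2 powr ((real n - 1) / 2) * 2 powr ((real n + 1) / 2))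
      * \<alpha> powr ((real n + 1) / 4) * \<rho> powr (- 1 / 2) * I
      * (pi powr (real n / 2) / sqrt pi / ?G1) / (pi powr (real n / 2) / ?G2) / R ^ n"
    unfolding a1 r1 v1 v2 p by (simp add: mult_ac)
  also have "\<dots> = (?G2 / sqrt pi * 2 ^ n) / ?G1 * I * (\<alpha> powr ((real n + 1) / 4) * \<rho> powr (- 1 / 2))"
    unfolding r2 t2 using R G by simp
  also have "\<dots> = fact n * I / ?G1\<^sup>2 * (\<alpha> powr ((real n + 1) / 4) * \<rho> powr (- 1 / 2))"
    unfolding dup by (simp add: power2_eq_square)
  finally show ?thesis unfolding a2 .
qed

section \<open>The boundary layer in a touching ball\<close>

locale touching_ball = curvature_frame \<Omega> y e g v \<kappa> J
  for \<Omega> :: "(real^'n) set" and y e :: "real^'n" and g v \<kappa> J +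
  fixes x :: "real^'n" and R :: real and p :: ereal and u :: "real^'n \<Rightarrow> real \<Rightarrow> real"
  assumes R: "0 < R" and touch: "cball x R \<inter> (UNIV - \<Omega>) = {y}"
    and curv: "\<And>j. j \<in> J \<Longrightarrow> \<kappa> j < 1 / R"
    and p: "1 < p" and sol: "bounded_viscosity_solution_01 p \<Omega> u"
begin

lemmas u_range = solution_range[OF p dim dom sol]

lemma center: "x = y + R *\<^sub>R e"
  by (rule centre_of_touching_ball[OF R touch])

lemma mem_ball_iff: "z \<in> ball x R \<longleftrightarrow> (norm (z - y))\<^sup>2 < 2 * R * ((z - y) \<bullet> e)"
  unfolding center using ball_translate_iff[OF unit, of z y R] R by simp

lemma ball_subset: "ball x R \<subseteq> \<Omega>"
proof
  fix z assume z: "z \<in> ball x R"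
  then have "z \<noteq> y" using mem_ball_iff by auto
  moreover have "z \<in> cball x R" using z by auto
  ultimately show "z \<in> \<Omega>" using touch by blast
qed

lemma continuous_u: "continuous_on (\<Omega> \<times> {0..} \<union> frontier \<Omega> \<times> {0<..}) (\<lambda>(z, t). u z t)"
  using sol by (simp add: bounded_viscosity_solution_01_def)

lemma continuous_on_slice:
  assumes "0 < t"
  shows "continuous_on (\<Omega> \<union> frontier \<Omega>) (\<lambda>z. u z t)"
proof -
  have "continuous_on (\<Omega> \<union> frontier \<Omega>) (\<lambda>z. (\<lambda>(z, t). u z t) (z, t))"
    by (rule continuous_on_compose2[OF continuous_u, of _ "\<lambda>z. (z, t)"]) (use assms in \<open>auto intro!: continuous_intros\<close>)
  then show ?thesis by simp
qed

lemma initial_limit: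
  assumes "z \<in> \<Omega>"
  shows "((\<lambda>t. u z t) \<longlongrightarrow> 0) (at_right 0)"
proof -
  have "continuous_on {0..} (\<lambda>t. (\<lambda>(z, t). u z t) (z, t))"
    by (rule continuous_on_compose2[OF continuous_u, of _ "\<lambda>t. (z, t)"]) (use assms in \<open>auto intro!: continuous_intros\<close>)
  then have "((\<lambda>t. u z t) \<longlongrightarrow> u z 0) (at 0 within {0..})" by (simp add: continuous_on_def)
  moreover have "u z 0 = 0" using sol assms by (simp add: bounded_viscosity_solution_01_def)
  moreover have "at (0::real) within {0..} = at_right 0" by (rule at_within_nhd[of _ UNIV]) auto
  ultimately show ?thesis by simp
qed

text \<open>In \<open>ball x R\<close> the squared distance to \<open>y\<close> is below
  \<open>2 R d\<close>, where \<open>d = (z - y) \<bullet> e\<close>. The barrier of the larger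
  tangent ball of radius \<open>R'\<close> therefore sees a depth of at least
  \<open>d (1 - R / R')\<close>; the strict inequality \<open>R < R'\<close> is what makes this a
  decay in \<open>d / sqrt t\<close>.\<close>

lemma exponential_bound:
  obtains c C where "0 < c" "0 < C"
    "\<And>z t. z \<in> ball x R \<Longrightarrow> 0 < t \<Longrightarrow> u z t \<le> C * exp (C * sqrt t - c * (((z - y) \<bullet> e) / sqrt t))"
proof -
  define \<alpha> where "\<alpha> = normal_coeff p"
  have \<alpha>: "0 < \<alpha>" unfolding \<alpha>_def by (rule normal_coeff_bounds[OF p])
  obtain R' where R': "R < R'" "ball (y + R' *\<^sub>R e) R' \<subseteq> \<Omega>"
    using larger_interior_ball[OF R touch curv] by metis
  have R'0: "0 < R'" using R R' by simp
  define c where "c = (1 - R / R') / (2 * sqrt \<alpha>)"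
  define D where "D = real CARD('n) / R' / (2 * sqrt \<alpha>)"
  define C where "C = max D (2 / sqrt pi * exp (1/4))"
  have c: "0 < c" using R R' R'0 \<alpha> by (simp add: c_def)
  have C: "0 < C" "D \<le> C" "2 / sqrt pi * exp (1/4) \<le> C" by (auto simp: C_def less_max_iff_disj)
  have "u z t \<le> C * exp (C * sqrt t - c * (((z - y) \<bullet> e) / sqrt t))" if z: "z \<in> ball x R" and t: "0 < t" for z t
  proof -
    define d where "d = (z - y) \<bullet> e"
    have z\<Omega>: "z \<in> \<Omega>" using z ball_subset by blast
    have q: "(norm (z - y))\<^sup>2 < 2 * R * d" using z unfolding mem_ball_iff d_def .
    have n: "(norm (z - (y + R' *\<^sub>R e)))\<^sup>2 = (norm (z - y))\<^sup>2 - 2 * R' * d + R'\<^sup>2"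
      using dot_norm_neg[of "z - y" "R' *\<^sub>R e"] unit by (simp add: diff_diff_eq d_def)
    have "d * (1 - R / R') = (2 * R' * d - 2 * R * d) / (2 * R')" using R'0 by (simp add: field_simps)
    also have "\<dots> \<le> (R'\<^sup>2 - (norm (z - (y + R' *\<^sub>R e)))\<^sup>2) / (2 * R')"
      using q n R'0 by (intro divide_right_mono) auto
    finally have ge: "d * (1 - R / R') - real CARD('n) * t / R' \<le> (R'\<^sup>2 - (norm (z - (y + R' *\<^sub>R e)))\<^sup>2) / (2 * R') - real CARD('n) * t / R'"
      by simp
    have arg: "(d * (1 - R / R') - real CARD('n) * t / R') / (2 * sqrt (\<alpha> * t)) = c * (d / sqrt t) - D * sqrt t"
    proof -
      obtain s where s: "s > 0" "t = s * s" using t by (metis real_sqrt_gt_zero real_sqrt_mult_self abs_of_pos)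
      have "sqrt t = s" using s by simp
      then show ?thesis using s R'0 \<alpha> by (simp add: c_def D_def real_sqrt_mult) (simp add: field_simps)
    qed
    have "u z t \<le> Erfc (((R'\<^sup>2 - (norm (z - (y + R' *\<^sub>R e)))\<^sup>2) / (2 * R') - real CARD('n) * t / R') / (2 * sqrt (\<alpha> * t)))"
      unfolding \<alpha>_def by (rule solution_upper_bound[OF p dim dom sol R'(2) R'0 z\<Omega> t])
    also have "\<dots> \<le> Erfc (c * (d / sqrt t) - D * sqrt t)"
      unfolding arg[symmetric] using ge \<alpha> t by (intro Erfc_antimono divide_right_mono) auto
    also have "\<dots> \<le> 2 / sqrt pi * exp (1/4 - (c * (d / sqrt t) - D * sqrt t))" by (rule Erfc_le_exp)
    also have "\<dots> = (2 / sqrt pi * exp (1/4)) * exp (D * sqrt t - c * (d / sqrt t))"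
      by (simp add: exp_add[symmetric] algebra_simps)
    also have "\<dots> \<le> C * exp (C * sqrt t - c * (d / sqrt t))"
      using C t by (intro mult_mono) (auto intro!: mult_right_mono)
    finally show ?thesis unfolding d_def .
  qed
  then show thesis using that c C(1) by blast
qed

text \<open>In the coordinates \<open>z = y + t\<^sup>1\<^sup>/\<^sup>4 \<zeta> + t\<^sup>1\<^sup>/\<^sup>2 \<eta> e\<close> the ball becomes the paraboloid
  \<open>\<eta> > |\<zeta>|\<^sup>2 / (2 R)\<close> and \<open>\<Gamma>\<close> the graph of half the second fundamental form; the tangential
  coordinates are normalised such that the difference of the two quadratic forms is the identity.\<close>

lemma scaled_integral_limit:
  fixes a :: real and \<tau> \<epsilon> :: "nat \<Rightarrow> real"
  assumes a: "0 < a" and \<tau>: "\<And>k. 0 < \<tau> k" "\<tau> \<longlonglongrightarrow> 0" and \<epsilon>: "\<And>k. 0 \<le> \<epsilon> k" "\<epsilon> \<longlonglongrightarrow> 0"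
  shows "(\<lambda>k. \<tau> k powr (- ((real CARD('n) + 1) / 4)) * (LINT z|lebesgue_on (ball x R). pos_powr a (u z (\<tau> k) - \<epsilon> k)))
    \<longlonglongrightarrow> (\<Prod>j\<in>J. sqrt (2 / (1 / R - \<kappa> j))) *
      (unit_ball_vol (real (CARD('n) - 1)) *
        ((2 * sqrt (normal_coeff p)) powr ((real CARD('n) + 1) / 2) * erfc_moment a ((real CARD('n) - 1) / 2)))"
proof -
  define n where "n = CARD('n)"
  have n: "2 \<le> n" using dim by (simp add: n_def)
  define \<alpha> where "\<alpha> = normal_coeff p"
  have \<alpha>: "0 < \<alpha>" unfolding \<alpha>_def by (rule normal_coeff_bounds[OF p])
  have DIM: "DIM(real^'n) = n" by (simp add: n_def)
  \<comment> \<open>The coordinate along \<open>b0\<close> plays the normal direction; \<pi> assigns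
    the remaining basis vectors to the principal directions.\<close>
  obtain b0 :: "real^'n" where b0: "b0 \<in> Basis" using nonempty_Basis by blast
  let ?A = "Basis - {b0} :: (real^'n) set"
  have finA: "finite ?A" by simp
  have cardA: "card ?A = card J" using b0 DIM by (simp add: card_J n_def)
  obtain \<pi> where \<pi>: "bij_betw \<pi> ?A J" using finite_same_card_bij[OF finA finite_J cardA] by blast
  have \<pi>J: "\<pi> b \<in> J" if "b \<in> ?A" for b using \<pi> that by (rule bij_betwE[rule_format])
  \<comment> \<open>The solution of \<open>(1 / R - \<kappa> j) * (A j)^2 / 2 = 1\<close>.\<close>
  define A where "A j = sqrt (2 / (1 / R - \<kappa> j))" for j
  have A: "0 < A j" "(A j)\<^sup>2 = 2 / (1 / R - \<kappa> j)" if "j \<in> J" for j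
    using curv[OF that] by (auto simp: A_def)
  have A2: "(A j)\<^sup>2 / (2 * R) = 1 + \<kappa> j * (A j)\<^sup>2 / 2" if "j \<in> J" for j
  proof -
    define d where "d = 1 / R - \<kappa> j"
    have d: "d \<noteq> 0" "(A j)\<^sup>2 = 2 / d" "1 / R = d + \<kappa> j"
      using curv[OF that] A(2)[OF that] by (auto simp: d_def)
    have "(A j)\<^sup>2 / (2 * R) = (A j)\<^sup>2 / 2 * (1 / R)" by simp
    also have "\<dots> = 1 + \<kappa> j * (A j)\<^sup>2 / 2" unfolding d(2,3) using d(1) by (simp add: field_simps)
    finally show ?thesis .
  qed
  define V where "V b = (if b = b0 then e else v (\<pi> b))" for b
  have V: "V b \<bullet> V c = (if b = c then 1 else 0)" if "b \<in> Basis" "c \<in> Basis" for b c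
  proof -
    have "\<pi> b = \<pi> c \<longleftrightarrow> b = c" if "b \<in> ?A" "c \<in> ?A" for b c
      using \<pi> that by (auto simp: bij_betw_def inj_on_def)
    moreover have "e \<bullet> v (\<pi> b) = 0" "v (\<pi> b) \<bullet> e = 0" if "b \<in> ?A" for b
      using ve[OF \<pi>J[OF that]] by (simp_all add: inner_commute)
    moreover have "v (\<pi> b) \<bullet> v (\<pi> c) = (if \<pi> b = \<pi> c then 1 else 0)" if "b \<in> ?A" "c \<in> ?A" for b c
      by (rule vv[OF \<pi>J[OF that(1)] \<pi>J[OF that(2)]])
    ultimately show ?thesis
      using that ee by (simp add: V_def)
  qed
  define s where "s t b = (if b = b0 then sqrt t else t powr (1/4) * A (\<pi> b))" for t b
  have s_pos: "0 < s t b" if "0 < t" "b \<in> Basis" for t b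
    using that A(1)[OF \<pi>J] by (auto simp: s_def)
  define Z where "Z t w = y + (\<Sum>b\<in>Basis. (s t b * (w \<bullet> b)) *\<^sub>R V b)" for t w
  define \<zeta> where "\<zeta> w = (\<Sum>b\<in>?A. (A (\<pi> b) * (w \<bullet> b)) *\<^sub>R v (\<pi> b))" for w
  have Z: "Z t w = y + t powr (1/4) *\<^sub>R \<zeta> w + (sqrt t * (w \<bullet> b0)) *\<^sub>R e" for t w
  proof -
    have "(\<Sum>b\<in>Basis. (s t b * (w \<bullet> b)) *\<^sub>R V b) = (s t b0 * (w \<bullet> b0)) *\<^sub>R V b0 + (\<Sum>b\<in>?A. (s t b * (w \<bullet> b)) *\<^sub>R V b)"
      using b0 by (intro sum.remove) auto
    moreover have "(\<Sum>b\<in>?A. (s t b * (w \<bullet> b)) *\<^sub>R V b) = t powr (1/4) *\<^sub>R \<zeta> w"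
      unfolding \<zeta>_def scaleR_sum_right by (intro sum.cong) (auto simp: s_def V_def mult.assoc)
    ultimately show ?thesis by (simp add: Z_def s_def V_def)
  qed
  have \<zeta>e: "\<zeta> w \<bullet> e = 0" for w
    using ve[OF \<pi>J] by (simp add: \<zeta>_def inner_sum_left)
  have \<zeta>v: "\<zeta> w \<bullet> v (\<pi> b) = A (\<pi> b) * (w \<bullet> b)" if b: "b \<in> ?A" for w b
  proof -
    have "\<zeta> w \<bullet> v (\<pi> b) = (\<Sum>c\<in>?A. if c = b then A (\<pi> b) * (w \<bullet> b) else 0)"
      unfolding \<zeta>_def inner_sum_left
    proof (rule sum.cong[OF refl])
      fix c assume c: "c \<in> ?A"
      have "\<pi> c = \<pi> b \<longleftrightarrow> c = b" using \<pi> b c by (auto simp: bij_betw_def inj_on_def)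
      then show "(A (\<pi> c) * (w \<bullet> c)) *\<^sub>R v (\<pi> c) \<bullet> v (\<pi> b) = (if c = b then A (\<pi> b) * (w \<bullet> b) else 0)"
        using vv[OF \<pi>J[OF c] \<pi>J[OF b]] by auto
    qed
    then show ?thesis using b finA by simp
  qed
  have reindex: "(\<Sum>j\<in>J. f j * (\<zeta> w \<bullet> v j)\<^sup>2) = (\<Sum>b\<in>?A. f (\<pi> b) * (A (\<pi> b))\<^sup>2 * (w \<bullet> b)\<^sup>2)" for f :: "nat \<Rightarrow> real" and w
  proof -
    have "(\<Sum>j\<in>J. f j * (\<zeta> w \<bullet> v j)\<^sup>2) = (\<Sum>b\<in>?A. f (\<pi> b) * (\<zeta> w \<bullet> v (\<pi> b))\<^sup>2)"
      by (rule sum.reindex_bij_betw[OF \<pi>, symmetric])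
    also have "\<dots> = (\<Sum>b\<in>?A. f (\<pi> b) * (A (\<pi> b))\<^sup>2 * (w \<bullet> b)\<^sup>2)"
      by (intro sum.cong refl) (simp add: \<zeta>v power_mult_distrib)
    finally show ?thesis .
  qed
  define k where "k b = \<kappa> (\<pi> b) * (A (\<pi> b))\<^sup>2 / 2" for b
  \<comment> \<open>In scaled coordinates the frontier tends to the graph of \<open>q\<close> and
    the sphere to that of \<open>q + r\<close>; thus \<open>w \<bullet> b0 - q w\<close> is the
    limit of the scaled height above the frontier.\<close>
  define q where "q w = (\<Sum>b\<in>?A. k b * (w \<bullet> b)\<^sup>2)" for w
  define r where "r w = (\<Sum>b\<in>?A. (w \<bullet> b)\<^sup>2)" for w
  have q_eq: "(\<Sum>j\<in>J. \<kappa> j * (\<zeta> w \<bullet> v j)\<^sup>2) / 2 = q w" for w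
    unfolding reindex q_def k_def sum_divide_distrib by (intro sum.cong) auto
  have norm_\<zeta>: "(norm (\<zeta> w))\<^sup>2 = 2 * R * (q w + r w)" for w
  proof -
    have "(norm (\<zeta> w))\<^sup>2 = (\<Sum>b\<in>?A. (A (\<pi> b))\<^sup>2 * (w \<bullet> b)\<^sup>2)"
      using norm_frame[OF \<zeta>e, of w] reindex[of "\<lambda>_. 1" w] by simp
    also have "\<dots> = (\<Sum>b\<in>?A. 2 * R * (k b * (w \<bullet> b)\<^sup>2 + (w \<bullet> b)\<^sup>2))"
    proof (rule sum.cong[OF refl])
      fix b assume "b \<in> ?A"
      from A2[OF \<pi>J[OF this]] have "(A (\<pi> b))\<^sup>2 = 2 * R * (k b + 1)" using R by (simp add: k_def field_simps)
      then show "(A (\<pi> b))\<^sup>2 * (w \<bullet> b)\<^sup>2 = 2 * R * (k b * (w \<bullet> b)\<^sup>2 + (w \<bullet> b)\<^sup>2)" by (simp add: algebra_simps)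
    qed
    also have "\<dots> = 2 * R * (q w + r w)" by (simp only: q_def r_def sum.distrib[symmetric] sum_distrib_left)
    finally show ?thesis .
  qed
  have quarter: "(t powr (1/4))\<^sup>2 = sqrt t" if "0 < t" for t :: real
    using that by (simp add: powr_half_sqrt[symmetric] powr_powr powr_realpow[symmetric])
  have Ze: "(Z t w - y) \<bullet> e = sqrt t * (w \<bullet> b0)" for t w
    using \<zeta>e ee by (simp add: Z inner_add_left)
  have Zn: "(norm (Z t w - y))\<^sup>2 = sqrt t * (2 * R * (q w + r w)) + t * (w \<bullet> b0)\<^sup>2" if "0 < t" for t w
  proof -
    have "(norm (Z t w - y))\<^sup>2 = (t powr (1/4))\<^sup>2 * (norm (\<zeta> w))\<^sup>2 + (sqrt t)\<^sup>2 * (w \<bullet> b0)\<^sup>2"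
      unfolding power2_norm_eq_inner using \<zeta>e[of w] ee inner_commute[of e "\<zeta> w"]
      by (simp add: Z inner_add_left inner_add_right power2_eq_square)
    then show ?thesis using that by (simp add: quarter norm_\<zeta>)
  qed
  have Z_ball: "Z t w \<in> ball x R \<longleftrightarrow> 2 * R * (q w + r w) + sqrt t * (w \<bullet> b0)\<^sup>2 < 2 * R * (w \<bullet> b0)" if t: "0 < t" for t w
  proof -
    have st: "0 < sqrt t" "t = sqrt t * sqrt t" using t by auto
    have t2: "t * (w \<bullet> b0)\<^sup>2 = sqrt t * (sqrt t * (w \<bullet> b0)\<^sup>2)" using st(2) by (metis mult.assoc)
    have "Z t w \<in> ball x R \<longleftrightarrow> sqrt t * (2 * R * (q w + r w) + sqrt t * (w \<bullet> b0)\<^sup>2) < sqrt t * (2 * R * (w \<bullet> b0))"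
      unfolding mem_ball_iff Zn[OF t] Ze t2
      by (simp only: distrib_left mult.left_commute[of "2 * R" "sqrt t"])
    then show ?thesis unfolding mult_less_cancel_left_pos[OF st(1)] .
  qed
  define B where "B = ball x R"
  define F where "F i z = indicator B z * pos_powr a (u z (\<tau> i) - \<epsilon> i)" for i z
  have F_meas [measurable]: "F i \<in> borel_measurable borel" for i
  proof -
    have "continuous_on B (\<lambda>z. pos_powr a (u z (\<tau> i) - \<epsilon> i))"
      using ball_subset by (intro continuous_intros a continuous_on_subset[OF continuous_on_slice[OF \<tau>(1)]]) (auto simp: B_def)
    then have "(\<lambda>z. indicator B z *\<^sub>R pos_powr a (u z (\<tau> i) - \<epsilon> i)) \<in> borel_measurable borel"
      by (intro borel_measurable_continuous_on_indicator) (auto simp: B_def)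
    then show ?thesis by (simp add: F_def[abs_def])
  qed
  have F_nonneg: "0 \<le> F i z" for i z by (simp add: F_def)
  have Z_meas [measurable]: "Z t \<in> borel_measurable borel" for t
    unfolding Z_def[abs_def] by measurable
  define P where "P = (\<Prod>j\<in>J. A j)"
  have prod_s: "(\<Prod>b\<in>Basis. s t b) = t powr ((real n + 1) / 4) * P" if t: "0 < t" for t
  proof -
    have "(\<Prod>b\<in>Basis. s t b) = s t b0 * (\<Prod>b\<in>?A. s t b)" using b0 by (intro prod.remove) auto
    also have "(\<Prod>b\<in>?A. s t b) = (\<Prod>b\<in>?A. t powr (1/4) * A (\<pi> b))" by (intro prod.cong) (auto simp: s_def)
    also have "\<dots> = (t powr (1/4)) ^ (n - 1) * (\<Prod>b\<in>?A. A (\<pi> b))"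
      using cardA by (simp add: prod.distrib card_J n_def)
    also have "(\<Prod>b\<in>?A. A (\<pi> b)) = P" unfolding P_def by (rule prod.reindex_bij_betw[OF \<pi>])
    also have "(t powr (1/4)) ^ (n - 1) = t powr ((real n - 1) / 4)"
      using t n by (simp add: powr_realpow[symmetric] powr_powr of_nat_diff)
    also have "s t b0 = t powr (1/2)" using t by (simp add: s_def powr_half_sqrt)
    also have "t powr (1/2) * (t powr ((real n - 1) / 4) * P) = t powr (1/2 + (real n - 1) / 4) * P" by (simp add: powr_add)
    also have "1/2 + (real n - 1) / 4 = (real n + 1) / 4" by (simp add: field_simps)
    finally show ?thesis .
  qed
  have P: "0 < P" unfolding P_def using A(1) by (intro prod_pos) auto
  have transform: "\<tau> i powr (- ((real n + 1) / 4)) * (LINT z|lebesgue_on B. pos_powr a (u z (\<tau> i) - \<epsilon> i)) =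
      P * (LINT w|lborel. F i (Z (\<tau> i) w))" for i
  proof -
    have "(LINT z|lebesgue_on B. pos_powr a (u z (\<tau> i) - \<epsilon> i)) = (LINT z|lebesgue. indicator B z *\<^sub>R pos_powr a (u z (\<tau> i) - \<epsilon> i))"
      by (rule integral_restrict_space) (simp add: B_def)
    also have "\<dots> = (LINT z|lborel. F i z)"
      unfolding F_def[symmetric] real_scaleR_def by (rule integral_completion) simp
    also have "\<dots> = enn2real (\<integral>\<^sup>+z. ennreal (F i z) \<partial>lborel)"
      by (rule integral_eq_nn_integral) (auto simp: F_nonneg)
    also have "(\<integral>\<^sup>+z. ennreal (F i z) \<partial>lborel) = ennreal (\<Prod>b\<in>Basis. s (\<tau> i) b) *
        (\<integral>\<^sup>+w. ennreal (F i (y + (\<Sum>b\<in>Basis. (s (\<tau> i) b * (w \<bullet> b)) *\<^sub>R V b))) \<partial>lborel)"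
      by (rule nn_integral_lborel_frame[OF V s_pos[OF \<tau>(1)]]) auto
    also have "enn2real \<dots> = (\<tau> i powr ((real n + 1) / 4) * P) * enn2real (\<integral>\<^sup>+w. ennreal (F i (Z (\<tau> i) w)) \<partial>lborel)"
      unfolding prod_s[OF \<tau>(1)] Z_def[symmetric] using P by (simp add: enn2real_mult)
    also have "enn2real (\<integral>\<^sup>+w. ennreal (F i (Z (\<tau> i) w)) \<partial>lborel) = (LINT w|lborel. F i (Z (\<tau> i) w))"
      by (rule integral_eq_nn_integral[symmetric]) (auto simp: F_nonneg)
    finally show ?thesis using \<tau>(1)[of i] by (simp add: powr_minus field_simps)
  qed
  define G where "G w = indicator {w. 1 * r w < w \<bullet> b0 - q w} w * Erfc ((w \<bullet> b0 - q w) / (2 * sqrt \<alpha>)) powr a" for w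
  have qr_meas [measurable]: "q \<in> borel_measurable borel" "r \<in> borel_measurable borel"
    unfolding q_def[abs_def] r_def[abs_def] by measurable
  have G_meas [measurable]: "G \<in> borel_measurable borel"
    unfolding G_def[abs_def] by measurable
  have lim_sqrt: "(\<lambda>i. sqrt (\<tau> i)) \<longlonglongrightarrow> 0" using tendsto_real_sqrt[OF \<tau>(2)] by simp
  have lim_quarter: "(\<lambda>i. \<tau> i powr (1/4)) \<longlonglongrightarrow> 0"
    using tendsto_powr'[OF \<tau>(2) tendsto_const, of "1/4"] \<tau>(1) by (simp add: less_imp_le)
  have pointwise: "(\<lambda>i. F i (Z (\<tau> i) w)) \<longlonglongrightarrow> G w" for w
  proof (cases "r w < w \<bullet> b0 - q w")
    \<comment> \<open>The correction \<open>sqrt t (w \<bullet> b0)^2\<close> is nonnegative, so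
      points outside or exactly on the limit paraboloid never enter the ball.\<close>
    case False
    have "F i (Z (\<tau> i) w) = 0" for i
    proof -
      have "2 * R * (w \<bullet> b0) \<le> 2 * R * (q w + r w)" using False R by (intro mult_left_mono) auto
      moreover have "0 \<le> sqrt (\<tau> i) * (w \<bullet> b0)\<^sup>2" using \<tau>(1)[of i] by simp
      ultimately have "Z (\<tau> i) w \<notin> B" unfolding B_def Z_ball[OF \<tau>(1)] by linarith
      then show ?thesis by (simp add: F_def)
    qed
    moreover have "G w = 0" using False by (simp add: G_def)
    ultimately show ?thesis by simp
  next
    case True
    have "(\<lambda>i. 2 * R * (q w + r w) + sqrt (\<tau> i) * (w \<bullet> b0)\<^sup>2) \<longlonglongrightarrow> 2 * R * (q w + r w) + 0 * (w \<bullet> b0)\<^sup>2"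
      by (intro tendsto_intros lim_sqrt)
    moreover have "2 * R * (q w + r w) + 0 * (w \<bullet> b0)\<^sup>2 < 2 * R * (w \<bullet> b0)" using True R by simp
    ultimately have "\<forall>\<^sub>F i in sequentially. 2 * R * (q w + r w) + sqrt (\<tau> i) * (w \<bullet> b0)\<^sup>2 < 2 * R * (w \<bullet> b0)"
      by (rule order_tendstoD(2))
    then have evB: "\<forall>\<^sub>F i in sequentially. Z (\<tau> i) w \<in> B"
      unfolding B_def by eventually_elim (simp only: Z_ball[OF \<tau>(1)])
    then have ev\<Omega>: "\<forall>\<^sub>F i in sequentially. Z (\<tau> i) w \<in> \<Omega>"
      by eventually_elim (use ball_subset in \<open>auto simp: B_def\<close>)
    have "(\<lambda>i. y + \<tau> i powr (1/4) *\<^sub>R \<zeta> w + (sqrt (\<tau> i) * (w \<bullet> b0)) *\<^sub>R e) \<longlonglongrightarrow> y + 0 *\<^sub>R \<zeta> w + (0 * (w \<bullet> b0)) *\<^sub>R e"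
      by (intro tendsto_intros lim_sqrt lim_quarter)
    then have limZ: "(\<lambda>i. Z (\<tau> i) w) \<longlonglongrightarrow> y" by (simp add: Z)
    have pZ: "hyperplane_proj e (Z t w) = hyperplane_proj e y + t powr (1/4) *\<^sub>R \<zeta> w" for t
      using \<zeta>e ee by (simp add: Z hyperplane_proj_def inner_add_left algebra_simps)
    have "0 < \<tau> i powr (1/4)" for i using \<tau>(1)[of i] by simp
    then have "filterlim (\<lambda>i. \<tau> i powr (1/4)) (at_right 0) sequentially"
      unfolding filterlim_at using lim_quarter by (auto intro!: always_eventually simp: less_imp_neq[symmetric])
    from filterlim_compose[OF graph_along_ray[OF \<zeta>e] this, unfolded quarter[OF \<tau>(1)] q_eq]
    have "(\<lambda>i. (g (hyperplane_proj e y + \<tau> i powr (1/4) *\<^sub>R \<zeta> w) - g (hyperplane_proj e y)) / sqrt (\<tau> i)) \<longlonglongrightarrow> q w" .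
    from tendsto_diff[OF tendsto_const[of "w \<bullet> b0"] this]
    have lim_q: "(\<lambda>i. w \<bullet> b0 - (g (hyperplane_proj e y + \<tau> i powr (1/4) *\<^sub>R \<zeta> w) - g (hyperplane_proj e y)) / sqrt (\<tau> i)) \<longlonglongrightarrow> w \<bullet> b0 - q w" .
    moreover have "w \<bullet> b0 - (g (hyperplane_proj e y + \<tau> i powr (1/4) *\<^sub>R \<zeta> w) - g (hyperplane_proj e y)) / sqrt (\<tau> i) =
        (Z (\<tau> i) w \<bullet> e - g (hyperplane_proj e (Z (\<tau> i) w))) / sqrt (\<tau> i)" for i
    proof -
      have "Z (\<tau> i) w \<bullet> e = g (hyperplane_proj e y) + sqrt (\<tau> i) * (w \<bullet> b0)"
        using Ze[of "\<tau> i" w] y_graph by (simp add: inner_diff_left)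
      then show ?thesis unfolding pZ using \<tau>(1)[of i] by (simp add: field_simps)
    qed
    ultimately have "(\<lambda>i. (Z (\<tau> i) w \<bullet> e - g (hyperplane_proj e (Z (\<tau> i) w))) / sqrt (\<tau> i)) \<longlonglongrightarrow> w \<bullet> b0 - q w" by simp
    from solution_boundary_layer[OF p dim dom sol gr yfr normal_at \<tau>(2) always_eventually limZ ev\<Omega> this] \<tau>(1)
    have "(\<lambda>i. u (Z (\<tau> i) w) (\<tau> i)) \<longlonglongrightarrow> Erfc ((w \<bullet> b0 - q w) / (2 * sqrt \<alpha>))" by (simp add: \<alpha>_def)
    from tendsto_pos_powr[OF a tendsto_diff[OF this \<epsilon>(2)]]
    have "(\<lambda>i. pos_powr a (u (Z (\<tau> i) w) (\<tau> i) - \<epsilon> i)) \<longlonglongrightarrow> G w"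
      using True Erfc_nonneg by (simp add: G_def)
    moreover have "\<forall>\<^sub>F i in sequentially. pos_powr a (u (Z (\<tau> i) w) (\<tau> i) - \<epsilon> i) = F i (Z (\<tau> i) w)"
      using evB by eventually_elim (simp add: F_def)
    ultimately show ?thesis by (rule Lim_transform_eventually)
  qed
  obtain c C where c: "0 < c" "0 < C"
    "\<And>z t. z \<in> ball x R \<Longrightarrow> 0 < t \<Longrightarrow> u z t \<le> C * exp (C * sqrt t - c * (((z - y) \<bullet> e) / sqrt t))"
    using exponential_bound by metis
  obtain S where S: "\<And>i. sqrt (\<tau> i) \<le> S"
    using convergent_imp_Bseq[OF convergentI[OF lim_sqrt]] unfolding Bseq_def by (auto simp: abs_le_iff)
  define K where "K = (C * exp (C * S)) powr a"
  have Jne: "J \<noteq> {}" using dim by (simp add: J)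
  \<comment> \<open>\<open>q\<close> may take negative values, so it gives no control by itself;
    \<open>q + r\<close>, the form of the sphere, is positive definite and bounds \<open>r\<close>
    with the constant \<open>c1\<close>.\<close>
  define c1 where "c1 = Min ((\<lambda>j. (A j)\<^sup>2 / (2 * R)) ` J)"
  have c1: "0 < c1" "\<And>j. j \<in> J \<Longrightarrow> c1 \<le> (A j)\<^sup>2 / (2 * R)"
  proof -
    have "0 < (A j)\<^sup>2 / (2 * R)" if "j \<in> J" for j using A(1)[OF that] R by simp
    then show "0 < c1" unfolding c1_def using Jne by auto
    show "c1 \<le> (A j)\<^sup>2 / (2 * R)" if "j \<in> J" for j
      unfolding c1_def using that by (intro Min_le) auto
  qed
  have qr: "c1 * r w \<le> q w + r w" for w
  proof -
    have "c1 * r w = (\<Sum>b\<in>?A. c1 * (w \<bullet> b)\<^sup>2)" by (simp add: r_def sum_distrib_left)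
    also have "\<dots> \<le> (\<Sum>b\<in>?A. (k b + 1) * (w \<bullet> b)\<^sup>2)"
    proof (intro sum_mono mult_right_mono)
      fix b assume b: "b \<in> ?A"
      show "c1 \<le> k b + 1" using c1(2)[OF \<pi>J[OF b]] A2[OF \<pi>J[OF b]] by (simp add: k_def)
    qed simp
    also have "\<dots> = q w + r w" by (simp add: q_def r_def sum.distrib distrib_right)
    finally show ?thesis .
  qed
  \<comment> \<open>Independent of the index. It is integrable because the exponential decays along
    \<open>b0\<close> while the volume of the slices \<open>c1 * r w < w \<bullet> b0\<close> grows
    only like a power.\<close>
  define H where "H w = indicator {w. c1 * r w < w \<bullet> b0} w * (K * exp (- (a * c) * (w \<bullet> b0)))" for w
  have H_meas [measurable]: "H \<in> borel_measurable borel" unfolding H_def[abs_def] by measurable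
  have K0: "0 \<le> K" by (simp add: K_def)
  have dominated: "norm (F i (Z (\<tau> i) w)) \<le> H w" for i w
  proof (cases "Z (\<tau> i) w \<in> B")
    case True
    have "2 * R * (q w + r w) + sqrt (\<tau> i) * (w \<bullet> b0)\<^sup>2 < 2 * R * (w \<bullet> b0)"
      using True unfolding B_def Z_ball[OF \<tau>(1)] .
    moreover have "0 \<le> sqrt (\<tau> i) * (w \<bullet> b0)\<^sup>2" using \<tau>(1)[of i] by simp
    ultimately have "2 * R * (q w + r w) < 2 * R * (w \<bullet> b0)" by linarith
    then have "q w + r w < w \<bullet> b0" using R by simp
    then have D: "c1 * r w < w \<bullet> b0" using qr[of w] by linarith
    have z\<Omega>: "Z (\<tau> i) w \<in> \<Omega>" using True ball_subset by (auto simp: B_def)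
    have st: "0 < sqrt (\<tau> i)" using \<tau>(1) by simp
    have "((Z (\<tau> i) w - y) \<bullet> e) / sqrt (\<tau> i) = w \<bullet> b0" using Ze[of "\<tau> i" w] st by simp
    then have "u (Z (\<tau> i) w) (\<tau> i) \<le> C * exp (C * sqrt (\<tau> i) - c * (w \<bullet> b0))"
      using c(3)[of "Z (\<tau> i) w" "\<tau> i"] True \<tau>(1) by (simp add: B_def)
    also have "\<dots> \<le> C * exp (C * S - c * (w \<bullet> b0))" using c S[of i] by simp
    also have "\<dots> = (C * exp (C * S)) * exp (- c * (w \<bullet> b0))" by (simp add: exp_diff exp_minus divide_inverse)
    finally have le: "u (Z (\<tau> i) w) (\<tau> i) \<le> (C * exp (C * S)) * exp (- c * (w \<bullet> b0))" .
    have "pos_powr a (u (Z (\<tau> i) w) (\<tau> i) - \<epsilon> i) \<le> pos_powr a ((C * exp (C * S)) * exp (- c * (w \<bullet> b0)))"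
      using le \<epsilon>(1)[of i] by (intro pos_powr_mono a) linarith
    also have "\<dots> = K * exp (- (a * c) * (w \<bullet> b0))"
      using c(2) by (simp add: K_def powr_mult) (simp add: powr_def mult_ac)
    finally show ?thesis using True D by (simp add: F_def H_def)
  qed (simp add: F_def H_def K0)
  have H_int: "integrable lborel H"
  proof (rule integrableI_nonneg)
    have "(\<integral>\<^sup>+w. ennreal (H w) \<partial>lborel) =
       (\<integral>\<^sup>+w. ennreal (K * exp (- (a * c) * (w \<bullet> b0 - (\<Sum>b\<in>Basis - {b0}. 0 * (w \<bullet> b)\<^sup>2)))) *
         indicator {w. c1 * (\<Sum>b\<in>Basis - {b0}. (w \<bullet> b)\<^sup>2) < w \<bullet> b0 - (\<Sum>b\<in>Basis - {b0}. 0 * (w \<bullet> b)\<^sup>2)} w \<partial>lborel)"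
      by (intro nn_integral_cong) (auto simp: H_def r_def indicator_def)
    also have "\<dots> = ennreal (unit_ball_vol (real (DIM(real^'n) - 1))) *
      (\<integral>\<^sup>+\<sigma>. ennreal (K * exp (- (a * c) * \<sigma>)) * ennreal ((\<sigma> / c1) powr (real (DIM(real^'n) - 1) / 2)) * indicator {0<..} \<sigma> \<partial>lborel)"
      by (rule nn_integral_paraboloid[OF b0 c1(1)]) measurable
    also have "(\<integral>\<^sup>+\<sigma>. ennreal (K * exp (- (a * c) * \<sigma>)) * ennreal ((\<sigma> / c1) powr (real (DIM(real^'n) - 1) / 2)) * indicator {0<..} \<sigma> \<partial>lborel)
       = (\<integral>\<^sup>+\<sigma>. ennreal (K / c1 powr (real (n - 1) / 2)) * (ennreal (exp (- (a * c) * \<sigma>) * \<sigma> powr (real (n - 1) / 2)) * indicator {0<..} \<sigma>) \<partial>lborel)"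
      using c1(1) K0 by (intro nn_integral_cong)
        (auto simp: n_def indicator_def powr_divide ennreal_mult'[symmetric] ennreal_mult[symmetric] mult_ac)
    also have "\<dots> = ennreal (K / c1 powr (real (n - 1) / 2)) * (\<integral>\<^sup>+\<sigma>. ennreal (exp (- (a * c) * \<sigma>) * \<sigma> powr (real (n - 1) / 2)) * indicator {0<..} \<sigma> \<partial>lborel)"
      by (rule nn_integral_cmult) measurable
    also have "ennreal (unit_ball_vol (real (DIM(real^'n) - 1))) * \<dots> < \<infinity>"
      using nn_integral_powr_exp_finite[of "real (n - 1) / 2" "a * c"] a c(1)
      by (simp add: ennreal_mult_less_top)
    finally show "(\<integral>\<^sup>+w. ennreal (H w) \<partial>lborel) < \<infinity>" .
  qed (use K0 in \<open>auto simp: H_def intro!: AE_I2\<close>)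
  have "(\<lambda>i. LINT w|lborel. F i (Z (\<tau> i) w)) \<longlonglongrightarrow> (LINT w|lborel. G w)"
    by (rule integral_dominated_convergence[OF _ _ H_int]) (use pointwise dominated in \<open>auto intro!: AE_I2\<close>)
  then have lim: "(\<lambda>i. P * (LINT w|lborel. F i (Z (\<tau> i) w))) \<longlonglongrightarrow> P * (LINT w|lborel. G w)"
    by (intro tendsto_intros)
  have "(LINT w|lborel. G w) = enn2real (\<integral>\<^sup>+w. ennreal (G w) \<partial>lborel)"
    by (rule integral_eq_nn_integral) (auto simp: G_def)
  also have "(\<integral>\<^sup>+w. ennreal (G w) \<partial>lborel) =
     (\<integral>\<^sup>+w. ennreal (Erfc ((w \<bullet> b0 - (\<Sum>b\<in>Basis - {b0}. k b * (w \<bullet> b)\<^sup>2)) / (2 * sqrt \<alpha>)) powr a) *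
         indicator {w. 1 * (\<Sum>b\<in>Basis - {b0}. (w \<bullet> b)\<^sup>2) < w \<bullet> b0 - (\<Sum>b\<in>Basis - {b0}. k b * (w \<bullet> b)\<^sup>2)} w \<partial>lborel)"
    by (intro nn_integral_cong) (auto simp: G_def r_def q_def indicator_def)
  also have "\<dots> = ennreal (unit_ball_vol (real (DIM(real^'n) - 1))) *
      (\<integral>\<^sup>+\<sigma>. ennreal (Erfc (\<sigma> / (2 * sqrt \<alpha>)) powr a) * ennreal ((\<sigma> / 1) powr (real (DIM(real^'n) - 1) / 2)) * indicator {0<..} \<sigma> \<partial>lborel)"
    by (rule nn_integral_paraboloid[OF b0]) simp_all
  also have "(\<integral>\<^sup>+\<sigma>. ennreal (Erfc (\<sigma> / (2 * sqrt \<alpha>)) powr a) * ennreal ((\<sigma> / 1) powr (real (DIM(real^'n) - 1) / 2)) * indicator {0<..} \<sigma> \<partial>lborel)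
     = ennreal ((2 * sqrt \<alpha>) powr (real (n - 1) / 2 + 1) * erfc_moment a (real (n - 1) / 2))"
    using erfc_moment_scaled[OF a, of "real (n - 1) / 2" "2 * sqrt \<alpha>"] \<alpha> by (simp add: n_def)
  also have "real (n - 1) / 2 + 1 = (real n + 1) / 2" using n by (simp add: of_nat_diff field_simps)
  also have "real (n - 1) / 2 = (real n - 1) / 2" using n by (simp add: of_nat_diff)
  also have "enn2real (ennreal (unit_ball_vol (real (DIM(real^'n) - 1))) * ennreal ((2 * sqrt \<alpha>) powr ((real n + 1) / 2) * erfc_moment a ((real n - 1) / 2)))
     = unit_ball_vol (real (n - 1)) * ((2 * sqrt \<alpha>) powr ((real n + 1) / 2) * erfc_moment a ((real n - 1) / 2))"
    using erfc_moment_pos[OF a, of "(real n - 1) / 2"] n by (simp add: n_def enn2real_mult)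
  finally show ?thesis
    using lim unfolding transform[symmetric] by (simp only: n_def B_def \<alpha>_def P_def A_def)
qed

end

lemma powr_exp_inverse_sqrt_tendsto_0:
  fixes k C \<gamma> :: real
  assumes "0 < k"
  shows "((\<lambda>t. t powr \<gamma> * exp (C * sqrt t - k / sqrt t)) \<longlongrightarrow> 0) (at_right 0)"
  using assms by real_asymp

section \<open>Limits of the means\<close>

context touching_ball
begin

lemma measurable_slice:
  assumes "0 < t"
  shows "(\<lambda>z. u z t) \<in> borel_measurable (lebesgue_on (ball x R))"
  using ball_subset
  by (intro continuous_imp_measurable_on_sets_lebesgue continuous_on_subset[OF continuous_on_slice[OF assms]]) auto

lemma measure_touching_ball:
  "measure lebesgue (ball x R) = unit_ball_vol (real CARD('n)) * R ^ CARD('n)"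
  using R content_ball[of R x] by simp

lemma measure_touching_ball_pos: "0 < measure lebesgue (ball x R)"
proof -
  have "0 < unit_ball_vol (real CARD('n))" by (rule unit_ball_vol_pos) simp
  then show ?thesis unfolding measure_touching_ball using R by (intro mult_pos_pos) auto
qed

text \<open>Every point of the open ball has positive depth \<open>d\<close>, and
  \<open>exp (- c d / sqrt t)\<close> beats all powers of \<open>t\<close>. Hence at a fixed point
  the solution is negligible against the mean.\<close>

lemma power_decay:
  assumes z: "z \<in> ball x R"
  shows "((\<lambda>t. t powr \<gamma> * u z t) \<longlongrightarrow> 0) (at_right 0)"
proof -
  obtain c C where c: "0 < c" "0 < C"
    "\<And>z t. z \<in> ball x R \<Longrightarrow> 0 < t \<Longrightarrow> u z t \<le> C * exp (C * sqrt t - c * (((z - y) \<bullet> e) / sqrt t))"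
    using exponential_bound by metis
  define d where "d = (z - y) \<bullet> e"
  have "0 \<le> (norm (z - y))\<^sup>2" by simp
  then have "0 < 2 * R * d" using z unfolding mem_ball_iff d_def by (rule le_less_trans)
  then have d: "0 < d" using R by (simp add: zero_less_mult_iff)
  have "((\<lambda>t. C * (t powr \<gamma> * exp (C * sqrt t - c * d / sqrt t))) \<longlongrightarrow> C * 0) (at_right 0)"
    using c d by (intro tendsto_mult tendsto_const powr_exp_inverse_sqrt_tendsto_0) simp
  then have lim: "((\<lambda>t. C * (t powr \<gamma> * exp (C * sqrt t - c * d / sqrt t))) \<longlongrightarrow> 0) (at_right 0)" by simp
  show ?thesis
  proof (rule tendsto_sandwich[OF _ _ tendsto_const lim])
    have z\<Omega>: "z \<in> \<Omega>" using z ball_subset by blast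
    have "0 \<le> t powr \<gamma> * u z t \<and> t powr \<gamma> * u z t \<le> C * (t powr \<gamma> * exp (C * sqrt t - c * d / sqrt t))" if "0 < t" for t
    proof
      show "0 \<le> t powr \<gamma> * u z t" using u_range[OF z\<Omega> that] by simp
      have "t powr \<gamma> * u z t \<le> t powr \<gamma> * (C * exp (C * sqrt t - c * (d / sqrt t)))"
        unfolding d_def by (intro mult_left_mono c(3) z that) simp
      then show "t powr \<gamma> * u z t \<le> C * (t powr \<gamma> * exp (C * sqrt t - c * d / sqrt t))"
        by (simp add: mult_ac)
    qed
    then show "\<forall>\<^sub>F t in at_right 0. 0 \<le> t powr \<gamma> * u z t"
      "\<forall>\<^sub>F t in at_right 0. t powr \<gamma> * u z t \<le> C * (t powr \<gamma> * exp (C * sqrt t - c * d / sqrt t))"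
      by (auto simp: eventually_at_right_field intro!: exI[of _ 1])
  qed
qed

lemma curvature_product:
  "(\<Prod>j\<in>J. sqrt (2 / (1 / R - \<kappa> j))) = (2 * R) powr ((real CARD('n) - 1) / 2) * (\<Prod>j\<in>J. 1 - R * \<kappa> j) powr (- 1 / 2)"
  "0 < (\<Prod>j\<in>J. 1 - R * \<kappa> j)"
proof -
  have pos: "0 < 1 - R * \<kappa> j" if "j \<in> J" for j
    using curv[OF that] R by (simp add: pos_less_divide_eq mult.commute)
  show "0 < (\<Prod>j\<in>J. 1 - R * \<kappa> j)" using pos by (intro prod_pos) auto
  have prod_powr: "finite K \<Longrightarrow> K \<subseteq> J \<Longrightarrow> (\<Prod>j\<in>K. (1 - R * \<kappa> j) powr (- 1 / 2)) = (\<Prod>j\<in>K. 1 - R * \<kappa> j) powr (- 1 / 2)" for K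
  proof (induction K rule: finite_induct)
    case (insert j K)
    have "0 \<le> (\<Prod>j\<in>K. 1 - R * \<kappa> j)" using pos insert by (intro prod_nonneg) (auto simp: less_imp_le)
    then show ?case using insert pos[of j] by (simp add: powr_mult)
  qed simp
  have "sqrt (2 / (1 / R - \<kappa> j)) = (2 * R) powr (1 / 2) * (1 - R * \<kappa> j) powr (- 1 / 2)" if "j \<in> J" for j
  proof -
    have "2 / (1 / R - \<kappa> j) = 2 * R / (1 - R * \<kappa> j)" using R by (simp add: field_simps)
    then have "sqrt (2 / (1 / R - \<kappa> j)) = (2 * R / (1 - R * \<kappa> j)) powr (1 / 2)"
      using R pos[OF that] by (simp add: powr_half_sqrt)
    also have "\<dots> = (2 * R) powr (1 / 2) * (1 - R * \<kappa> j) powr (- (1 / 2))"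
      using R pos[OF that] by (simp add: powr_divide powr_minus_divide)
    finally show ?thesis by simp
  qed
  then have "(\<Prod>j\<in>J. sqrt (2 / (1 / R - \<kappa> j))) = (\<Prod>j\<in>J. (2 * R) powr (1 / 2) * (1 - R * \<kappa> j) powr (- 1 / 2))"
    by (intro prod.cong) auto
  also have "\<dots> = ((2 * R) powr (1 / 2)) ^ card J * (\<Prod>j\<in>J. 1 - R * \<kappa> j) powr (- 1 / 2)"
    using prod_powr[of J] by (simp add: prod.distrib)
  also have "((2 * R) powr (1 / 2)) ^ card J = (2 * R) powr ((real CARD('n) - 1) / 2)"
  proof -
    have "((2 * R) powr (1 / 2)) ^ card J = (2 * R) powr (1 / 2 * real (card J))"
      using R by (subst powr_realpow[symmetric]) (auto simp: powr_powr)
    also have "1 / 2 * real (card J) = (real CARD('n) - 1) / 2" using dim by (simp add: card_J of_nat_diff)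
    finally show ?thesis .
  qed
  finally show "(\<Prod>j\<in>J. sqrt (2 / (1 / R - \<kappa> j))) = (2 * R) powr ((real CARD('n) - 1) / 2) * (\<Prod>j\<in>J. 1 - R * \<kappa> j) powr (- 1 / 2)" .
qed

lemma q_mean_limit_finite:
  fixes q :: real
  assumes q: "1 < q"
  shows "((\<lambda>t. (R\<^sup>2 / t) powr ((real CARD('n) + 1) / (4 * (q - 1))) * q_mean (ereal q) (ball x R) (\<lambda>z. u z t))
     \<longlongrightarrow> (fact CARD('n) * erfc_moment (q - 1) ((real CARD('n) - 1) / 2) / (Gamma ((real CARD('n) + 1) / 2))\<^sup>2) powr (1 / (q - 1))
        * (conj_exponent p powr ((real CARD('n) + 1) / 2) * (\<Prod>j\<in>J. 1 - R * \<kappa> j)) powr (- 1 / (2 * (q - 1))))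
     (at_right 0)"
proof (rule tendsto_at_right_sequentially[of 0 1])
  \<comment> \<open>The dominated convergence arguments are sequential, so the limit is taken along
    an arbitrary positive null sequence.\<close>
  fix S :: "nat \<Rightarrow> real" assume S: "\<And>n. 0 < S n" "S \<longlonglongrightarrow> 0"
  define N where "N = CARD('n)"
  define a where "a = q - 1"
  have a: "0 < a" using q by (simp add: a_def)
  define \<alpha> where "\<alpha> = normal_coeff p"
  have \<alpha>: "0 < \<alpha>" unfolding \<alpha>_def by (rule normal_coeff_bounds[OF p])
  define I where "I = erfc_moment a ((real N - 1) / 2)"
  have I: "0 < I" unfolding I_def using a dim by (intro erfc_moment_pos) (auto simp: N_def)
  define \<rho> where "\<rho> = (\<Prod>j\<in>J. 1 - R * \<kappa> j)"
  have \<rho>: "0 < \<rho>" unfolding \<rho>_def by (rule curvature_product(2))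
  let ?B = "ball x R"
  define m where "m k = q_mean (ereal q) ?B (\<lambda>z. u z (S k))" for k
  define T where "T k = S k powr (- ((real N + 1) / 4))" for k
  define L where "L = (2 * R) powr ((real N - 1) / 2) * \<rho> powr (- 1 / 2) *
      (unit_ball_vol (real (N - 1)) * ((2 * sqrt \<alpha>) powr ((real N + 1) / 2) * I))"
  have vpos: "0 < unit_ball_vol (real (N - 1))" by (rule unit_ball_vol_pos) simp
  have L: "0 < L" unfolding L_def using R \<rho> I \<alpha> vpos by (intro mult_pos_pos) auto
  have fin: "finite_measure (lebesgue_on ?B)" by (rule finite_measure_lebesgue_on) simp
  have V: "measure (lebesgue_on ?B) (space (lebesgue_on ?B)) = unit_ball_vol (real N) * R ^ N"
    using measure_touching_ball by (simp add: measure_restrict_space N_def)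
  have rng: "0 \<le> u z t \<and> u z t \<le> 1" if "z \<in> ?B" "0 < t" for z t
    using u_range[of z t] that ball_subset by auto
  note qm = q_mean_finite_exponent[OF q _ measure_touching_ball_pos measurable_slice[OF S(1)] rng[OF _ S(1)], folded m_def a_def]
  have m: "0 \<le> m k" "m k \<le> 1" "(LINT z|lebesgue_on ?B. signed_powr a (u z (S k) - m k)) = 0" for k
    using qm[of k] by simp_all
  have Sright: "filterlim S (at_right 0) sequentially"
    unfolding filterlim_at using S by (auto intro!: always_eventually simp: less_imp_neq[symmetric])
  have "(\<lambda>k. T k * m k powr a) \<longlonglongrightarrow> L / measure (lebesgue_on ?B) (space (lebesgue_on ?B))"
  proof (rule finite_measure.signed_powr_root_asymptotics[OF fin a, where v="\<lambda>k z. u z (S k)"])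
    show "0 < measure (lebesgue_on ?B) (space (lebesgue_on ?B))"
      using measure_touching_ball_pos by (simp add: measure_restrict_space)
    show "(\<lambda>z. u z (S k)) \<in> borel_measurable (lebesgue_on ?B)" for k by (rule measurable_slice[OF S(1)])
    show "0 \<le> u z (S k) \<and> u z (S k) \<le> 1" if "z \<in> space (lebesgue_on ?B)" for k z
      using rng[OF _ S(1)] that by simp
    show "0 < T k" for k using S(1)[of k] by (simp add: T_def)
    show "(\<lambda>k. T k * (LINT z|lebesgue_on ?B. pos_powr a (u z (S k) - \<epsilon> k))) \<longlonglongrightarrow> L" if "\<And>k. 0 \<le> \<epsilon> k" "\<epsilon> \<longlonglongrightarrow> 0" for \<epsilon>
      using scaled_integral_limit[OF a S that]
      unfolding curvature_product(1) T_def L_def \<rho>_def N_def \<alpha>_def I_def .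
    show "(\<lambda>k. u z (S k)) \<longlonglongrightarrow> 0" if "z \<in> space (lebesgue_on ?B)" for z
      using that ball_subset by (intro filterlim_compose[OF initial_limit Sright]) auto
    show "(\<lambda>k. T k powr (1 / a) * u z (S k)) \<longlonglongrightarrow> 0" if "z \<in> space (lebesgue_on ?B)" for z
    proof -
      have "z \<in> ?B" using that by simp
      from filterlim_compose[OF power_decay[OF this, of "- ((real N + 1) / 4) * (1 / a)"] Sright]
      show ?thesis by (simp add: T_def powr_powr)
    qed
  qed (use m L in auto)
  then have lim: "(\<lambda>k. T k * m k powr a) \<longlonglongrightarrow> L / (unit_ball_vol (real N) * R ^ N)" unfolding V .
  define X where "X = fact N * I / (Gamma ((real N + 1) / 2))\<^sup>2"
  define Y where "Y = conj_exponent p powr ((real N + 1) / 2) * \<rho>"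
  have "0 < Gamma ((real N + 1) / 2)" by (rule Gamma_real_pos) simp
  then have X: "0 < X" unfolding X_def using I by (intro divide_pos_pos mult_pos_pos zero_less_power) auto
  have Y: "0 < Y" using \<alpha> \<rho> by (simp add: Y_def conj_exponent_eq[OF p] \<alpha>_def[symmetric])
  \<comment> \<open>\<open>T k * m k powr a\<close> tends to the layer integral divided by the
    volume of the ball. The power of \<open>R\<close> comes from \<open>R^2 / t\<close> in the
    theorem, raised to the power \<open>a\<close>.\<close>
  have const: "R powr ((real N + 1) / 2) * (L / (unit_ball_vol (real N) * R ^ N)) = X * Y powr (- 1 / 2)"
    using boundary_layer_constant[of N R \<rho> \<alpha> I] R \<rho> \<alpha> dim
    by (simp add: L_def X_def Y_def conj_exponent_eq[OF p] \<alpha>_def[symmetric] N_def)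
  have "(\<lambda>k. R powr ((real N + 1) / 2) * (T k * m k powr a)) \<longlonglongrightarrow> X * Y powr (- 1 / 2)"
    unfolding const[symmetric] by (intro tendsto_mult tendsto_const lim)
  then have "(\<lambda>k. (R powr ((real N + 1) / 2) * (T k * m k powr a)) powr (1 / a)) \<longlonglongrightarrow> (X * Y powr (- 1 / 2)) powr (1 / a)"
    using X Y by (intro tendsto_powr tendsto_const) auto
  also have "(X * Y powr (- 1 / 2)) powr (1 / a) = X powr (1 / a) * Y powr (- 1 / (2 * a))"
    using X Y a by (simp add: powr_mult powr_powr)
  also have "(\<lambda>k. (R powr ((real N + 1) / 2) * (T k * m k powr a)) powr (1 / a)) = (\<lambda>k. (R\<^sup>2 / S k) powr ((real N + 1) / (4 * a)) * m k)"
  proof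
    fix k
    have s: "0 < S k" by (rule S)
    have "(R powr ((real N + 1) / 2) * (T k * m k powr a)) powr (1 / a) =
       R powr ((real N + 1) / (2 * a)) * (S k powr (- ((real N + 1) / (4 * a))) * m k)"
      using a R s m(1)[of k] by (simp add: T_def powr_mult powr_powr)
    also have "R powr ((real N + 1) / (2 * a)) = (R\<^sup>2) powr ((real N + 1) / (4 * a))"
    proof -
      have "2 * ((real N + 1) / (4 * a)) = (real N + 1) / (2 * a)" using a by (simp add: field_simps)
      moreover have "R\<^sup>2 = R powr 2" using R by simp
      ultimately show ?thesis by (simp only: powr_powr)
    qed
    also have "\<dots> * (S k powr (- ((real N + 1) / (4 * a))) * m k) = (R\<^sup>2 / S k) powr ((real N + 1) / (4 * a)) * m k"
      using R s by (simp add: powr_divide powr_minus_divide)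
    finally show "(R powr ((real N + 1) / 2) * (T k * m k powr a)) powr (1 / a) = (R\<^sup>2 / S k) powr ((real N + 1) / (4 * a)) * m k" .
  qed
  finally show "(\<lambda>k. (R\<^sup>2 / S k) powr ((real CARD('n) + 1) / (4 * (q - 1))) * q_mean (ereal q) (ball x R) (\<lambda>z. u z (S k)))
     \<longlonglongrightarrow> (fact CARD('n) * erfc_moment (q - 1) ((real CARD('n) - 1) / 2) / (Gamma ((real CARD('n) + 1) / 2))\<^sup>2) powr (1 / (q - 1))
        * (conj_exponent p powr ((real CARD('n) + 1) / 2) * (\<Prod>j\<in>J. 1 - R * \<kappa> j)) powr (- 1 / (2 * (q - 1)))"
    unfolding X_def Y_def I_def \<rho>_def N_def a_def m_def .
qed simp

text \<open>The solution is continuous up to \<open>y\<close>, where its value is 1, and the ball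
  contains an initial piece of the inner normal from \<open>y\<close>.\<close>

lemma Sup_slice:
  assumes t: "0 < t"
  shows "Sup ((\<lambda>z. u z t) ` ball x R) = 1"
proof (rule cSup_eq_non_empty)
  show "(\<lambda>z. u z t) ` ball x R \<noteq> {}" using R by simp
  show "w \<le> 1" if "w \<in> (\<lambda>z. u z t) ` ball x R" for w
    using that u_range(2)[OF _ t] ball_subset by auto
  fix b assume b: "\<And>w. w \<in> (\<lambda>z. u z t) ` ball x R \<Longrightarrow> w \<le> b"
  define Z where "Z s = y + s *\<^sub>R e" for s
  have "Z s \<in> ball x R" if "0 < s" "s < 2 * R" for s
  proof -
    have "(norm (s *\<^sub>R e))\<^sup>2 = s * s" using unit that by (simp add: power2_eq_square)
    then show ?thesis unfolding mem_ball_iff Z_def using that ee by simp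
  qed
  then have ev: "\<forall>\<^sub>F s in at_right 0. Z s \<in> ball x R"
    unfolding eventually_at_right_field using R by (intro exI[of _ "2 * R"]) auto
  have "((\<lambda>s. y + s *\<^sub>R e) \<longlongrightarrow> y + 0 *\<^sub>R e) (at_right 0)" by (intro tendsto_intros)
  then have "(Z \<longlongrightarrow> y) (at_right 0)" by (simp add: Z_def[abs_def])
  moreover have "\<forall>\<^sub>F s in at_right 0. Z s \<in> \<Omega> \<union> frontier \<Omega>"
    using ev by eventually_elim (use ball_subset in auto)
  ultimately have "((\<lambda>s. u (Z s) t) \<longlongrightarrow> u y t) (at_right 0)"
    using yfr by (intro continuous_on_tendsto_compose[OF continuous_on_slice[OF t]]) auto
  moreover have "u y t = 1" using sol yfr t by (simp add: bounded_viscosity_solution_01_def)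
  moreover have "\<forall>\<^sub>F s in at_right 0. u (Z s) t \<le> b" using ev by eventually_elim (use b in auto)
  ultimately show "1 \<le> b" using tendsto_upperbound[of "\<lambda>s. u (Z s) t" 1 "at_right 0" b] by simp
qed

text \<open>The infimum is squeezed between 0 and the value at the centre \<open>x\<close>, which
  tends to the initial value.\<close>

lemma q_mean_limit_infinity:
  "((\<lambda>t. q_mean \<infinity> (ball x R) (\<lambda>z. u z t)) \<longlongrightarrow> 1 / 2) (at_right 0)"
proof -
  let ?I = "\<lambda>t. Inf ((\<lambda>z. u z t) ` ball x R)"
  have xB: "x \<in> ball x R" using R by simp
  have "0 \<le> ?I t \<and> ?I t \<le> u x t \<and> q_mean \<infinity> (ball x R) (\<lambda>z. u z t) = (1 + ?I t) / 2" if t: "0 < t" for t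
  proof (intro conjI)
    have rng: "0 \<le> u z t" "u z t \<le> 1" if "z \<in> ball x R" for z
      using u_range[OF _ t] that ball_subset by auto
    show "0 \<le> ?I t" using rng xB by (intro cINF_greatest) auto
    show "?I t \<le> u x t" using rng xB by (intro cINF_lower bdd_belowI2[of _ 0])
    have "bounded ((\<lambda>z. u z t) ` ball x R)" using rng by (intro boundedI[of _ 1]) auto
    then show "q_mean \<infinity> (ball x R) (\<lambda>z. u z t) = (1 + ?I t) / 2"
      using ball_subset R Sup_slice[OF t]
      by (subst q_mean_infinity) (auto intro!: continuous_on_subset[OF continuous_on_slice[OF t]])
  qed
  then have ev: "\<forall>\<^sub>F t in at_right 0. 0 \<le> ?I t \<and> ?I t \<le> u x t \<and> q_mean \<infinity> (ball x R) (\<lambda>z. u z t) = (1 + ?I t) / 2"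
    by (auto simp: eventually_at_right_field intro!: exI[of _ 1])
  have "(?I \<longlongrightarrow> 0) (at_right 0)"
  proof (rule tendsto_sandwich[OF _ _ tendsto_const])
    show "((\<lambda>t. u x t) \<longlongrightarrow> 0) (at_right 0)" using initial_limit xB ball_subset by blast
  qed (use ev in \<open>auto elim: eventually_mono\<close>)
  then have "((\<lambda>t. (1 + ?I t) / 2) \<longlongrightarrow> (1 + 0) / 2) (at_right 0)" by (intro tendsto_intros) auto
  moreover have "\<forall>\<^sub>F t in at_right 0. (1 + ?I t) / 2 = q_mean \<infinity> (ball x R) (\<lambda>z. u z t)"
    using ev by eventually_elim simp
  ultimately show ?thesis using Lim_transform_eventually by fastforce
qed

end

theorem theorem4p7:
  fixes \<Omega> :: "(real^'n) set"
    and x y :: "real^'n"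
    and R :: real
    and \<kappa> :: "nat \<Rightarrow> real"
    and p :: ereal
    and u :: "real^'n \<Rightarrow> real \<Rightarrow> real"
  defines "N \<equiv> CARD('n)"
  assumes "N \<ge> 2"
    and "C2_domain \<Omega>"
    and "x \<in> \<Omega>"
    and "R > 0"
    and "y \<in> frontier \<Omega>"
    and "cball x R \<inter> (UNIV - \<Omega>) = {y}"
    and "principal_curvatures \<Omega> y \<kappa>"
    and "\<forall>j\<in>{1..N - 1}. \<kappa> j < 1 / R"
    and "1 < p"
    and "bounded_viscosity_solution_01 p \<Omega> u"
  shows "(\<forall>q::real. 1 < q \<longrightarrow>
      ((\<lambda>t. (R\<^sup>2 / t) powr ((real N + 1) / (4 * (q - 1)))
              * q_mean (ereal q) (ball x R) (\<lambda>z. u z t))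
        \<longlongrightarrow>
        (fact N * (LBINT \<sigma>:{0..}. Erfc \<sigma> powr (q - 1) * \<sigma> powr ((real N - 1) / 2))
            / (Gamma ((real N + 1) / 2))\<^sup>2) powr (1 / (q - 1))
        * (conj_exponent p powr ((real N + 1) / 2) * (\<Prod>j=1..N - 1. 1 - R * \<kappa> j))
            powr (- 1 / (2 * (q - 1))))
      (at_right 0)) \<and>
    ((\<lambda>t. q_mean \<infinity> (ball x R) (\<lambda>z. u z t)) \<longlongrightarrow> 1 / 2) (at_right 0)"
proof -
  have N: "2 \<le> CARD('n)" using assms(2) by (simp add: N_def)
  obtain e g v where frame: "curvature_frame \<Omega> y e g v \<kappa> {1..CARD('n) - 1}"
    using curvature_frame_exists[OF N assms(3,6,8)] by metis
  interpret touching_ball \<Omega> y e g v \<kappa> "{1..CARD('n) - 1}" x R p u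
    by (intro touching_ball.intro frame touching_ball_axioms.intro) (use assms in \<open>auto simp: N_def\<close>)
  show ?thesis
    unfolding N_def erfc_moment_def[symmetric] using q_mean_limit_finite q_mean_limit_infinity by blast
qed

end
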